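(* Let $(\Omega_t)$ be an L-admissible family. Then the following two statements are equivalent: (i) there exists a Goryainov–Ba evolution family $(\varphi_{s,t})$ and a Loewner chain $(f_t)$ associated with $(\varphi_{s,t})$ such that $\{f_t(\mathbb{D}):t\ge0\}=\{\Omega_t:t\ge0\}$ (equality of sets of domains); (ii) there exists a family $(F_t)_{t\ge0}$ of univalent functions in the unit disk $\mathbb{D}$ such that $F_t(\mathbb{D})=\Omega_t$ and $F_t^{-1}\circ F_0\in\tilde{\mathcal{C}}$ for all $t\ge0$.
   Context: $\mathbb{D}=\{z:|z|<1\}$, $\mathbb{H}=\{z:\mathrm{Im}\,z>0\}$; $\angle\lim$ denotes angular (non-tangential) limit. $H(\zeta):=i\frac{1+\zeta}{1-\zeta}$ is the Cayley map of $\mathbb{D}$ onto $\mathbb{H}$. $AC^d([0,+\infty),\mathbb{R})$ is the class of locally absolutely continuous $f$ with $f'\in L^d_{loc}$. $r(D,z)$ is the conformal radius of a simply connected domain $D\subsetneq\mathbb{C}$ with respect to $z\in D$: $r(D,z)=|f'(0)|$ for $f$ a conformal map of $\mathbb{D}$ onto $D$ with $f(0)=z$. L-admissible family of order $d\in[1,+\infty]$: a family $(\Omega_t)_{t\ge0}$ of simply connected domains $\Omega_t\subset\mathbb{C}$ such that (AF1) $\Omega_s\subset\Omega_t\ne\mathbb{C}$ whenever $t\ge s\ge0$; (AF2) there is $w_*\in\Omega_0$ such that $t\mapsto r(\Omega_t,w_* )$ belongs to $AC^d([0,+\infty),\mathbb{R})$. Evolution family of order $d\in[1,+\infty]$: a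 family $(\varphi_{s,t})_{0\le s\le t<+\infty}$ of holomorphic self-maps of $\mathbb{D}$ with (EF1) $\varphi_{s,s}=\mathrm{id}_{\mathbb{D}}$; (EF2) $\varphi_{s,t}=\varphi_{u,t}\circ\varphi_{s,u}$ for $0\le s\le u\le t$; (EF3) for all $z\in\mathbb{D}$, $T>0$ there is a non-negative $k_{z,T}\in L^d([0,T],\mathbb{R})$ with $|\varphi_{s,u}(z)-\varphi_{s,t}(z)|\le\int_u^t k_{z,T}(\xi)\,d\xi$ for $0\le s\le u\le t\le T$. Loewner chain of order $d\in[1,+\infty]$: a family $(f_t)_{t\ge0}$ of holomorphic maps $f_t:\mathbb{D}\to\mathbb{C}$ such that (LC1) each $f_t$ is univalent; (LC2) $f_s(\mathbb{D})\subset f_t(\mathbb{D})$ for $0\le s\le t$; (LC3) for any compact $K\subset\mathbb{D}$ and $T>0$ there is a non-negative $k_{K,T}\in L^d([0,T],\mathbb{R})$ with $|f_s(z)-f_t(z)|\le\int_s^t k_{K,T}(\xi)\,d\xi$ for all $z\in K$, $0\le s\le t\le T$. $(f_t)$ is associated with $(\varphi_{s,t})$ if $f_t\circ\varphi_{s,t}=f_s$ for all $0\le s\le t$. L-admissible families, evolution families and Loewner chains without specified order are those of some order $d\in[1,+\infty]$. $\mathfrak{P}_0$ is the class of all univalent holomorphic $G:\mathbb{H}\to\mathbb{H}$ for which there is $C>0$ with $|G(z)-z|\le C/\mathrm{Im}\,z$ for all $z\in\mathbb{H}$; $\ell(G)$ denotes the minimal constant $C$ for which this estimate holds ($\ell(\mathrm{id})=0$).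 $\mathcal{P}_0:=\{H^{-1}\circ G\circ H:G\in\mathfrak{P}_0\}$, and $\ell(\varphi):=\ell(H\circ\varphi\circ H^{-1})$ for $\varphi\in\mathcal{P}_0$. A Goryainov–Ba evolution family is an evolution family $(\varphi_{s,t})$ contained in $\mathcal{P}_0$ such that $t\mapsto\ell(\varphi_{0,t})$ is locally absolutely continuous on $[0,+\infty)$. $\mathcal{C}$ is the class of all univalent holomorphic $\varphi:\mathbb{D}\to\mathbb{D}$ with $\angle\lim_{z\to1}\varphi(z)=1$ and $\varphi'(1):=\angle\lim_{z\to1}\frac{\varphi(z)-1}{z-1}<\infty$. $\tilde{\mathcal{C}}$ is the class of all $\varphi\in\mathcal{C}$ such that $\varphi^{(j)}(1)\neq\infty$ exists in the angular sense (finite angular limit of $\varphi^{(j)}$ at $1$) for $j=1,2,3$ and $\mathrm{Re}\,\varphi''(1)=\varphi'(1)(\varphi'(1)-1)$; the last condition means exactly that the coefficient $b$ in the expansion $(H\circ\varphi\circ H^{-1})(z)=az+b+\frac cz+\gamma(z)$, $\angle\lim_{z\to\infty}z\gamma(z)=0$, is real. *)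

theory Defs
  imports "HOL-Complex_Analysis.Complex_Analysis"
begin

definition abs_continuous_on :: "real set \<Rightarrow> (real \<Rightarrow> real) \<Rightarrow> bool" where
  "abs_continuous_on S f \<longleftrightarrow>
     (\<forall>\<epsilon>>0. \<exists>\<delta>>0. \<forall>(n::nat) a b.
        (\<forall>i<n. a i \<le> b i \<and> {a i..b i} \<subseteq> S) \<and>
        (\<forall>i<n. \<forall>j<n. i \<noteq> j \<longrightarrow> {a i<..<b i} \<inter> {a j<..<b j} = {}) \<and>
        (\<Sum>i<n. b i - a i) < \<delta>
        \<longrightarrow> (\<Sum>i<n. \<bar>f (b i) - f (a i)\<bar>) < \<epsilon>)"

definition loc_abs_continuous :: "(real \<Rightarrow> real) \<Rightarrow> bool" where
  "loc_abs_continuous f \<longleftrightarrow> (\<forall>T>0. abs_continuous_on {0..T} f)"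

definition L_space :: "ereal \<Rightarrow> real set \<Rightarrow> (real \<Rightarrow> real) \<Rightarrow> bool" where
  "L_space d S k \<longleftrightarrow>
     k \<in> borel_measurable (lebesgue_on S) \<and>
     (if d = \<infinity> then (\<exists>C. AE x in lebesgue_on S. \<bar>k x\<bar> \<le> C)
      else integrable (lebesgue_on S) (\<lambda>x. \<bar>k x\<bar> powr real_of_ereal d))"

text \<open>A locally absolutely continuous function is differentiable almost everywhere, so the
  arbitrary values of \<^const>\<open>deriv\<close> at the remaining points do not matter.\<close>

definition AC_order :: "ereal \<Rightarrow> (real \<Rightarrow> real) \<Rightarrow> bool" where
  "AC_order d f \<longleftrightarrow> loc_abs_continuous f \<and> (\<forall>T>0. L_space d {0..T} (deriv f))"

text \<open>All functions are total; those defined mathematically on the unit disk or the half-plane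
  are unconstrained elsewhere, and every notion below depends only on the values there.\<close>

abbreviation unit_disk :: "complex set"  ("\<D>")
  where "\<D> \<equiv> ball 0 1"

definition upper_half_plane :: "complex set"  ("\<H>")
  where "\<H> = {z. 0 < Im z}"

definition cayley :: "complex \<Rightarrow> complex" where
  "cayley \<zeta> = \<i> * (1 + \<zeta>) / (1 - \<zeta>)"

abbreviation cayley_inv :: "complex \<Rightarrow> complex" where
  "cayley_inv \<equiv> inv_into \<D> cayley"

definition univalent_on :: "complex set \<Rightarrow> (complex \<Rightarrow> complex) \<Rightarrow> bool" where
  "univalent_on S f \<longleftrightarrow> f holomorphic_on S \<and> inj_on f S"

text \<open>The conformal radius is well defined for a simply connected domain \<open>U \<noteq> UNIV\<close> containing
  \<open>z\<close>: the map \<open>f\<close> exists and is unique up to a rotation of the disk.\<close>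

definition conformal_radius :: "complex set \<Rightarrow> complex \<Rightarrow> real" where
  "conformal_radius U z =
     (THE r. \<exists>f. univalent_on \<D> f \<and> f ` \<D> = U \<and> f 0 = z \<and> r = cmod (deriv f 0))"

text \<open>Intended for \<open>cmod \<sigma> = 1\<close>; the sets in the definition are the Stolz regions at \<open>\<sigma>\<close>.\<close>

definition has_angular_lim ::
    "(complex \<Rightarrow> complex) \<Rightarrow> complex \<Rightarrow> complex \<Rightarrow> bool" where
  "has_angular_lim f \<sigma> L \<longleftrightarrow>
     (\<forall>M>1. (f \<longlongrightarrow> L) (at \<sigma> within {z \<in> \<D>. cmod (\<sigma> - z) < M * (1 - cmod z)}))"

definition has_angular_deriv ::
    "(complex \<Rightarrow> complex) \<Rightarrow> complex \<Rightarrow> complex \<Rightarrow> complex \<Rightarrow> bool" where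
  "has_angular_deriv f \<sigma> w a \<longleftrightarrow> has_angular_lim (\<lambda>z. (f z - w) / (z - \<sigma>)) \<sigma> a"

definition simply_connected_domain :: "complex set \<Rightarrow> bool" where
  "simply_connected_domain U \<longleftrightarrow> open U \<and> U \<noteq> {} \<and> simply_connected U"

definition L_admissible_order :: "ereal \<Rightarrow> (real \<Rightarrow> complex set) \<Rightarrow> bool" where
  "L_admissible_order d \<Omega> \<longleftrightarrow>
     (\<forall>t\<ge>0. simply_connected_domain (\<Omega> t)) \<and>
     (\<forall>s t. 0 \<le> s \<and> s \<le> t \<longrightarrow> \<Omega> s \<subseteq> \<Omega> t \<and> \<Omega> t \<noteq> UNIV) \<and>
     (\<exists>w\<in>\<Omega> 0. AC_order d (\<lambda>t. conformal_radius (\<Omega> t) w))"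

definition L_admissible :: "(real \<Rightarrow> complex set) \<Rightarrow> bool" where
  "L_admissible \<Omega> \<longleftrightarrow> (\<exists>d\<ge>1. L_admissible_order d \<Omega>)"

definition evolution_family_order ::
    "ereal \<Rightarrow> (real \<Rightarrow> real \<Rightarrow> complex \<Rightarrow> complex) \<Rightarrow> bool" where
  "evolution_family_order d \<phi> \<longleftrightarrow>
     (\<forall>s t. 0 \<le> s \<and> s \<le> t \<longrightarrow> \<phi> s t holomorphic_on \<D> \<and> \<phi> s t ` \<D> \<subseteq> \<D>) \<and>
     (\<forall>s\<ge>0. \<forall>z\<in>\<D>. \<phi> s s z = z) \<and>
     (\<forall>s u t. 0 \<le> s \<and> s \<le> u \<and> u \<le> t \<longrightarrow> (\<forall>z\<in>\<D>. \<phi> s t z = \<phi> u t (\<phi> s u z))) \<and>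
     (\<forall>z\<in>\<D>. \<forall>T>0. \<exists>k. (\<forall>\<xi>\<in>{0..T}. 0 \<le> k \<xi>) \<and> L_space d {0..T} k \<and>
        (\<forall>s u t. 0 \<le> s \<and> s \<le> u \<and> u \<le> t \<and> t \<le> T \<longrightarrow>
           cmod (\<phi> s u z - \<phi> s t z) \<le> (LINT \<xi>:{u..t}|lebesgue. k \<xi>)))"

definition evolution_family :: "(real \<Rightarrow> real \<Rightarrow> complex \<Rightarrow> complex) \<Rightarrow> bool" where
  "evolution_family \<phi> \<longleftrightarrow> (\<exists>d\<ge>1. evolution_family_order d \<phi>)"

definition Loewner_chain_order ::
    "ereal \<Rightarrow> (real \<Rightarrow> complex \<Rightarrow> complex) \<Rightarrow> bool" where
  "Loewner_chain_order d f \<longleftrightarrow>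
     (\<forall>t\<ge>0. univalent_on \<D> (f t)) \<and>
     (\<forall>s t. 0 \<le> s \<and> s \<le> t \<longrightarrow> f s ` \<D> \<subseteq> f t ` \<D>) \<and>
     (\<forall>K T. compact K \<and> K \<subseteq> \<D> \<and> 0 < T \<longrightarrow>
        (\<exists>k. (\<forall>\<xi>\<in>{0..T}. 0 \<le> k \<xi>) \<and> L_space d {0..T} k \<and>
           (\<forall>z\<in>K. \<forall>s t. 0 \<le> s \<and> s \<le> t \<and> t \<le> T \<longrightarrow>
              cmod (f s z - f t z) \<le> (LINT \<xi>:{s..t}|lebesgue. k \<xi>))))"

definition Loewner_chain :: "(real \<Rightarrow> complex \<Rightarrow> complex) \<Rightarrow> bool" where
  "Loewner_chain f \<longleftrightarrow> (\<exists>d\<ge>1. Loewner_chain_order d f)"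

definition associated_with ::
    "(real \<Rightarrow> complex \<Rightarrow> complex) \<Rightarrow> (real \<Rightarrow> real \<Rightarrow> complex \<Rightarrow> complex) \<Rightarrow> bool" where
  "associated_with f \<phi> \<longleftrightarrow>
     (\<forall>s t. 0 \<le> s \<and> s \<le> t \<longrightarrow> (\<forall>z\<in>\<D>. f t (\<phi> s t z) = f s z))"

definition frakP0 :: "(complex \<Rightarrow> complex) set" where
  "frakP0 = {G. univalent_on \<H> G \<and> G ` \<H> \<subseteq> \<H> \<and>
                (\<exists>C>0. \<forall>z\<in>\<H>. cmod (G z - z) \<le> C / Im z)}"

text \<open>The least constant exists for every member of \<^const>\<open>frakP0\<close>; it is automatically
  nonnegative, and it is \<open>0\<close> for the identity.\<close>

definition ell_half_plane :: "(complex \<Rightarrow> complex) \<Rightarrow> real" where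
  "ell_half_plane G = (LEAST C. \<forall>z\<in>\<H>. cmod (G z - z) \<le> C / Im z)"

definition calP0 :: "(complex \<Rightarrow> complex) set" where
  "calP0 = {\<phi>. \<exists>G\<in>frakP0. \<forall>z\<in>\<D>. \<phi> z = (cayley_inv \<circ> G \<circ> cayley) z}"

definition ell :: "(complex \<Rightarrow> complex) \<Rightarrow> real" where
  "ell \<phi> = ell_half_plane (cayley \<circ> \<phi> \<circ> cayley_inv)"

definition Goryainov_Ba :: "(real \<Rightarrow> real \<Rightarrow> complex \<Rightarrow> complex) \<Rightarrow> bool" where
  "Goryainov_Ba \<phi> \<longleftrightarrow>
     evolution_family \<phi> \<and>
     (\<forall>s t. 0 \<le> s \<and> s \<le> t \<longrightarrow> \<phi> s t \<in> calP0) \<and>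
     loc_abs_continuous (\<lambda>t. ell (\<phi> 0 t))"

text \<open>By the Julia--Wolff--Caratheodory theorem the angular derivative at \<open>1\<close> always exists as an
  element of \<open>(0, \<infinity>]\<close>, so its finiteness amounts to the existence of the limit in the complex
  plane; the limit is then a positive real number. In particular the right-hand side of the last
  condition in \<open>calC_tilde\<close> is real.\<close>

definition calC :: "(complex \<Rightarrow> complex) set" where
  "calC = {\<phi>. univalent_on \<D> \<phi> \<and> \<phi> ` \<D> \<subseteq> \<D> \<and>
              has_angular_lim \<phi> 1 1 \<and> (\<exists>a. has_angular_deriv \<phi> 1 1 a)}"

definition calC_tilde :: "(complex \<Rightarrow> complex) set" where
  "calC_tilde = {\<phi> \<in> calC.
     (\<forall>j\<in>{1, 2, 3}. \<exists>p. has_angular_lim ((deriv ^^ j) \<phi>) 1 p) \<and>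
     (\<exists>a p. has_angular_deriv \<phi> 1 1 a \<and> has_angular_lim ((deriv ^^ 2) \<phi>) 1 p \<and>
            complex_of_real (Re p) = a * (a - 1))}"

end

theory Submission
  imports Defs
begin

text \<open>
  Everything is transported to the upper half-plane by the Cayley map, so that the boundary point
  \<open>1\<close> becomes \<open>\<infinity>\<close>. Two consequences of the Schwarz lemma carry the argument: the inequality of
  Julia, which yields the Julia--Wolff--Caratheodory theorem
  (lemma \<open>julia_wolff_caratheodory\<close>), and the equality case, which forces isometries.

  A self-map \<open>G\<close> of the half-plane is called hydrodynamic with constant \<open>l\<close> if
  \<open>G z = z - l / z + o(1 / z)\<close> nontangentially at \<open>\<infinity>\<close> and \<open>\<bar>G z - z\<bar> \<le> l / Im z\<close> everywhere; then
  \<open>l\<close> is the best constant. These two properties come from one very weak hypothesis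
  (lemma \<open>hydrodynamicI\<close>): a bound \<open>\<bar>G z - z\<bar> \<le> C / \<bar>z\<bar>\<close> along some nontangential approach to \<open>\<infinity>\<close>.
  Indeed \<open>p = G - id\<close> then maps into the closed half-plane, and the Julia--Wolff--Caratheodory
  theorem for \<open>q = - 1 / p\<close> turns the behaviour of \<open>q z / z\<close> at \<open>\<infinity>\<close> into the inequality
  \<open>Im z \<le> l * Im (q z)\<close>, which bounds \<open>p\<close> on the whole half-plane.

  (i) implies (ii): the ordered sets of domains being equal, \<open>F t\<close> can be chosen among the
  functions \<open>f \<tau>\<close>, with \<open>F 0 = f 0\<close>, so that \<open>(F t)\<inverse> \<circ> F 0\<close> is one of the maps \<open>\<phi> 0 \<tau>\<close>. It remains
  to see that the class \<open>calP0\<close> is contained in \<open>calC_tilde\<close>: in the disk the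
  hydrodynamic expansion reads \<open>\<phi> z = z + (l / 4) * (1 - z)^3 + o((1 - z)^3)\<close>, and Cauchy estimates allow
  it to be differentiated three times in Stolz regions.

  (ii) implies (i): Taylor's formula along the radius shows that a member of \<open>calC_tilde\<close> is, in the
  half-plane, of the form \<open>w / A + b + O(1 / w)\<close> along the imaginary axis, and \<open>b\<close> is real precisely
  because of the condition on the second derivative. Composing \<open>F t\<close> with a real affine map
  makes \<open>g t = (F t)\<inverse> \<circ> F 0\<close> hydrodynamic with a constant \<open>l t\<close>. The transition maps
  \<open>(F t)\<inverse> \<circ> F s\<close> satisfy \<open>G (g s z) = g t z\<close>, so they are hydrodynamic with constant
  \<open>l t - l s\<close> (lemma \<open>hydrodynamic_cancel\<close>), and \<open>l\<close> is nondecreasing.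

  The function \<open>l\<close> need not be absolutely continuous, and this is why (i) only asks for equality of
  the sets of domains. It is continuous, however. As the conformal radius is continuous in
  time, the transition maps between times close to \<open>t0\<close> are almost hyperbolic isometries; by Montel's
  theorem and the equality case of the Schwarz lemma they tend to isometries, and the identity is the
  only isometry that is hydrodynamically normalised. Hence \<open>g t\<close> depends continuously on \<open>t\<close>.
  Since \<open>l t\<close> is the least constant in an estimate that survives pointwise limits, it is lower
  semicontinuous, which together with monotonicity excludes jumps to the left; applying
  the same to the transition maps from \<open>t0\<close> to a fixed later time excludes jumps to the right.

  Finally let \<open>u\<close> be the inverse of the increasing homeomorphism
  \<open>t \<mapsto> t + (l t - l 0)\<close> of \<open>[0, \<infinity>)\<close>. In the new time \<open>\<sigma>\<close> the constant \<open>l (u \<sigma>)\<close> is Lipschitz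
  with constant 1, and all the estimates required of evolution families and Loewner chains
  hold with constant majorants, so the order \<open>\<infinity>\<close> is attained.
\<close>

section \<open>Conformal charts of the half-plane\<close>

lemma upper_half_plane_iff [simp]: "z \<in> \<H> \<longleftrightarrow> 0 < Im z"
  by (simp add: upper_half_plane_def)

lemma open_upper_half_plane: "open \<H>"
  unfolding upper_half_plane_def by (rule open_halfspace_Im_gt)

text \<open>The conformal map of the half-plane onto the disk that sends \<open>a\<close> to \<open>0\<close>, and below its inverse,
  written as a real affine map after the Cayley map.\<close>

definition disk_chart :: "complex \<Rightarrow> complex \<Rightarrow> complex" where
  "disk_chart a w = (w - a) / (w - cnj a)"

definition half_plane_chart :: "complex \<Rightarrow> complex \<Rightarrow> complex" where
  "half_plane_chart a \<zeta> = of_real (Re a) + of_real (Im a) * cayley \<zeta>"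

text \<open>This identity converts distances to \<open>w\<close> and to its mirror image into imaginary parts; it is the
  only computation behind the Schwarz--Pick and Julia inequalities.\<close>

lemma norm_diff_cnj_squared:
  "(cmod (z - cnj w))\<^sup>2 = (cmod (z - w))\<^sup>2 + 4 * Im z * Im w"
  unfolding cmod_power2 by (simp add: power2_eq_square algebra_simps)

lemma diff_cnj_nonzero: "0 < Im z \<Longrightarrow> 0 < Im w \<Longrightarrow> z - cnj w \<noteq> 0"
  by (auto simp: complex_eq_iff)

lemma disk_chart_in_disk:
  assumes "0 < Im a" "0 < Im w"
  shows "disk_chart a w \<in> \<D>"
proof -
  have "(cmod (w - a))\<^sup>2 < (cmod (w - cnj a))\<^sup>2"
    using assms norm_diff_cnj_squared[of w a] by simp
  then have "cmod (w - a) < cmod (w - cnj a)"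
    by (simp add: power_less_imp_less_base)
  then show ?thesis
    using diff_cnj_nonzero[OF assms(2,1)] by (simp add: disk_chart_def norm_divide divide_simps)
qed

lemma Im_cayley: "Im (cayley \<zeta>) = (1 - (cmod \<zeta>)\<^sup>2) / (cmod (1 - \<zeta>))\<^sup>2"
  unfolding cayley_def cmod_power2
  by (simp add: Im_divide power2_eq_square algebra_simps)

lemma one_minus_nonzero: "\<zeta> \<in> \<D> \<Longrightarrow> 1 - \<zeta> \<noteq> 0"
  by auto

lemma cayley_in_half_plane:
  assumes "\<zeta> \<in> \<D>"
  shows "0 < Im (cayley \<zeta>)"
proof -
  have "(cmod \<zeta>)\<^sup>2 < 1"
    using assms by (simp add: abs_square_less_1)
  then show ?thesis
    using one_minus_nonzero[OF assms] by (simp add: Im_cayley)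
qed

lemma half_plane_chart_in_half_plane:
  "0 < Im a \<Longrightarrow> \<zeta> \<in> \<D> \<Longrightarrow> 0 < Im (half_plane_chart a \<zeta>)"
  using cayley_in_half_plane by (simp add: half_plane_chart_def)

lemma half_plane_chart_eq:
  assumes "1 - \<zeta> \<noteq> 0"
  shows "half_plane_chart a \<zeta> = cnj a + 2 * \<i> * of_real (Im a) / (1 - \<zeta>)"
proof -
  have c: "cnj a = of_real (Re a) - \<i> * of_real (Im a)" by (simp add: complex_eq_iff)
  show ?thesis
    unfolding half_plane_chart_def cayley_def c using assms by (simp add: field_simps)
qed

lemma disk_chart_half_plane_chart:
  assumes "0 < Im a" "\<zeta> \<in> \<D>"
  shows "disk_chart a (half_plane_chart a \<zeta>) = \<zeta>"
proof -
  have nz: "1 - \<zeta> \<noteq> 0" using one_minus_nonzero[OF assms(2)] .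
  have a: "a = cnj a + 2 * \<i> * of_real (Im a)" by (simp add: complex_eq_iff)
  have "half_plane_chart a \<zeta> - a = 2 * \<i> * of_real (Im a) / (1 - \<zeta>) - 2 * \<i> * of_real (Im a)"
    unfolding half_plane_chart_eq[OF nz, of a] by (subst (2) a) simp
  then show ?thesis
    unfolding disk_chart_def using nz assms(1)
    by (simp add: half_plane_chart_eq[OF nz, of a] divide_simps) (simp add: algebra_simps)
qed

lemma half_plane_chart_disk_chart:
  assumes "0 < Im a" "0 < Im w"
  shows "half_plane_chart a (disk_chart a w) = w"
proof -
  have nz: "w - cnj a \<noteq> 0" using diff_cnj_nonzero assms by blast
  have e: "1 - disk_chart a w = 2 * \<i> * of_real (Im a) / (w - cnj a)"
    using nz complex_diff_cnj[of a] by (simp add: disk_chart_def diff_divide_eq_iff eq_divide_eq diff_eq_eq ac_simps)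
  then have "1 - disk_chart a w \<noteq> 0" using nz assms(1) by simp
  then show ?thesis
    using half_plane_chart_eq[of "disk_chart a w" a] nz assms(1) unfolding e by simp
qed

lemma cayley_eq_chart: "cayley = half_plane_chart \<i>"
  by (rule ext) (simp add: half_plane_chart_def)

lemma holomorphic_disk_chart: "0 < Im a \<Longrightarrow> disk_chart a holomorphic_on \<H>"
  unfolding disk_chart_def[abs_def]
  by (intro holomorphic_intros) (use diff_cnj_nonzero in auto)

lemma holomorphic_half_plane_chart: "half_plane_chart a holomorphic_on \<D>"
  unfolding half_plane_chart_def[abs_def] cayley_def
  by (intro holomorphic_intros) auto

lemma inj_on_cayley: "inj_on cayley \<D>"
  by (rule inj_on_inverseI[of _ "disk_chart \<i>"])
     (simp only: cayley_eq_chart, rule disk_chart_half_plane_chart, auto)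

lemma cayley_inv_eq:
  assumes "0 < Im w"
  shows "cayley_inv w = disk_chart \<i> w"
proof (rule inv_into_f_eq[OF inj_on_cayley])
  show "disk_chart \<i> w \<in> \<D>" using disk_chart_in_disk assms by simp
  show "cayley (disk_chart \<i> w) = w"
    using half_plane_chart_disk_chart[of \<i> w] assms by (simp only: cayley_eq_chart) simp
qed

lemma cayley_inv_in_disk: "0 < Im w \<Longrightarrow> cayley_inv w \<in> \<D>"
  using disk_chart_in_disk[of \<i> w] cayley_inv_eq[of w] by simp

lemma cayley_cayley_inv: "0 < Im w \<Longrightarrow> cayley (cayley_inv w) = w"
  using half_plane_chart_disk_chart[of \<i> w] cayley_inv_eq[of w] by (simp only: cayley_eq_chart) simp

lemma cayley_inv_cayley: "\<zeta> \<in> \<D> \<Longrightarrow> cayley_inv (cayley \<zeta>) = \<zeta>"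
  by (rule inv_into_f_f[OF inj_on_cayley])

lemma holomorphic_cayley: "cayley holomorphic_on \<D>"
  using holomorphic_half_plane_chart by (simp only: cayley_eq_chart)

lemma holomorphic_cayley_inv: "cayley_inv holomorphic_on \<H>"
  by (rule holomorphic_transform[OF holomorphic_disk_chart[of \<i>]]) (simp_all add: cayley_inv_eq)

lemma cayley_image: "cayley ` \<D> = \<H>"
proof
  show "cayley ` \<D> \<subseteq> \<H>" using cayley_in_half_plane by auto
  show "\<H> \<subseteq> cayley ` \<D>"
  proof
    fix w assume "w \<in> \<H>"
    then show "w \<in> cayley ` \<D>"
      using cayley_inv_in_disk[of w] cayley_cayley_inv[of w] by (metis image_eqI upper_half_plane_iff)
  qed
qed

lemma inj_on_cayley_inv: "inj_on cayley_inv \<H>"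
  using cayley_cayley_inv by (metis inj_on_inverseI upper_half_plane_iff)

lemma cayley_inv_image: "cayley_inv ` \<H> = \<D>"
proof
  show "cayley_inv ` \<H> \<subseteq> \<D>" using cayley_inv_in_disk by (intro image_subsetI) simp
  show "\<D> \<subseteq> cayley_inv ` \<H>"
  proof
    fix z assume z: "z \<in> \<D>"
    show "z \<in> cayley_inv ` \<H>"
      by (rule image_eqI[of _ _ "cayley z"]) (use cayley_inv_cayley[OF z] cayley_in_half_plane[OF z] in simp_all)
  qed
qed

section \<open>The Schwarz--Pick and Julia inequalities\<close>

text \<open>Conjugation by charts centred at \<open>w\<close> and \<open>q w\<close> reduces a self-map of the half-plane to the
  situation of the Schwarz lemma; the derivative at the centre is the hyperbolic derivative of \<open>q\<close>.\<close>

lemma schwarz_chart: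
  assumes holq: "q holomorphic_on \<H>" and q: "\<And>z. 0 < Im z \<Longrightarrow> 0 < Im (q z)" and w: "0 < Im w"
  defines "f \<equiv> \<lambda>\<zeta>. disk_chart (q w) (q (half_plane_chart w \<zeta>))"
  shows "f holomorphic_on \<D>" "f 0 = 0" "\<And>\<zeta>. norm \<zeta> < 1 \<Longrightarrow> norm (f \<zeta>) < 1"
    "deriv f 0 = deriv q w * of_real (Im w / Im (q w))"
proof -
  have m1: "half_plane_chart w ` \<D> \<subseteq> \<H>"
    using half_plane_chart_in_half_plane[OF w] by auto
  have m2: "q ` \<H> \<subseteq> \<H>" using q by auto
  have "(disk_chart (q w) \<circ> (q \<circ> half_plane_chart w)) holomorphic_on \<D>"
    by (rule holomorphic_on_compose_gen[OF holomorphic_on_compose_gen[OF holomorphic_half_plane_chart holq m1]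
          holomorphic_disk_chart[OF q[OF w]]]) (use m1 m2 in auto)
  then show "f holomorphic_on \<D>" by (simp add: f_def o_def)
  have c0: "half_plane_chart w 0 = w" by (simp add: half_plane_chart_def cayley_def complex_eq_iff)
  show "f 0 = 0" by (simp add: f_def c0 disk_chart_def)
  show "norm (f \<zeta>) < 1" if "norm \<zeta> < 1" for \<zeta>
    unfolding f_def using disk_chart_in_disk[OF q[OF w] q[OF half_plane_chart_in_half_plane[OF w]], of \<zeta>] that by simp
  have d1: "(half_plane_chart w has_field_derivative 2 * \<i> * of_real (Im w)) (at 0)"
    unfolding half_plane_chart_def[abs_def] cayley_def[abs_def]
    by (auto intro!: derivative_eq_intros)
  have d2: "(q has_field_derivative deriv q w) (at (half_plane_chart w 0))"
    unfolding c0 using holomorphic_derivI[OF holq open_upper_half_plane, of w] w by simp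
  have nz: "q w - cnj (q w) \<noteq> 0" using q[OF w] by (simp add: complex_eq_iff)
  have "(disk_chart (q w) has_field_derivative ((q w - cnj (q w)) / (q w - cnj (q w))\<^sup>2)) (at (q w))"
    unfolding disk_chart_def[abs_def] using nz
    by (auto intro!: derivative_eq_intros simp: power2_eq_square)
  then have d3: "(disk_chart (q w) has_field_derivative (1 / (2 * \<i> * of_real (Im (q w))))) (at (q (half_plane_chart w 0)))"
    using nz unfolding c0 complex_diff_cnj by (simp add: power2_eq_square divide_simps mult.assoc)
  have "(f has_field_derivative (1 / (2 * \<i> * of_real (Im (q w)))) * (deriv q w * (2 * \<i> * of_real (Im w)))) (at 0)"
    unfolding f_def by (rule DERIV_chain2[OF d3 DERIV_chain2[OF d2 d1]])
  then show "deriv f 0 = deriv q w * of_real (Im w / Im (q w))"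
    using q[OF w] by (simp add: DERIV_imp_deriv)
qed

lemma schwarz_pick_derivative_equality:
  assumes holq: "q holomorphic_on \<H>" and q: "\<And>z. 0 < Im z \<Longrightarrow> 0 < Im (q z)" and w: "0 < Im w"
    and eq: "cmod (deriv q w) * Im w = Im (q w)"
  obtains \<alpha> where "cmod \<alpha> = 1" "\<And>z. 0 < Im z \<Longrightarrow> disk_chart (q w) (q z) = \<alpha> * disk_chart w z"
proof -
  note sc = schwarz_chart[OF holq q w]
  have "norm (deriv (\<lambda>\<zeta>. disk_chart (q w) (q (half_plane_chart w \<zeta>))) 0) = 1"
    using sc(4) eq q[OF w] w by (simp add: norm_mult norm_divide)
  then obtain \<alpha> where \<alpha>: "cmod \<alpha> = 1"
    "\<And>\<zeta>. norm \<zeta> < 1 \<Longrightarrow> disk_chart (q w) (q (half_plane_chart w \<zeta>)) = \<alpha> * \<zeta>"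
    using Schwarz_Lemma(3)[OF sc(1-3), of 0] by auto
  have "disk_chart (q w) (q z) = \<alpha> * disk_chart w z" if "0 < Im z" for z
    using \<alpha>(2)[of "disk_chart w z"] disk_chart_in_disk[OF w that] half_plane_chart_disk_chart[OF w that] by simp
  then show ?thesis using that \<alpha>(1) by blast
qed

lemma schwarz_pick_half_plane:
  assumes holq: "q holomorphic_on \<H>" and q: "\<And>z. 0 < Im z \<Longrightarrow> 0 < Im (q z)"
    and w: "0 < Im w" and z: "0 < Im z"
  shows "cmod (q z - q w) * cmod (z - cnj w) \<le> cmod (q z - cnj (q w)) * cmod (z - w)"
proof -
  note sc = schwarz_chart[OF holq q w]
  have "cmod (disk_chart (q w) (q z)) \<le> cmod (disk_chart w z)"
    using Schwarz_Lemma(1)[OF sc(1-3), of "disk_chart w z"] disk_chart_in_disk[OF w z]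
      half_plane_chart_disk_chart[OF w z] by simp
  then show ?thesis
    unfolding disk_chart_def norm_divide
    using diff_cnj_nonzero[OF z w] diff_cnj_nonzero[OF q[OF z] q[OF w]] by (simp add: field_simps)
qed

text \<open>Squaring the Schwarz--Pick inequality and bounding \<open>Im (q z)\<close> by \<open>\<bar>q z - cnj (q w)\<bar>\<close> cancels one
  factor of the latter. The result is linear in \<open>Im (q w)\<close>: a point \<open>w\<close> where \<open>Im (q w) / Im w\<close> is
  small forces \<open>q\<close> to grow slowly everywhere.\<close>

lemma julia_half_plane:
  assumes holq: "q holomorphic_on \<H>" and q: "\<And>z. 0 < Im z \<Longrightarrow> 0 \<le> Im (q z)"
    and w: "0 < Im w" and z: "0 < Im z"
  shows "cmod (q z - cnj (q w)) * Im z * Im w \<le> Im (q w) * (cmod (z - cnj w))\<^sup>2"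
proof -
  have strict: "cmod (q z - cnj (q w)) * Im z * Im w \<le> Im (q w) * (cmod (z - cnj w))\<^sup>2"
    if holq: "q holomorphic_on \<H>" and q: "\<And>z. 0 < Im z \<Longrightarrow> 0 < Im (q z)" for q
  proof -
    define A B where "A = cmod (q z - q w)" and "B = cmod (q z - cnj (q w))"
    define E D where "E = cmod (z - w)" and "D = cmod (z - cnj w)"
    have "A * D \<le> B * E"
      unfolding A_def B_def D_def E_def by (rule schwarz_pick_half_plane[OF holq q w z])
    then have "(A * D)\<^sup>2 \<le> (B * E)\<^sup>2"
      by (intro power_mono) (auto simp: A_def D_def)
    moreover have "B\<^sup>2 = A\<^sup>2 + 4 * Im (q z) * Im (q w)" "D\<^sup>2 = E\<^sup>2 + 4 * Im z * Im w"
      unfolding A_def B_def D_def E_def by (rule norm_diff_cnj_squared)+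
    ultimately have "B\<^sup>2 * (Im z * Im w) \<le> Im (q z) * Im (q w) * D\<^sup>2"
      by (simp add: power_mult_distrib algebra_simps)
    moreover have "Im (q z) \<le> B"
      using abs_Im_le_cmod[of "q z - cnj (q w)"] q[OF w] q[OF z] by (simp add: B_def)
    then have "Im (q z) * (Im (q w) * D\<^sup>2) \<le> B * (Im (q w) * D\<^sup>2)"
      using q[OF w] by (intro mult_right_mono) auto
    ultimately have "B * (B * Im z * Im w) \<le> B * (Im (q w) * D\<^sup>2)"
      by (simp add: power2_eq_square algebra_simps)
    moreover have "0 < B"
      using diff_cnj_nonzero[OF q[OF z] q[OF w]] by (simp add: B_def)
    ultimately show ?thesis unfolding B_def D_def by simp
  qed
  \<comment> \<open>Maps into the closed half-plane are shifted upwards by \<open>\<delta>\<close>, and \<open>\<delta>\<close> tends to \<open>0\<close>.\<close>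
  let ?X = "\<lambda>\<delta>. cmod (q z - cnj (q w) + 2 * \<i> * of_real \<delta>) * Im z * Im w"
  let ?Y = "\<lambda>\<delta>. (Im (q w) + \<delta>) * (cmod (z - cnj w))\<^sup>2"
  have le: "?X \<delta> \<le> ?Y \<delta>" if "0 < \<delta>" for \<delta> :: real
  proof -
    have h: "(\<lambda>z. q z + \<i> * of_real \<delta>) holomorphic_on \<H>" by (intro holomorphic_intros holq)
    have e: "q z + \<i> * of_real \<delta> - cnj (q w + \<i> * of_real \<delta>) = q z - cnj (q w) + 2 * \<i> * of_real \<delta>"
      by (simp add: algebra_simps)
    show ?thesis using strict[OF h] q that unfolding e by (simp add: add_nonneg_pos)
  qed
  have "?X 0 \<le> ?Y 0"
  proof (rule tendsto_le[of "at_right 0"])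
    show "(?Y \<longlongrightarrow> ?Y 0) (at_right 0)" by (intro tendsto_intros)
    show "(?X \<longlongrightarrow> ?X 0) (at_right 0)" by (intro tendsto_intros)
    show "eventually (\<lambda>\<delta>. ?X \<delta> \<le> ?Y \<delta>) (at_right 0)"
      by (rule eventually_mono[OF eventually_at_right_less[of 0]]) (rule le)
  qed simp
  then show ?thesis by simp
qed

section \<open>The Julia--Wolff--Caratheodory theorem at infinity\<close>

definition nontangential :: "real \<Rightarrow> complex filter" where
  "nontangential M = inf at_infinity (principal {z. 0 < Im z \<and> cmod z \<le> M * Im z})"

lemma eventually_nontangential_sector:
  "\<forall>\<^sub>F z in nontangential M. 0 < Im z \<and> cmod z \<le> M * Im z"
  unfolding nontangential_def by (simp add: eventually_inf_principal)

lemma eventually_nontangential_large: "\<forall>\<^sub>F z in nontangential M. R \<le> cmod z"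
  unfolding nontangential_def eventually_inf_principal
  by (rule eventually_mono[OF eventually_at_infinityI[of R]]) auto

lemma filterlim_nontangentialI:
  assumes "filterlim g at_infinity F" "\<forall>\<^sub>F x in F. 0 < Im (g x) \<and> cmod (g x) \<le> M * Im (g x)"
  shows "filterlim g (nontangential M) F"
  unfolding nontangential_def filterlim_inf filterlim_principal using assms by simp

lemma filterlim_imaginary_axis: "filterlim (\<lambda>y::real. \<i> * of_real y) (nontangential 1) at_top"
proof (rule filterlim_nontangentialI)
  show "filterlim (\<lambda>y::real. \<i> * of_real y) at_infinity at_top"
    by (rule filterlim_norm_at_top_imp_at_infinity)
       (simp add: norm_mult filterlim_abs_real)
  show "\<forall>\<^sub>F y::real in at_top. 0 < Im (\<i> * of_real y) \<and> cmod (\<i> * of_real y) \<le> 1 * Im (\<i> * of_real y)"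
    using eventually_gt_at_top[of 0] by eventually_elim (simp add: norm_mult)
qed

text \<open>The constant is the infimum \<open>c\<close> of \<open>Im (q z) / Im z\<close>. Subtracting \<open>(c - \<epsilon>) z\<close> from \<open>q\<close> leaves a
  self-map \<open>h\<close> of the half-plane for which \<open>Im (h w) \<le> 2 \<epsilon> Im w\<close> at some \<open>w\<close>, and then Julia's
  inequality gives \<open>h z = O(\<epsilon> z)\<close> in every sector.\<close>

lemma julia_wolff_caratheodory:
  assumes holq: "q holomorphic_on \<H>" and q: "\<And>z. 0 < Im z \<Longrightarrow> 0 < Im (q z)"
  obtains c where "0 \<le> c" "\<And>z. 0 < Im z \<Longrightarrow> c * Im z \<le> Im (q z)"
    "\<And>M. ((\<lambda>z. q z / z) \<longlongrightarrow> of_real c) (nontangential M)"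
proof -
  define S where "S = (\<lambda>z. Im (q z) / Im z) ` \<H>"
  define c where "c = Inf S"
  have pos: "0 \<le> s" if "s \<in> S" for s using that q by (auto simp: S_def intro: less_imp_le)
  have bdd: "bdd_below S" using pos by (rule bdd_belowI)
  have ne: "S \<noteq> {}" unfolding S_def by (auto simp: upper_half_plane_def intro: exI[of _ \<i>])
  have c0: "0 \<le> c" unfolding c_def using ne pos by (rule cInf_greatest)
  have cle: "c * Im z \<le> Im (q z)" if "0 < Im z" for z
  proof -
    have "Im (q z) / Im z \<in> S" using that by (auto simp: S_def)
    then have "c \<le> Im (q z) / Im z" unfolding c_def using bdd by (rule cInf_lower)
    then show ?thesis using that by (simp add: field_simps)
  qed
  have "((\<lambda>z. q z / z) \<longlongrightarrow> of_real c) (nontangential M)" for M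
  proof (rule tendstoI)
    fix e :: real assume e: "0 < e"
    define M' where "M' = max M 1"
    have M': "1 \<le> M'" "M \<le> M'" by (auto simp: M'_def)
    \<comment> \<open>The final estimate is \<open>\<bar>q z / z - c\<bar> \<le> (2 + 8 M') \<epsilon>\<close>.\<close>
    define \<epsilon> where "\<epsilon> = e / (3 + 8 * M')"
    have \<epsilon>: "0 < \<epsilon>" using e M' by (simp add: \<epsilon>_def)
    have \<epsilon>e: "\<epsilon> * (3 + 8 * M') = e" using M' by (simp add: \<epsilon>_def)
    obtain s where "s \<in> S" "s < c + \<epsilon>"
      using cInf_lessD[OF ne, of "c + \<epsilon>"] \<epsilon> unfolding c_def by auto
    then obtain w where w: "0 < Im w" "Im (q w) < (c + \<epsilon>) * Im w"
      by (auto simp: S_def divide_simps)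
    define h where "h z = q z - of_real (c - \<epsilon>) * z" for z
    have holh: "h holomorphic_on \<H>" unfolding h_def[abs_def] by (intro holomorphic_intros holq)
    have Imh: "Im (h z) = Im (q z) - (c - \<epsilon>) * Im z" for z by (simp add: h_def)
    have hpos: "0 < Im (h z)" if "0 < Im z" for z
      using cle[OF that] that \<epsilon> by (simp add: Imh algebra_simps add_pos_nonneg) (smt (verit) mult_pos_pos)
    have hw: "Im (h w) \<le> 2 * \<epsilon> * Im w" using w by (simp add: Imh algebra_simps)
    have bound: "cmod (h z) * Im z \<le> cmod (h w) * Im z + 2 * \<epsilon> * (cmod z + cmod w)\<^sup>2" if z: "0 < Im z" for z
    proof -
      have "cmod (h z - cnj (h w)) * Im z * Im w \<le> Im (h w) * (cmod (z - cnj w))\<^sup>2"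
        using holh hpos by (intro julia_half_plane[OF _ _ w(1) z]) (auto intro: less_imp_le)
      also have "\<dots> \<le> (2 * \<epsilon> * Im w) * (cmod z + cmod w)\<^sup>2"
        using hw norm_triangle_ineq4[of z "cnj w"] \<epsilon> w(1)
        by (intro mult_mono power_mono) auto
      finally have "cmod (h z - cnj (h w)) * Im z \<le> 2 * \<epsilon> * (cmod z + cmod w)\<^sup>2"
        using w(1) by (simp add: field_simps)
      moreover have "cmod (h z) \<le> cmod (h z - cnj (h w)) + cmod (h w)"
        using norm_triangle_ineq[of "h z - cnj (h w)" "cnj (h w)"] by simp
      then have "cmod (h z) * Im z \<le> (cmod (h z - cnj (h w)) + cmod (h w)) * Im z"
        using z by (intro mult_right_mono) auto
      ultimately show ?thesis by (simp add: algebra_simps)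
    qed
    show "\<forall>\<^sub>F z in nontangential M. dist (q z / z) (of_real c) < e"
      using eventually_nontangential_sector[of M] eventually_nontangential_large[of "1 + cmod w + cmod (h w) / \<epsilon>" M]
    proof eventually_elim
      case (elim z)
      then have z: "0 < Im z" "cmod z \<le> M' * Im z" using M'
        by (auto intro: order_trans[OF _ mult_right_mono])
      have zl: "1 \<le> cmod z" "cmod w \<le> cmod z"
        using elim(2) \<epsilon> by (smt (verit) divide_nonneg_pos norm_ge_zero)+
      have "cmod (h w) / \<epsilon> \<le> cmod z" using elim(2) norm_ge_zero[of w] by linarith
      then have hwz: "cmod (h w) \<le> \<epsilon> * cmod z" using \<epsilon> by (simp add: field_simps)
      have "(cmod z + cmod w)\<^sup>2 \<le> (2 * cmod z)\<^sup>2" using zl by (intro power_mono) auto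
      also have "\<dots> = 4 * cmod z * cmod z" by (simp add: power2_eq_square)
      also have "\<dots> \<le> 4 * cmod z * (M' * Im z)" using z by (intro mult_left_mono) auto
      finally have "(cmod z + cmod w)\<^sup>2 \<le> 4 * cmod z * (M' * Im z)" .
      then have "2 * \<epsilon> * (cmod z + cmod w)\<^sup>2 \<le> 2 * \<epsilon> * (4 * cmod z * (M' * Im z))"
        using \<epsilon> by (intro mult_left_mono) auto
      moreover have "cmod (h w) * Im z \<le> (\<epsilon> * cmod z) * Im z" using hwz z by (intro mult_right_mono) auto
      ultimately have "cmod (h z) * Im z \<le> ((\<epsilon> + 8 * \<epsilon> * M') * cmod z) * Im z"
        using bound[OF z(1)] by (simp add: algebra_simps)
      then have hz: "cmod (h z) \<le> (\<epsilon> + 8 * \<epsilon> * M') * cmod z" using z by simp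
      have "z \<noteq> 0" using zl by auto
      then have "q z / z - of_real c = h z / z - of_real \<epsilon>" by (simp add: h_def field_simps)
      then have "cmod (q z / z - of_real c) \<le> cmod (h z / z) + \<epsilon>"
        using norm_triangle_ineq4[of "h z / z" "of_real \<epsilon>"] \<epsilon> by simp
      also have "cmod (h z / z) \<le> \<epsilon> + 8 * \<epsilon> * M'"
        using hz \<open>z \<noteq> 0\<close> by (simp add: norm_divide divide_le_eq)
      finally have "cmod (q z / z - of_real c) \<le> \<epsilon> * (3 + 8 * M') - \<epsilon>" by (simp add: algebra_simps)
      then show ?case using \<epsilon> \<epsilon>e by (simp add: dist_norm)
    qed
  qed
  with c0 cle that show ?thesis by blast
qed

section \<open>Hydrodynamic normalisation\<close>

text \<open>The third condition says that \<open>G z = z - l / z + o(1 / z)\<close>. In terms of the representation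
  of \<open>G\<close> by a finite measure, \<open>l\<close> is the total mass (the half-plane capacity of the omitted set).\<close>

definition hydrodynamic :: "(complex \<Rightarrow> complex) \<Rightarrow> real \<Rightarrow> bool" where
  "hydrodynamic G l \<longleftrightarrow> G holomorphic_on \<H> \<and> (\<forall>z\<in>\<H>. Im z \<le> Im (G z)) \<and>
     (\<forall>z\<in>\<H>. cmod (G z - z) \<le> l / Im z) \<and>
     (\<forall>M. ((\<lambda>z. z * (G z - z)) \<longlongrightarrow> of_real (- l)) (nontangential M))"

text \<open>First \<open>G z / z \<longlongrightarrow> 1\<close> along \<open>F\<close> identifies the constant of the Julia--Wolff--Caratheodory theorem
  for \<open>G\<close> as \<open>1\<close>, so that \<open>p = G - id\<close> has nonnegative imaginary part. Either \<open>p\<close> takes a real value, and is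
  constant with limit \<open>0\<close>, or the theorem applies to \<open>q = - 1 / p\<close>. The bound along \<open>F\<close> says that
  \<open>q z / z\<close> stays away from \<open>0\<close> there, so its limit \<open>k\<close> is positive and \<open>l = 1 / k\<close> works: \<open>Im (q z) \<ge> k Im z\<close>
  means \<open>Im (p z) \<ge> k Im z \<bar>p z\<bar>^2\<close>, hence \<open>\<bar>p z\<bar> \<le> 1 / (k Im z)\<close>.\<close>

lemma hydrodynamicI:
  assumes holG: "G holomorphic_on \<H>" and G: "\<And>z. 0 < Im z \<Longrightarrow> 0 < Im (G z)"
    and F: "F \<noteq> bot" "F \<le> nontangential M" and ev: "\<forall>\<^sub>F z in F. cmod (G z - z) \<le> C / cmod z"
  obtains l where "hydrodynamic G l"
proof -
  have large: "\<forall>\<^sub>F z in F. R \<le> cmod z" for R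
    using eventually_nontangential_large F(2) by (rule filter_leD[rotated])
  have inf0: "((\<lambda>z. K / cmod z) \<longlongrightarrow> 0) F" for K
  proof -
    have "F \<le> at_infinity" using F(2) unfolding nontangential_def by (simp add: le_inf_iff)
    then have "filterlim cmod at_top F"
      by (intro filterlim_at_infinity_imp_norm_at_top) (simp add: filterlim_def filtermap_ident)
    then show ?thesis by (intro tendsto_divide_0[OF tendsto_const]) (rule filterlim_at_top_imp_at_infinity)
  qed
  obtain c where c: "0 \<le> c" "\<And>z. 0 < Im z \<Longrightarrow> c * Im z \<le> Im (G z)"
    "((\<lambda>z. G z / z) \<longlongrightarrow> of_real c) (nontangential M)"
    using julia_wolff_caratheodory[OF holG G] by metis
  have lim0: "((\<lambda>z. G z - z) \<longlongrightarrow> 0) F"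
    using ev inf0[of C] by (rule Lim_null_comparison)
  have "((\<lambda>z. G z / z - 1) \<longlongrightarrow> 0) F"
  proof (rule Lim_null_comparison[OF _ inf0[of C]])
    show "\<forall>\<^sub>F z in F. cmod (G z / z - 1) \<le> C / cmod z"
      using ev large[of 1]
    proof eventually_elim
      case (elim z)
      then have nz: "z \<noteq> 0" by auto
      have "cmod (G z / z - 1) = cmod (G z - z) / cmod z"
        using nz by (simp add: norm_divide[symmetric] diff_divide_distrib)
      also have "\<dots> \<le> cmod (G z - z) / 1" using elim by (intro divide_left_mono) auto
      finally show ?case using elim by simp
    qed
  qed
  moreover have "((\<lambda>z. G z / z) \<longlongrightarrow> of_real c) F" using c(3) F(2) by (rule tendsto_mono[rotated])
  then have "((\<lambda>z. G z / z - 1) \<longlongrightarrow> of_real c - 1) F" by (intro tendsto_intros)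
  ultimately have "complex_of_real c - 1 = 0" using F(1) tendsto_unique by blast
  then have "c = 1" by (metis eq_iff_diff_eq_0 of_real_eq_1_iff)
  then have mono: "Im z \<le> Im (G z)" if "0 < Im z" for z using c(2)[OF that] by simp
  define p where "p z = G z - z" for z
  have holp: "p holomorphic_on \<H>" unfolding p_def[abs_def] by (intro holomorphic_intros holG)
  have p: "0 \<le> Im (p z)" if "0 < Im z" for z using mono[OF that] by (simp add: p_def)
  show ?thesis
  proof (cases "\<exists>w. 0 < Im w \<and> Im (p w) = 0")
    case True
    then obtain w where w: "0 < Im w" "Im (p w) = 0" by blast
    have const: "p z = p w" if z: "0 < Im z" for z
    proof -
      have "cmod (p z - cnj (p w)) * Im z * Im w \<le> 0"
        using julia_half_plane[OF holp p w(1) z] w(2) by simp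
      then have "p z = cnj (p w)"
        using mult_pos_pos[OF z w(1)] norm_ge_zero[of "p z - cnj (p w)"]
        by (smt (verit, best) mult.assoc mult_pos_pos right_minus_eq zero_less_norm_iff)
      then show ?thesis using w(2) by (simp add: complex_eq_iff)
    qed
    have "\<forall>\<^sub>F z in F. G z - z = p w"
      using filter_leD[OF F(2) eventually_nontangential_sector] by eventually_elim (metis const p_def)
    then have "((\<lambda>z. G z - z) \<longlongrightarrow> p w) F" by (rule tendsto_eventually)
    then have "p w = 0" using lim0 F(1) tendsto_unique by blast
    then have z: "G z - z = 0" if "0 < Im z" for z using const[OF that] by (simp add: p_def)
    have "hydrodynamic G 0"
      unfolding hydrodynamic_def
    proof (intro conjI ballI allI)
      fix M show "((\<lambda>z. z * (G z - z)) \<longlongrightarrow> of_real (- 0)) (nontangential M)"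
        by (rule tendsto_eventually, rule eventually_mono[OF eventually_nontangential_sector]) (auto simp: z)
    qed (use holG mono z in auto)
    then show ?thesis using that by blast
  next
    case False
    then have p: "0 < Im (p z)" if "0 < Im z" for z using p[OF that] that by fastforce
    define q where "q z = - 1 / p z" for z
    have pnz: "p z \<noteq> 0" if "0 < Im z" for z using p[OF that] by auto
    have holq: "q holomorphic_on \<H>" unfolding q_def[abs_def] using pnz by (intro holomorphic_intros holp) auto
    have Imq: "Im (q z) = Im (p z) / (cmod (p z))\<^sup>2" for z
      unfolding q_def cmod_power2 by (simp add: Im_divide)
    have q: "0 < Im (q z)" if "0 < Im z" for z using p[OF that] pnz[OF that] by (simp add: Imq)
    obtain k where k: "0 \<le> k" "\<And>z. 0 < Im z \<Longrightarrow> k * Im z \<le> Im (q z)"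
      "\<And>M. ((\<lambda>z. q z / z) \<longlongrightarrow> of_real k) (nontangential M)"
      using julia_wolff_caratheodory[OF holq q] by metis
    have sect: "\<forall>\<^sub>F z in F. 0 < Im z"
      using filter_leD[OF F(2) eventually_nontangential_sector] by eventually_elim simp
    have *: "\<forall>\<^sub>F z in F. 1 \<le> C * cmod (q z / z)"
      using ev sect
    proof eventually_elim
      case (elim z)
      then have "z \<noteq> 0" "p z \<noteq> 0" using pnz by auto
      moreover from this elim(1) have "cmod (p z) * cmod z \<le> C" by (simp add: p_def field_simps)
      ultimately show ?case by (simp add: q_def norm_divide norm_mult field_simps)
    qed
    have "((\<lambda>z. C * cmod (q z / z)) \<longlongrightarrow> C * cmod (of_real k)) F"
      using tendsto_mono[OF F(2) k(3)] by (intro tendsto_intros)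
    then have "1 \<le> C * cmod (of_real k :: complex)"
      using * F(1) by (intro tendsto_lowerbound) auto
    \<comment> \<open>A vanishing \<open>k\<close> would give \<open>1 \<le> 0\<close>.\<close>
    then have k0: "0 < k" using k(1) by (cases "k = 0") auto
    have bound: "cmod (p z) \<le> (1 / k) / Im z" if z: "0 < Im z" for z
    proof -
      have "k * Im z * (cmod (p z))\<^sup>2 \<le> Im (p z)"
        using k(2)[OF z] pnz[OF z] by (simp add: Imq field_simps)
      also have "\<dots> \<le> cmod (p z)" using abs_Im_le_cmod[of "p z"] by linarith
      finally have "(k * Im z * cmod (p z)) * cmod (p z) \<le> 1 * cmod (p z)"
        by (simp add: power2_eq_square mult.assoc)
      then have "k * Im z * cmod (p z) \<le> 1" using pnz[OF z] by (simp del: mult_1)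
      then show ?thesis using k0 z by (simp add: field_simps)
    qed
    have lim: "((\<lambda>z. z * (G z - z)) \<longlongrightarrow> of_real (- (1 / k))) (nontangential M)" for M
    proof (rule Lim_transform_eventually)
      have "((\<lambda>z. - 1 / (q z / z)) \<longlongrightarrow> - 1 / of_real k) (nontangential M)"
        using k0 by (intro tendsto_intros k(3)) auto
      then show "((\<lambda>z. - 1 / (q z / z)) \<longlongrightarrow> of_real (- (1 / k))) (nontangential M)" by simp
      show "\<forall>\<^sub>F z in nontangential M. - 1 / (q z / z) = z * (G z - z)"
        using eventually_nontangential_sector by eventually_elim (simp add: q_def p_def)
    qed
    have "hydrodynamic G (1 / k)"
      unfolding hydrodynamic_def using holG mono bound lim by (auto simp: p_def)
    then show ?thesis using that by blast
  qed
qed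

lemma hydrodynamicD:
  assumes "hydrodynamic G l"
  shows "G holomorphic_on \<H>" "\<And>z. 0 < Im z \<Longrightarrow> Im z \<le> Im (G z)" "\<And>z. 0 < Im z \<Longrightarrow> 0 < Im (G z)"
    "\<And>z. 0 < Im z \<Longrightarrow> cmod (G z - z) \<le> l / Im z"
    "\<And>M. ((\<lambda>z. z * (G z - z)) \<longlongrightarrow> of_real (- l)) (nontangential M)" "0 \<le> l"
proof -
  show "G holomorphic_on \<H>" "\<And>z. 0 < Im z \<Longrightarrow> cmod (G z - z) \<le> l / Im z"
    "\<And>M. ((\<lambda>z. z * (G z - z)) \<longlongrightarrow> of_real (- l)) (nontangential M)"
    using assms by (auto simp: hydrodynamic_def)
  show "\<And>z. 0 < Im z \<Longrightarrow> Im z \<le> Im (G z)" using assms by (auto simp: hydrodynamic_def)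
  then show "\<And>z. 0 < Im z \<Longrightarrow> 0 < Im (G z)" by force
  have "\<forall>z\<in>\<H>. cmod (G z - z) \<le> l / Im z" using assms unfolding hydrodynamic_def by blast
  then have "cmod (G \<i> - \<i>) \<le> l / Im \<i>" by (rule bspec) simp
  then show "0 \<le> l" using order_trans[OF norm_ge_zero] by force
qed

lemma hydrodynamic_axis_lim:
  assumes "hydrodynamic G l"
  shows "((\<lambda>y. \<i> * of_real y * (G (\<i> * of_real y) - \<i> * of_real y)) \<longlongrightarrow> of_real (- l)) at_top"
  using filterlim_compose[OF hydrodynamicD(5)[OF assms] filterlim_imaginary_axis] .

text \<open>Along the imaginary axis \<open>\<bar>z\<bar> = Im z\<close>, so any admissible constant bounds the limit of
  \<open>\<bar>z (G z - z)\<bar>\<close>.\<close>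

lemma hydrodynamic_least:
  assumes "hydrodynamic G l" and C: "\<And>z. 0 < Im z \<Longrightarrow> cmod (G z - z) \<le> C / Im z"
  shows "l \<le> C"
proof -
  have "\<forall>\<^sub>F y in at_top. cmod (\<i> * of_real y * (G (\<i> * of_real y) - \<i> * of_real y)) \<le> C"
    using eventually_gt_at_top[of 0]
  proof eventually_elim
    case (elim y)
    then have "y * cmod (G (\<i> * of_real y) - \<i> * of_real y) \<le> C"
      using C[of "\<i> * of_real y"] by (simp add: field_simps)
    then show ?case using elim by (simp only: norm_mult) simp
  qed
  moreover have "((\<lambda>y. cmod (\<i> * of_real y * (G (\<i> * of_real y) - \<i> * of_real y))) \<longlongrightarrow> cmod (of_real (- l))) at_top"
    by (intro tendsto_norm hydrodynamic_axis_lim assms)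
  ultimately have "cmod (of_real (- l)) \<le> C" by (intro tendsto_upperbound) auto
  then show ?thesis by simp
qed

lemma ell_half_plane_eq:
  assumes "hydrodynamic G l"
  shows "ell_half_plane G = l"
  unfolding ell_half_plane_def
proof (rule Least_equality)
  show "\<forall>z\<in>\<H>. cmod (G z - z) \<le> l / Im z" using hydrodynamicD(4)[OF assms] by simp
  show "l \<le> C" if "\<forall>z\<in>\<H>. cmod (G z - z) \<le> C / Im z" for C
    using hydrodynamic_least[OF assms] that by simp
qed

lemma frakP0_hydrodynamic:
  assumes "G \<in> frakP0"
  obtains l where "hydrodynamic G l"
proof -
  have G: "G holomorphic_on \<H>" "\<And>z. 0 < Im z \<Longrightarrow> 0 < Im (G z)"
    and "\<exists>C>0. \<forall>z\<in>\<H>. cmod (G z - z) \<le> C / Im z"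
    using assms unfolding frakP0_def univalent_on_def by (auto simp: image_subset_iff)
  then obtain C where "\<forall>z\<in>\<H>. cmod (G z - z) \<le> C / Im z" by blast
  then have C: "cmod (G z - z) \<le> C / Im z" if "0 < Im z" for z using that by simp
  let ?F = "filtermap (\<lambda>y::real. \<i> * of_real y) at_top"
  show ?thesis
  proof (rule hydrodynamicI[OF G(1,2), where F = ?F and M = 1 and C = C])
    show "?F \<noteq> bot" by (simp add: filtermap_bot_iff)
    show "?F \<le> nontangential 1" using filterlim_imaginary_axis by (simp add: filterlim_def)
    show "\<forall>\<^sub>F z in ?F. cmod (G z - z) \<le> C / cmod z"
      unfolding eventually_filtermap using eventually_gt_at_top[of 0]
    proof eventually_elim
      case (elim y)
      then show ?case using C[of "\<i> * of_real y"] by (simp add: norm_mult)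
    qed
  qed (use that in auto)
qed

lemma hydrodynamic_frakP0:
  assumes "hydrodynamic G l" "inj_on G \<H>"
  shows "G \<in> frakP0"
proof -
  note h = hydrodynamicD[OF assms(1)]
  have "cmod (G z - z) \<le> (l + 1) / Im z" if "0 < Im z" for z
    by (rule order_trans[OF h(4)[OF that]]) (use that in \<open>simp add: divide_right_mono\<close>)
  then show ?thesis
    unfolding frakP0_def univalent_on_def using assms(2) h(1,3,6)
    by (auto intro!: exI[of _ "l + 1"])
qed

text \<open>The curve \<open>g (\<i> y)\<close> stays within \<open>l / y\<close> of \<open>\<i> y\<close> and is therefore nontangential. Along it
  \<open>G - id\<close> equals \<open>(k - id) - (g - id)\<close> evaluated at \<open>\<i> y\<close>, which supplies the weak bound that makes \<open>G\<close> hydrodynamic, and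
  then also its constant. Thus the constants add up under composition.\<close>

lemma hydrodynamic_cancel:
  assumes g: "hydrodynamic g l" and k: "hydrodynamic k m"
    and holG: "G holomorphic_on \<H>" and G: "\<And>z. 0 < Im z \<Longrightarrow> 0 < Im (G z)"
    and comp: "\<And>z. 0 < Im z \<Longrightarrow> G (g z) = k z"
  shows "hydrodynamic G (m - l)"
proof -
  note hg = hydrodynamicD[OF g] and hk = hydrodynamicD[OF k]
  define \<gamma> where "\<gamma> y = g (\<i> * of_real y)" for y :: real
  have near: "\<forall>\<^sub>F y in at_top. l \<le> y \<and> 1 \<le> y" by (intro eventually_conj eventually_ge_at_top)
  have dist: "cmod (\<gamma> y - \<i> * of_real y) \<le> l / y" "y \<le> Im (\<gamma> y)" if "0 < y" for y
    using hg(4)[of "\<i> * of_real y"] hg(2)[of "\<i> * of_real y"] that by (auto simp: \<gamma>_def)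
  have len: "cmod (\<gamma> y) \<le> y + l / y" if "0 < y" for y
    using norm_triangle_ineq2[of "\<gamma> y" "\<i> * of_real y"] dist(1)[OF that] that by (simp add: norm_mult)
  have ly: "l / y \<le> y" if "l \<le> y" "1 \<le> y" for y
  proof -
    have "l \<le> y * y" by (rule order_trans[OF that(1)]) (use that in simp)
    then show ?thesis using that by (simp add: divide_le_eq)
  qed
  have \<gamma>lim: "filterlim \<gamma> (nontangential 2) at_top"
  proof (rule filterlim_nontangentialI)
    show "filterlim \<gamma> at_infinity at_top"
    proof (rule filterlim_norm_at_top_imp_at_infinity, rule filterlim_at_top_mono[OF filterlim_ident])
      show "\<forall>\<^sub>F y in at_top. y \<le> cmod (\<gamma> y)"
        using eventually_gt_at_top[of 0]
      proof eventually_elim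
        case (elim y)
        then show ?case using dist(2)[of y] abs_Im_le_cmod[of "\<gamma> y"] by linarith
      qed
    qed
    show "\<forall>\<^sub>F y in at_top. 0 < Im (\<gamma> y) \<and> cmod (\<gamma> y) \<le> 2 * Im (\<gamma> y)"
      using near
    proof eventually_elim
      case (elim y)
      then have "l / y \<le> y" using ly by simp
      then show ?case using dist(2)[of y] len[of y] elim by linarith
    qed
  qed
  let ?F = "filtermap \<gamma> at_top"
  have "\<exists>n. hydrodynamic G n"
  proof (rule hydrodynamicI[OF holG G, where F = ?F and M = 2 and C = "2 * (l + m)"])
    show "?F \<noteq> bot" by (simp add: filtermap_bot_iff)
    show "?F \<le> nontangential 2" using \<gamma>lim by (simp add: filterlim_def)
    show "\<forall>\<^sub>F z in ?F. cmod (G z - z) \<le> 2 * (l + m) / cmod z"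
      unfolding eventually_filtermap using near
    proof eventually_elim
      case (elim y)
      then have y: "0 < y" by simp
      have "G (\<gamma> y) - \<gamma> y = (k (\<i> * of_real y) - \<i> * of_real y) - (\<gamma> y - \<i> * of_real y)"
        using comp[of "\<i> * of_real y"] y by (simp add: \<gamma>_def)
      then have "cmod (G (\<gamma> y) - \<gamma> y) \<le> m / y + l / y"
        using norm_triangle_ineq4[of "k (\<i> * of_real y) - \<i> * of_real y" "\<gamma> y - \<i> * of_real y"]
          hk(4)[of "\<i> * of_real y"] dist(1)[OF y] y by simp
      also have "\<dots> = (l + m) / y" by (simp add: add_divide_distrib)
      also have "\<dots> = 2 * (l + m) / (2 * y)" by (rule mult_divide_mult_cancel_left[symmetric]) simp
      also have "\<dots> \<le> 2 * (l + m) / cmod (\<gamma> y)"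
      proof (intro divide_left_mono)
        have "l / y \<le> y" using ly elim by simp
        then show "cmod (\<gamma> y) \<le> 2 * y" using len[OF y] by linarith
        have "0 < cmod (\<gamma> y)" using dist(2)[OF y] y by auto
        then show "0 < 2 * y * cmod (\<gamma> y)" "0 \<le> 2 * (l + m)" using y hg(6) hk(6) by auto
      qed
      finally show ?case .
    qed
  qed (auto intro: exI)
  then obtain n where n: "hydrodynamic G n" ..
  have "((\<lambda>y. \<gamma> y * (G (\<gamma> y) - \<gamma> y)) \<longlongrightarrow> of_real (- n)) at_top"
    using filterlim_compose[OF hydrodynamicD(5)[OF n] \<gamma>lim] .
  moreover have "((\<lambda>y. \<gamma> y * (G (\<gamma> y) - \<gamma> y)) \<longlongrightarrow> of_real (- (m - l))) at_top"
  proof (rule Lim_transform_eventually)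
    let ?iy = "\<lambda>y::real. \<i> * of_real y"
    have "((\<lambda>y. \<gamma> y / ?iy y - 1) \<longlongrightarrow> 0) at_top"
    proof (rule Lim_null_comparison)
      show "((\<lambda>y::real. l / y) \<longlongrightarrow> 0) at_top"
        by (intro tendsto_divide_0[OF tendsto_const] filterlim_at_top_imp_at_infinity filterlim_ident)
      show "\<forall>\<^sub>F y in at_top. cmod (\<gamma> y / ?iy y - 1) \<le> l / y"
        using eventually_ge_at_top[of 1]
      proof eventually_elim
        case (elim y)
        then have "cmod (\<gamma> y / ?iy y - 1) = cmod (\<gamma> y - ?iy y) / y"
          using norm_divide[of "\<gamma> y - ?iy y" "?iy y"] by (simp add: norm_mult diff_divide_distrib)
        also have "\<dots> \<le> cmod (\<gamma> y - ?iy y) / 1" using elim by (intro divide_left_mono) auto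
        also have "\<dots> \<le> l / y" using dist(1)[of y] elim by simp
        finally show ?case .
      qed
    qed
    then have "((\<lambda>y. (\<gamma> y / ?iy y - 1) + 1) \<longlongrightarrow> 0 + 1) at_top" by (intro tendsto_intros)
    then have "((\<lambda>y. \<gamma> y / ?iy y) \<longlongrightarrow> 1) at_top" by simp
    then have "((\<lambda>y. \<gamma> y / ?iy y * (?iy y * (k (?iy y) - ?iy y) - ?iy y * (g (?iy y) - ?iy y)))
        \<longlongrightarrow> 1 * (of_real (- m) - of_real (- l))) at_top"
      by (intro tendsto_intros hydrodynamic_axis_lim g k)
    then show "((\<lambda>y. \<gamma> y / ?iy y * (?iy y * (k (?iy y) - ?iy y) - ?iy y * (g (?iy y) - ?iy y)))
        \<longlongrightarrow> of_real (- (m - l))) at_top" by simp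
    show "\<forall>\<^sub>F y in at_top. \<gamma> y / ?iy y * (?iy y * (k (?iy y) - ?iy y) - ?iy y * (g (?iy y) - ?iy y))
        = \<gamma> y * (G (\<gamma> y) - \<gamma> y)"
      using eventually_gt_at_top[of 0]
    proof eventually_elim
      case (elim y)
      then have "G (\<gamma> y) = k (?iy y)" using comp[of "?iy y"] by (simp add: \<gamma>_def)
      then show ?case using elim by (simp add: \<gamma>_def field_simps)
    qed
  qed
  ultimately have "complex_of_real (- n) = of_real (- (m - l))"
    using tendsto_unique trivial_limit_at_top_linorder by blast
  then have "n = m - l" by (simp only: of_real_eq_iff)
  then show ?thesis using n by simp
qed

section \<open>Angular limits at the boundary point 1\<close>

text \<open>The sets in the definition of angular limits, at the point \<open>1\<close>.\<close>

definition stolz :: "real \<Rightarrow> complex set" where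
  "stolz M = {z \<in> \<D>. cmod (1 - z) < M * (1 - cmod z)}"

lemma has_angular_lim_stolz:
  "has_angular_lim f 1 L \<longleftrightarrow> (\<forall>M>1. (f \<longlongrightarrow> L) (at 1 within stolz M))"
  unfolding has_angular_lim_def stolz_def ..

lemma eventually_stolz: "\<forall>\<^sub>F z in at 1 within stolz M. z \<in> \<D> \<and> cmod (1 - z) < M * (1 - cmod z)"
  by (auto simp: eventually_at_filter stolz_def)

lemma has_angular_lim_transform:
  assumes "has_angular_lim f 1 L" "\<And>z. z \<in> \<D> \<Longrightarrow> f z = g z"
  shows "has_angular_lim g 1 L"
  using assms(1) unfolding has_angular_lim_stolz
  by (auto elim!: Lim_transform_eventually intro!: eventually_mono[OF eventually_stolz] simp: assms(2))

lemma has_angular_lim_continuous: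
  assumes "isCont f 1" "f 1 = L"
  shows "has_angular_lim f 1 L"
  unfolding has_angular_lim_stolz
  using assms by (auto simp: isCont_def intro: tendsto_within_subset)

lemma has_angular_lim_add:
  "has_angular_lim f 1 L \<Longrightarrow> has_angular_lim g 1 K \<Longrightarrow> has_angular_lim (\<lambda>z. f z + g z) 1 (L + K)"
  unfolding has_angular_lim_stolz by (auto intro: tendsto_add)

lemma has_angular_lim_mult:
  "has_angular_lim f 1 L \<Longrightarrow> has_angular_lim g 1 K \<Longrightarrow> has_angular_lim (\<lambda>z. f z * g z) 1 (L * K)"
  unfolding has_angular_lim_stolz by (auto intro: tendsto_mult)

text \<open>\<open>\<bar>cayley z\<bar> / Im (cayley z) = \<bar>1 + z\<bar> \<bar>1 - z\<bar> / (1 - \<bar>z\<bar>^2)\<close>, which is at most \<open>2 M\<close> in a Stolz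
  region of aperture \<open>M\<close>.\<close>

lemma filterlim_cayley_nontangential:
  "filterlim cayley (nontangential (2 * M)) (at 1 within stolz M)"
proof (rule filterlim_nontangentialI)
  show "filterlim cayley at_infinity (at 1 within stolz M)"
    unfolding cayley_def[abs_def]
  proof (rule filterlim_divide_at_infinity)
    show "((\<lambda>z. \<i> * (1 + z)) \<longlongrightarrow> \<i> * (1 + 1)) (at 1 within stolz M)"
      by (intro tendsto_intros)
    show "filterlim (\<lambda>z::complex. 1 - z) (at 0) (at 1 within stolz M)"
    proof (rule filterlim_atI)
      have "((\<lambda>z::complex. 1 - z) \<longlongrightarrow> 1 - 1) (at 1 within stolz M)" by (intro tendsto_intros)
      then show "((\<lambda>z::complex. 1 - z) \<longlongrightarrow> 0) (at 1 within stolz M)" by simp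
      show "\<forall>\<^sub>F z in at 1 within stolz M. 1 - z \<noteq> 0" by (auto simp: eventually_at_filter)
    qed
  qed simp
  show "\<forall>\<^sub>F z in at 1 within stolz M. 0 < Im (cayley z) \<and> cmod (cayley z) \<le> 2 * M * Im (cayley z)"
    using eventually_stolz
  proof eventually_elim
    case (elim z)
    then have z: "cmod z < 1" "cmod (1 - z) \<le> M * (1 - cmod z)" and nz: "0 < cmod (1 - z)" by auto
    have M: "0 \<le> M" using z nz by (smt (verit) mult_neg_pos)
    have "cmod (1 + z) \<le> 2" using norm_triangle_ineq[of 1 z] z by simp
    then have "cmod (1 + z) * cmod (1 - z) \<le> 2 * (M * (1 - cmod z))"
      using z by (intro mult_mono) auto
    also have "\<dots> \<le> 2 * (M * ((1 - cmod z) * (1 + cmod z)))"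
      using z M mult_left_mono[of 1 "1 + cmod z" "1 - cmod z"] by (intro mult_left_mono) auto
    finally have "cmod (1 + z) * cmod (1 - z) \<le> 2 * M * (1 - (cmod z)\<^sup>2)"
      by (simp add: power2_eq_square algebra_simps)
    then have "cmod (1 + z) \<le> 2 * M * (1 - (cmod z)\<^sup>2) / cmod (1 - z)" using nz by (simp add: le_divide_eq)
    then have "cmod (1 + z) / cmod (1 - z) \<le> 2 * M * (1 - (cmod z)\<^sup>2) / cmod (1 - z) / cmod (1 - z)"
      using nz by (intro divide_right_mono) auto
    then have "cmod (cayley z) \<le> 2 * M * Im (cayley z)"
      by (simp add: cayley_def[of z] norm_divide norm_mult Im_cayley power2_eq_square del: Im_divide)
         (simp add: cayley_def[symmetric] Im_cayley power2_eq_square)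
    then show ?case using cayley_in_half_plane elim by blast
  qed
qed

lemma filterlim_radial:
  assumes "1 < M"
  shows "filterlim (\<lambda>x. complex_of_real x) (at 1 within stolz M) (at_left 1)"
proof (rule filterlim_at_withinI)
  have "((\<lambda>x. complex_of_real x) \<longlongrightarrow> of_real 1) (at_left 1)" by (intro tendsto_intros)
  then show "((\<lambda>x. complex_of_real x) \<longlongrightarrow> 1) (at_left 1)" by simp
  have "\<forall>\<^sub>F x in at_left 1. x \<in> {0<..<1::real}" by (rule eventually_at_leftI[of 0]) auto
  then show "\<forall>\<^sub>F x in at_left 1. complex_of_real x \<in> stolz M - {1}"
  proof eventually_elim
    case (elim x)
    then have "cmod (1 - of_real x) = 1 - x" using norm_of_real[of "1 - x", where ?'a = complex] by simp
    then show ?case using elim assms by (simp add: stolz_def)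
  qed
qed

lemma has_angular_lim_radial:
  assumes "has_angular_lim f 1 L"
  shows "((\<lambda>x. f (of_real x)) \<longlongrightarrow> L) (at_left 1)"
proof -
  have "(f \<longlongrightarrow> L) (at 1 within stolz 2)" using assms by (simp add: has_angular_lim_stolz)
  from filterlim_compose[OF this filterlim_radial] show ?thesis by simp
qed

lemma has_angular_lim_weaken:
  assumes "has_angular_lim (\<lambda>z. g z / (1 - z) ^ n) 1 0"
  shows "has_angular_lim g 1 0"
proof -
  have "has_angular_lim (\<lambda>z. (1 - z) ^ n) 1 (0 ^ n)"
    by (rule has_angular_lim_continuous) (auto intro!: continuous_intros)
  from has_angular_lim_mult[OF assms this] have "has_angular_lim (\<lambda>z. g z / (1 - z) ^ n * (1 - z) ^ n) 1 0" by simp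
  then show ?thesis by (rule has_angular_lim_transform) auto
qed

text \<open>Cauchy's estimate on the disk of radius \<open>(1 - \<bar>z\<bar>) / 2\<close> about \<open>z\<close>. For \<open>z\<close> in a Stolz region this
  disk stays in a wider one, and its radius is comparable to \<open>\<bar>1 - z\<bar>\<close>, so one power is lost.\<close>

lemma angular_decay_deriv:
  assumes hol: "g holomorphic_on \<D>" and lim: "has_angular_lim (\<lambda>z. g z / (1 - z) ^ Suc n) 1 0"
  shows "has_angular_lim (\<lambda>z. deriv g z / (1 - z) ^ n) 1 0"
  unfolding has_angular_lim_stolz
proof (intro allI impI)
  fix M :: real assume M: "1 < M"
  show "((\<lambda>z. deriv g z / (1 - z) ^ n) \<longlongrightarrow> 0) (at 1 within stolz M)"
    unfolding Lim_within
  proof (intro allI impI)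
    fix e :: real assume e: "0 < e"
    define e' where "e' = e / (2 ^ (n + 3) * M)"
    have e': "0 < e'" using e M by (simp add: e'_def)
    have "((\<lambda>z. g z / (1 - z) ^ Suc n) \<longlongrightarrow> 0) (at 1 within stolz (2 * M + 2))"
      using lim M unfolding has_angular_lim_stolz by simp
    then obtain d where d: "0 < d" and dd: "\<And>w. w \<in> stolz (2 * M + 2) \<Longrightarrow> 0 < dist w 1 \<Longrightarrow> dist w 1 < d
        \<Longrightarrow> dist (g w / (1 - w) ^ Suc n) 0 < e'"
      using e' unfolding Lim_within by blast
    have "dist (deriv g z / (1 - z) ^ n) 0 < e" if z: "z \<in> stolz M" "dist z 1 < d / 2" for z
    proof -
      have z1: "cmod z < 1" "cmod (1 - z) < M * (1 - cmod z)" using z(1) by (auto simp: stolz_def)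
      then have nz: "0 < cmod (1 - z)" by auto
      define \<rho> where "\<rho> = (1 - cmod z) / 2"
      have \<rho>: "0 < \<rho>" using z1 by (simp add: \<rho>_def)
      have zz: "1 - cmod z \<le> cmod (1 - z)" using norm_triangle_ineq2[of 1 z] by simp
      have gw: "cmod (g w) \<le> e' * (2 * cmod (1 - z)) ^ Suc n" if w: "cmod (z - w) = \<rho>" for w
      proof -
        have a: "cmod w \<le> cmod z + \<rho>" using norm_triangle_ineq3[of z w] w by linarith
        then have a': "(1 - cmod z) / 2 \<le> 1 - cmod w" by (simp add: \<rho>_def field_simps)
        have "cmod (1 - w) \<le> cmod (1 - z) + \<rho>" using norm_triangle_ineq[of "1 - z" "z - w"] w by simp
        moreover have "\<rho> \<le> cmod (1 - z)" using zz z1 by (simp add: \<rho>_def)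
        ultimately have b: "cmod (1 - w) \<le> 2 * cmod (1 - z)" "cmod (1 - w) \<le> M * (1 - cmod z) + (1 - cmod z) / 2"
          using z1 by (linarith, simp add: \<rho>_def)
        have wD: "cmod w < 1" using a z1(1) unfolding \<rho>_def by (simp add: field_simps)
        have "cmod (1 - w) \<le> (2 * M + 1) * ((1 - cmod z) / 2)" using b(2) by (simp add: field_simps)
        also have "\<dots> \<le> (2 * M + 1) * (1 - cmod w)" using a' M by (intro mult_left_mono) auto
        also have "\<dots> < (2 * M + 2) * (1 - cmod w)" using wD by (intro mult_strict_right_mono) auto
        finally have "w \<in> stolz (2 * M + 2)" using wD by (simp add: stolz_def)
        moreover have "0 < dist w 1" using wD by auto
        moreover have "dist w 1 < d" using b(1) z(2) by (simp add: dist_norm norm_minus_commute)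
        ultimately have "cmod (g w / (1 - w) ^ Suc n) < e'" using dd by (simp add: dist_norm del: power_Suc)
        then have "cmod (g w) < e' * cmod (1 - w) ^ Suc n"
          using \<open>0 < dist w 1\<close> by (simp add: norm_divide norm_power dist_norm norm_minus_commute divide_less_eq del: power_Suc)
        also have "\<dots> \<le> e' * (2 * cmod (1 - z)) ^ Suc n"
          using e' b(1) by (intro mult_left_mono power_mono) auto
        finally show ?thesis by simp
      qed
      have sub: "cball z \<rho> \<subseteq> \<D>"
      proof
        fix w assume "w \<in> cball z \<rho>"
        then show "w \<in> \<D>" using norm_triangle_ineq3[of z w] z1 by (simp add: dist_norm \<rho>_def abs_le_iff)
      qed
      have "cmod ((deriv ^^ 1) g z) \<le> fact 1 * (e' * (2 * cmod (1 - z)) ^ Suc n) / \<rho> ^ 1"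
      proof (rule Cauchy_inequality)
        show "g holomorphic_on ball z \<rho>" using hol sub by (meson ball_subset_cball holomorphic_on_subset order_trans)
        show "continuous_on (cball z \<rho>) g"
          using hol sub by (meson holomorphic_on_imp_continuous_on holomorphic_on_subset)
      qed (use \<rho> gw in auto)
      then have "cmod (deriv g z) \<le> e' * (2 * cmod (1 - z)) ^ Suc n / \<rho>" by simp
      also have "\<dots> = e' * 2 ^ (n + 2) * cmod (1 - z) ^ n * (cmod (1 - z) / (1 - cmod z))"
        by (simp add: \<rho>_def power_mult_distrib)
      also have "\<dots> \<le> e' * 2 ^ (n + 2) * cmod (1 - z) ^ n * M"
        using z1 e' by (intro mult_left_mono) (auto simp: divide_le_eq)
      also have "\<dots> = e / 2 * cmod (1 - z) ^ n"
        using M by (simp add: e'_def power_add field_simps)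
      finally have "cmod (deriv g z / (1 - z) ^ n) \<le> e / 2"
        using nz by (simp add: norm_divide norm_power divide_le_eq)
      then show ?thesis using e by (simp add: dist_norm)
    qed
    then show "\<exists>d>0. \<forall>x\<in>stolz M. 0 < dist x 1 \<and> dist x 1 < d \<longrightarrow> dist (deriv g x / (1 - x) ^ n) 0 < e"
      using d by (intro exI[of _ "d / 2"]) auto
  qed
qed

section \<open>Angular derivatives of hydrodynamic maps\<close>

lemma cayley_inv_formula: "0 < Im w \<Longrightarrow> cayley_inv w = 1 - 2 * \<i> / (w + \<i>)"
  using diff_cnj_nonzero[of w \<i>] by (simp add: cayley_inv_eq disk_chart_def field_simps)

text \<open>With \<open>w = cayley z\<close> one has \<open>1 - z = 2 \<i> / (w + \<i>)\<close>, whence the quotient equals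
  \<open>- (G w - w) (w + \<i>)^2 / (4 (G w + \<i>))\<close>, which is asymptotic to \<open>- w (G w - w) / 4\<close>.\<close>

lemma hydrodynamic_disk_expansion:
  assumes G: "hydrodynamic G l" and \<phi>: "\<And>z. z \<in> \<D> \<Longrightarrow> \<phi> z = cayley_inv (G (cayley z))"
  shows "has_angular_lim (\<lambda>z. (\<phi> z - z) / (1 - z) ^ 3) 1 (of_real (l / 4))"
  unfolding has_angular_lim_stolz
proof (intro allI impI)
  fix M :: real assume "1 < M"
  let ?N = "nontangential (2 * M)"
  let ?P = "\<lambda>w. w * (G w - w)"
  have inv: "(inverse \<longlongrightarrow> 0) ?N"
    using tendsto_inverse_0 by (rule tendsto_mono[rotated]) (simp add: nontangential_def)
  have "((\<lambda>w. - (1/4) * ?P w * (1 + \<i> * inverse w) * (1 + \<i> * inverse w) / (1 + ?P w * inverse w * inverse w + \<i> * inverse w))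
      \<longlongrightarrow> - (1/4) * of_real (- l) * (1 + \<i> * 0) * (1 + \<i> * 0) / (1 + of_real (- l) * 0 * 0 + \<i> * 0)) ?N"
    by (intro tendsto_intros inv hydrodynamicD(5)[OF G]) auto
  from filterlim_compose[OF this filterlim_cayley_nontangential[of M]]
  show "((\<lambda>z. (\<phi> z - z) / (1 - z) ^ 3) \<longlongrightarrow> of_real (l / 4)) (at 1 within stolz M)"
  proof (rule Lim_transform_eventually[OF tendsto_eq_rhs])
    show "\<forall>\<^sub>F z in at 1 within stolz M. - (1/4) * ?P (cayley z) * (1 + \<i> * inverse (cayley z)) * (1 + \<i> * inverse (cayley z))
       / (1 + ?P (cayley z) * inverse (cayley z) * inverse (cayley z) + \<i> * inverse (cayley z)) = (\<phi> z - z) / (1 - z) ^ 3"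
      using eventually_stolz
    proof eventually_elim
      case (elim z)
      then have z: "z \<in> \<D>" by simp
      define w where "w = cayley z"
      have w: "0 < Im w" using cayley_in_half_plane[OF z] by (simp add: w_def)
      have Gw: "0 < Im (G w)" using hydrodynamicD(3)[OF G w] .
      have nz: "w \<noteq> 0" "w + \<i> \<noteq> 0" "G w + \<i> \<noteq> 0" using w Gw by (auto simp: complex_eq_iff)
      have ze: "z = 1 - 2 * \<i> / (w + \<i>)"
        using cayley_inv_formula[OF w] cayley_inv_cayley[OF z] by (simp add: w_def)
      have \<phi>e: "\<phi> z = 1 - 2 * \<i> / (G w + \<i>)"
        using cayley_inv_formula[OF Gw] \<phi>[OF z] by (simp add: w_def)
      have "\<phi> z - z = 2 * \<i> * (G w - w) / ((w + \<i>) * (G w + \<i>))"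
        unfolding \<phi>e by (subst ze) (use nz in \<open>simp add: field_simps\<close>)
      have "1 - z = 2 * \<i> / (w + \<i>)" by (subst ze) simp
      then have "(1 - z) ^ 3 = - 8 * \<i> / (w + \<i>) ^ 3" by (simp add: power_divide power3_eq_cube)
      have "(\<phi> z - z) / (1 - z) ^ 3 = - (1/4) * (G w - w) * (w + \<i>)\<^sup>2 / (G w + \<i>)"
      proof -
        have gen: "2 * \<i> * D / (Q * P) / (- 8 * \<i> / Q ^ 3) = - (1/4) * D * Q\<^sup>2 / P"
          if "P \<noteq> 0" "Q \<noteq> 0" for D P Q :: complex
          using that by (simp add: field_simps power2_eq_square power3_eq_cube)
        show ?thesis unfolding \<open>\<phi> z - z = _\<close> \<open>(1 - z) ^ 3 = _\<close> using gen nz by blast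
      qed
      also have "\<dots> = - (1/4) * ?P w * (1 + \<i> * inverse w) * (1 + \<i> * inverse w)
          / (1 + ?P w * inverse w * inverse w + \<i> * inverse w)"
      proof -
        have "1 + \<i> * inverse w = (w + \<i>) / w" using nz by (simp add: field_simps)
        moreover have "1 + ?P w * inverse w * inverse w + \<i> * inverse w = (G w + \<i>) / w"
          using nz by (simp add: field_simps)
        ultimately show ?thesis using nz by (simp add: power2_eq_square)
      qed
      finally show ?case unfolding w_def by simp
    qed
  qed simp
qed

lemma univalent_cayley_conjugate:
  assumes G: "univalent_on \<H> G" "G ` \<H> \<subseteq> \<H>" and \<phi>: "\<And>z. z \<in> \<D> \<Longrightarrow> \<phi> z = cayley_inv (G (cayley z))"
  shows "univalent_on \<D> \<phi>" "\<phi> ` \<D> \<subseteq> \<D>"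
proof -
  have m: "cayley z \<in> \<H>" "G (cayley z) \<in> \<H>" if "z \<in> \<D>" for z
    using cayley_in_half_plane[OF that] G(2) by (auto simp: image_subset_iff)
  have "(cayley_inv \<circ> (G \<circ> cayley)) holomorphic_on \<D>"
    using G by (intro holomorphic_on_compose_gen[OF holomorphic_on_compose_gen[OF holomorphic_cayley] holomorphic_cayley_inv])
      (use m in \<open>auto simp: univalent_on_def\<close>)
  then have "\<phi> holomorphic_on \<D>"
    by (rule holomorphic_transform) (simp add: \<phi>)
  moreover have "inj_on \<phi> \<D>"
  proof (rule inj_onI)
    fix x y assume xy: "x \<in> \<D>" "y \<in> \<D>" "\<phi> x = \<phi> y"
    then have "G (cayley x) = G (cayley y)"
      using m \<phi> inj_onD[OF inj_on_cayley_inv] by metis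
    then have "cayley x = cayley y" using G m xy unfolding univalent_on_def inj_on_def by blast
    then show "x = y" using xy inj_onD[OF inj_on_cayley] by blast
  qed
  ultimately show "univalent_on \<D> \<phi>" by (simp add: univalent_on_def)
  show "\<phi> ` \<D> \<subseteq> \<D>" using m \<phi> cayley_inv_in_disk by (auto simp del: mem_ball)
qed

text \<open>By the expansion, \<open>g z = \<phi> z - z - \<kappa> (1 - z)^3\<close> is \<open>o((1 - z)^3)\<close> in Stolz regions, and three
  applications of the Cauchy estimate give the limits of the derivatives of \<open>\<phi>\<close> at \<open>1\<close>, namely \<open>1\<close>, \<open>0\<close> and
  \<open>- 6 \<kappa>\<close>. The condition on the second derivative reads \<open>0 = 1 * 0\<close>.\<close>

lemma calP0_subset_calC_tilde: "calP0 \<subseteq> calC_tilde"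
proof
  fix \<phi> assume "\<phi> \<in> calP0"
  then obtain G where G: "G \<in> frakP0" and "\<forall>z\<in>\<D>. \<phi> z = (cayley_inv \<circ> G \<circ> cayley) z"
    unfolding calP0_def by blast
  then have \<phi>: "\<phi> z = cayley_inv (G (cayley z))" if "z \<in> \<D>" for z using that by simp
  obtain l where l: "hydrodynamic G l" using frakP0_hydrodynamic[OF G] .
  have uni: "univalent_on \<D> \<phi>" "\<phi> ` \<D> \<subseteq> \<D>"
    using univalent_cayley_conjugate[of G \<phi>] \<phi> G by (auto simp: frakP0_def)
  then have hol: "\<phi> holomorphic_on \<D>" by (simp add: univalent_on_def)
  define \<kappa> where "\<kappa> = complex_of_real (l / 4)"
  define g where "g z = \<phi> z - z - \<kappa> * (1 - z) ^ 3" for z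
  have holg: "g holomorphic_on \<D>" unfolding g_def[abs_def] by (intro holomorphic_intros hol)
  have holg1: "deriv g holomorphic_on \<D>" by (intro holomorphic_deriv holg) auto
  have holg2: "deriv (deriv g) holomorphic_on \<D>" by (intro holomorphic_deriv holg1) auto
  have poly: "has_angular_lim (\<lambda>z. c * (1 - z) ^ n) 1 (c * 0 ^ n)" for c n
    by (rule has_angular_lim_continuous) (auto intro!: continuous_intros)
  have const: "has_angular_lim (\<lambda>z. c) 1 c" for c by (rule has_angular_lim_continuous) auto
  have g0: "has_angular_lim (\<lambda>z. g z / (1 - z) ^ Suc 2) 1 0"
  proof -
    have "has_angular_lim (\<lambda>z. (\<phi> z - z) / (1 - z) ^ 3 + - \<kappa>) 1 (\<kappa> + - \<kappa>)"
      unfolding \<kappa>_def by (intro has_angular_lim_add const hydrodynamic_disk_expansion[OF l \<phi>])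
    then have "has_angular_lim (\<lambda>z. (\<phi> z - z) / (1 - z) ^ 3 + - \<kappa>) 1 0" by simp
    then show ?thesis
      by (rule has_angular_lim_transform) (auto simp: g_def diff_divide_distrib numeral_3_eq_3)
  qed
  have g1: "has_angular_lim (\<lambda>z. deriv g z / (1 - z) ^ Suc 1) 1 0"
    using angular_decay_deriv[OF holg g0] by (simp add: numeral_2_eq_2)
  have g2: "has_angular_lim (\<lambda>z. deriv (deriv g) z / (1 - z) ^ Suc 0) 1 0"
    using angular_decay_deriv[OF holg1 g1] by simp
  have g3: "has_angular_lim (\<lambda>z. deriv (deriv (deriv g)) z) 1 0"
    using angular_decay_deriv[OF holg2 g2] by simp
  have d1: "deriv \<phi> z = deriv g z + (1 + (- 3 * \<kappa>) * (1 - z) ^ 2)" if z: "z \<in> \<D>" for z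
  proof -
    have "((\<lambda>z. g z + z + \<kappa> * (1 - z) ^ 3) has_field_derivative deriv g z + (1 + (- 3 * \<kappa>) * (1 - z) ^ 2)) (at z)"
      by (auto intro!: derivative_eq_intros holomorphic_derivI[OF holg _ z] simp: algebra_simps)
    then show ?thesis by (simp add: g_def DERIV_imp_deriv)
  qed
  have d2: "deriv (deriv \<phi>) z = deriv (deriv g) z + (6 * \<kappa>) * (1 - z) ^ 1" if z: "z \<in> \<D>" for z
  proof -
    have "deriv (deriv \<phi>) z = deriv (\<lambda>z. deriv g z + (1 + (- 3 * \<kappa>) * (1 - z) ^ 2)) z"
    proof (rule complex_derivative_transform_within_open[OF _ _ open_ball z])
      show "deriv \<phi> holomorphic_on \<D>" by (intro holomorphic_deriv hol) auto
      show "(\<lambda>z. deriv g z + (1 + (- 3 * \<kappa>) * (1 - z) ^ 2)) holomorphic_on \<D>"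
        by (intro holomorphic_intros holg1)
    qed (rule d1)
    also have "\<dots> = deriv (deriv g) z + (6 * \<kappa>) * (1 - z) ^ 1"
      by (rule DERIV_imp_deriv)
         (auto intro!: derivative_eq_intros holomorphic_derivI[OF holg1 _ z] simp: algebra_simps)
    finally show ?thesis .
  qed
  have d3: "deriv (deriv (deriv \<phi>)) z = deriv (deriv (deriv g)) z + (- 6 * \<kappa>)" if z: "z \<in> \<D>" for z
  proof -
    have "deriv (deriv (deriv \<phi>)) z = deriv (\<lambda>z. deriv (deriv g) z + (6 * \<kappa>) * (1 - z) ^ 1) z"
    proof (rule complex_derivative_transform_within_open[OF _ _ open_ball z])
      show "deriv (deriv \<phi>) holomorphic_on \<D>" by (intro holomorphic_deriv hol) auto
      show "(\<lambda>z. deriv (deriv g) z + (6 * \<kappa>) * (1 - z) ^ 1) holomorphic_on \<D>"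
        by (intro holomorphic_intros holg2)
    qed (rule d2)
    also have "\<dots> = deriv (deriv (deriv g)) z + (- 6 * \<kappa>)"
      by (rule DERIV_imp_deriv)
         (auto intro!: derivative_eq_intros holomorphic_derivI[OF holg2 _ z] simp: algebra_simps)
    finally show ?thesis .
  qed
  have L1: "has_angular_lim (deriv \<phi>) 1 1"
    by (rule has_angular_lim_transform[OF _ d1[symmetric]])
       (use has_angular_lim_add[OF has_angular_lim_weaken[OF g1] has_angular_lim_add[OF const[of 1] poly[of "- 3 * \<kappa>" 2]]] in simp_all)
  have L2: "has_angular_lim (deriv (deriv \<phi>)) 1 0"
    by (rule has_angular_lim_transform[OF _ d2[symmetric]])
       (use has_angular_lim_add[OF has_angular_lim_weaken[OF g2] poly[of "6 * \<kappa>" 1]] in simp_all)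
  have L3: "has_angular_lim (deriv (deriv (deriv \<phi>))) 1 (- 6 * \<kappa>)"
    by (rule has_angular_lim_transform[OF _ d3[symmetric]])
       (use has_angular_lim_add[OF g3 const[of "- 6 * \<kappa>"]] in simp_all)
  have id: "has_angular_lim (\<lambda>z. z) 1 1" by (rule has_angular_lim_continuous) auto
  have L0: "has_angular_lim \<phi> 1 1"
    by (rule has_angular_lim_transform[OF has_angular_lim_add[OF has_angular_lim_weaken[OF g0] has_angular_lim_add[OF id poly[of \<kappa> 3]], simplified]])
       (simp add: g_def)
  have D: "has_angular_deriv \<phi> 1 1 1"
    unfolding has_angular_deriv_def
  proof (rule has_angular_lim_transform)
    have "has_angular_lim (\<lambda>z. g z / (1 - z)) 1 0"
    proof (rule has_angular_lim_weaken[of _ 2])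
      show "has_angular_lim (\<lambda>z. g z / (1 - z) / (1 - z)\<^sup>2) 1 0"
        by (rule has_angular_lim_transform[OF g0]) (simp add: power2_eq_square power3_eq_cube)
    qed
    then have "has_angular_lim (\<lambda>z. - 1 * (g z / (1 - z)) + ((- \<kappa>) * (1 - z) ^ 2 + 1)) 1 (- 1 * 0 + ((- \<kappa>) * 0 ^ 2 + 1))"
      by (intro has_angular_lim_add has_angular_lim_mult const poly)
    then show "has_angular_lim (\<lambda>z. - 1 * (g z / (1 - z)) + ((- \<kappa>) * (1 - z) ^ 2 + 1)) 1 1" by simp
    show "- 1 * (g z / (1 - z)) + ((- \<kappa>) * (1 - z) ^ 2 + 1) = (\<phi> z - 1) / (z - 1)" if "z \<in> \<D>" for z
    proof -
      have nz: "1 - z \<noteq> 0" using that by auto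
      have gen: "- 1 * (u / X) + ((- \<kappa>) * X ^ 2 + 1) = (u + \<kappa> * X ^ 3 - X) / (- X)" if "X \<noteq> 0" for u X
        using that by (simp add: field_simps power2_eq_square power3_eq_cube)
      have "(\<phi> z - 1) / (z - 1) = (g z + \<kappa> * (1 - z) ^ 3 - (1 - z)) / (- (1 - z))" by (simp add: g_def)
      then show ?thesis using gen[OF nz] by (simp only:)
    qed
  qed
  show "\<phi> \<in> calC_tilde"
    unfolding calC_tilde_def calC_def
  proof (intro CollectI conjI ballI)
    fix j assume "j \<in> {1, 2, 3::nat}"
    then show "\<exists>p. has_angular_lim ((deriv ^^ j) \<phi>) 1 p"
      using L1 L2 L3 by (auto simp: numeral_2_eq_2 numeral_3_eq_3)
  next
    show "\<exists>a p. has_angular_deriv \<phi> 1 1 a \<and> has_angular_lim ((deriv ^^ 2) \<phi>) 1 p \<and> complex_of_real (Re p) = a * (a - 1)"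
      using D L2 by (intro exI[of _ 1] exI[of _ 0]) (simp add: numeral_2_eq_2)
  qed (use uni L0 D in auto)
qed

section \<open>From angular derivatives to a hydrodynamic normalisation\<close>

text \<open>The mean value inequality on the segment from \<open>r\<close> to \<open>s\<close>, followed by \<open>s \<longlongrightarrow> 1\<close>; the point \<open>1\<close>
  itself is outside the domain of \<open>f\<close>.\<close>

lemma radial_integral_bound:
  fixes f f' :: "complex \<Rightarrow> complex"
  assumes deriv: "\<And>x. r0 < x \<Longrightarrow> x < 1 \<Longrightarrow> (f has_field_derivative f' (of_real x)) (at (of_real x))"
    and bound: "\<And>x. r0 < x \<Longrightarrow> x < 1 \<Longrightarrow> cmod (f' (of_real x)) \<le> K * (1 - x) ^ n"
    and lim: "((\<lambda>x. f (of_real x)) \<longlongrightarrow> 0) (at_left 1)" and r: "r0 < r" "r < 1"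
  shows "cmod (f (of_real r)) \<le> K * (1 - r) ^ Suc n"
proof -
  have K: "0 \<le> K * (1 - r) ^ n" using bound[OF r] norm_ge_zero order_trans by blast
  have K0: "0 \<le> K"
  proof (rule ccontr)
    assume "\<not> 0 \<le> K"
    then have "K * (1 - r) ^ n < 0" using r by (intro mult_neg_pos) auto
    then show False using K by linarith
  qed
  have "cmod (f (of_real r) - f (of_real s)) \<le> K * (1 - r) ^ Suc n" if s: "r < s" "s < 1" for s
  proof -
    have "cmod (f (of_real r) - f (of_real s)) \<le> (K * (1 - r) ^ n) * cmod (of_real r - of_real s)"
    proof (rule field_differentiable_bound[of "closed_segment (of_real r) (of_real s)"])
      fix z :: complex assume "z \<in> closed_segment (of_real r) (of_real s)"
      then obtain x where x: "z = of_real x" "r \<le> x" "x \<le> s"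
        using s by (auto simp: closed_segment_of_real closed_segment_eq_real_ivl)
      then show "(f has_field_derivative f' z) (at z within closed_segment (of_real r) (of_real s))"
        using deriv[of x] r s by (auto intro: has_field_derivative_at_within)
      have "cmod (f' z) \<le> K * (1 - x) ^ n" using bound[of x] x r s by simp
      also have "\<dots> \<le> K * (1 - r) ^ n" using x s r K0 by (intro mult_left_mono power_mono) auto
      finally show "cmod (f' z) \<le> K * (1 - r) ^ n" .
    qed auto
    also have "cmod (of_real r - of_real s :: complex) = s - r"
      using s norm_of_real[of "r - s", where ?'a = complex] by simp
    also have "(K * (1 - r) ^ n) * (s - r) \<le> (K * (1 - r) ^ n) * (1 - r)"
      using s K by (intro mult_left_mono) auto
    finally show ?thesis by (simp add: mult_ac)
  qed
  then have "\<forall>\<^sub>F s in at_left 1. cmod (f (of_real r) - f (of_real s)) \<le> K * (1 - r) ^ Suc n"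
    using r by (intro eventually_at_leftI[of r]) auto
  moreover have "((\<lambda>s. cmod (f (of_real r) - f (of_real s))) \<longlongrightarrow> cmod (f (of_real r) - 0)) (at_left 1)"
    by (intro tendsto_intros lim)
  ultimately have "cmod (f (of_real r) - 0) \<le> K * (1 - r) ^ Suc n"
    by (intro tendsto_upperbound) auto
  then show ?thesis by simp
qed

text \<open>Taylor's formula at a boundary point: near \<open>1\<close> the third derivative is bounded along the
  radius, and three integrations from \<open>1\<close> produce the remainder.\<close>

lemma radial_taylor_bound:
  assumes hol: "\<psi> holomorphic_on \<D>"
    and L0: "has_angular_lim \<psi> 1 1" and L1: "has_angular_lim (deriv \<psi>) 1 p1"
    and L2: "has_angular_lim (deriv (deriv \<psi>)) 1 p2" and L3: "has_angular_lim (deriv (deriv (deriv \<psi>))) 1 p3"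
  shows "\<exists>r0 K. 0 \<le> r0 \<and> r0 < 1 \<and> 0 < K \<and> (\<forall>r\<in>{r0<..<1}. cmod (\<psi> (of_real r) - 1 - p1 * (of_real r - 1) - p2 * (of_real r - 1)\<^sup>2 / 2) \<le> K * (1 - r) ^ 3)"
proof -
  have holom: "deriv \<psi> holomorphic_on \<D>" "deriv (deriv \<psi>) holomorphic_on \<D>"
    by (intro holomorphic_deriv hol open_ball)+
  define K where "K = cmod p3 + 1"
  have "\<forall>\<^sub>F x in at_left 1. dist (deriv (deriv (deriv \<psi>)) (of_real x)) p3 < 1"
    by (rule tendstoD[OF has_angular_lim_radial[OF L3]]) simp
  then obtain b where b: "b < 1" "\<And>x. b < x \<Longrightarrow> x < 1 \<Longrightarrow> dist (deriv (deriv (deriv \<psi>)) (of_real x)) p3 < 1"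
    unfolding eventually_at_left[OF zero_less_one] by blast
  define r0 where "r0 = max b 0"
  have B3: "cmod (deriv (deriv (deriv \<psi>)) (of_real x)) \<le> K * (1 - x) ^ 0" if "r0 < x" "x < 1" for x
    using b(2)[of x] that norm_triangle_ineq2[of "deriv (deriv (deriv \<psi>)) (of_real x)" p3]
    by (simp add: K_def r0_def dist_norm)
  have inD: "complex_of_real x \<in> \<D>" if "r0 < x" "x < 1" for x
    using that by (simp add: r0_def)
  have zero: "((\<lambda>x. h (of_real x)) \<longlongrightarrow> 0) (at_left 1)"
    if "((\<lambda>x. g (of_real x)) \<longlongrightarrow> L) (at_left 1)" "\<And>z. h z = g z - L - c * (z - 1) - d * (z - 1)\<^sup>2 / 2"
    for g h :: "complex \<Rightarrow> complex" and L c d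
  proof -
    have "((\<lambda>x. g (of_real x) - L - c * (of_real x - 1) - d * (of_real x - 1)\<^sup>2 / 2)
        \<longlongrightarrow> L - L - c * (of_real 1 - 1) - d * (of_real 1 - 1)\<^sup>2 / 2) (at_left 1)"
      by (intro tendsto_intros that(1)) simp
    then show ?thesis by (simp add: that(2))
  qed
  have B2: "cmod (deriv (deriv \<psi>) (of_real x) - p2) \<le> K * (1 - x) ^ Suc 0" if "r0 < x" "x < 1" for x
  proof (rule radial_integral_bound[where f = "\<lambda>z. deriv (deriv \<psi>) z - p2", OF _ B3 _ that])
    show "((\<lambda>x. deriv (deriv \<psi>) (of_real x) - p2) \<longlongrightarrow> 0) (at_left 1)"
      by (rule zero[OF has_angular_lim_radial[OF L2], where c = 0 and d = 0]) simp
  qed (use inD in \<open>auto intro!: derivative_eq_intros holomorphic_derivI[OF holom(2)]\<close>)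
  have B1: "cmod (deriv \<psi> (of_real x) - p1 - p2 * (of_real x - 1)) \<le> K * (1 - x) ^ Suc (Suc 0)" if "r0 < x" "x < 1" for x
  proof (rule radial_integral_bound[where f = "\<lambda>z. deriv \<psi> z - p1 - p2 * (z - 1)", OF _ B2 _ that])
    show "((\<lambda>x. deriv \<psi> (of_real x) - p1 - p2 * (of_real x - 1)) \<longlongrightarrow> 0) (at_left 1)"
      by (rule zero[OF has_angular_lim_radial[OF L1], where c = p2 and d = 0]) simp
  qed (use inD in \<open>auto intro!: derivative_eq_intros holomorphic_derivI[OF holom(1)]\<close>)
  have B0: "cmod (\<psi> (of_real x) - 1 - p1 * (of_real x - 1) - p2 * (of_real x - 1)\<^sup>2 / 2) \<le> K * (1 - x) ^ Suc (Suc (Suc 0))"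
    if "r0 < x" "x < 1" for x
  proof (rule radial_integral_bound[where f = "\<lambda>z. \<psi> z - 1 - p1 * (z - 1) - p2 * (z - 1)\<^sup>2 / 2", OF _ B1 _ that])
    show "((\<lambda>x. \<psi> (of_real x) - 1 - p1 * (of_real x - 1) - p2 * (of_real x - 1)\<^sup>2 / 2) \<longlongrightarrow> 0) (at_left 1)"
      by (rule zero[OF has_angular_lim_radial[OF L0], where c = p1 and d = p2]) simp
  qed (use inD in \<open>auto intro!: derivative_eq_intros holomorphic_derivI[OF hol]\<close>)
  show ?thesis
  proof (rule exI[of _ r0], rule exI[of _ K], intro conjI ballI)
    show "0 \<le> r0" "r0 < 1" using b by (auto simp: r0_def)
    show "0 < K" by (simp add: K_def add_nonneg_pos)
  qed (use B0 in \<open>simp add: numeral_3_eq_3\<close>)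
qed

lemma cayley_radial:
  "filterlim (\<lambda>r. cayley (of_real r)) (nontangential 4) (at_left 1)"
  using filterlim_compose[OF filterlim_cayley_nontangential[of 2] filterlim_radial[of 2]] by simp

text \<open>Let \<open>X = 1 - r\<close> and \<open>e = 1 - \<psi> r = a X - p2 X^2 / 2 + O(X^3)\<close>. In the half-plane \<open>w = 2 \<i> / X - \<i>\<close> is
  mapped to \<open>G w = 2 \<i> / e - \<i> = w / a + \<beta> + O(X)\<close> with
  \<open>\<beta> = \<i> (p2 / a^2 + 1 / a - 1)\<close>. Here \<open>a\<close> is positive because its reciprocal is the
  constant of the Julia--Wolff--Caratheodory theorem for \<open>G\<close>, and \<open>Im \<beta> = 0\<close> is the condition
  \<open>Re p2 = a (a - 1)\<close>. Since \<open>X = O(1 / \<bar>w\<bar>)\<close>, the affine renormalisation of \<open>G\<close> satisfies the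
  hypothesis of \<open>hydrodynamicI\<close>.\<close>

lemma calC_tilde_normalisation:
  assumes "\<psi> \<in> calC_tilde"
  obtains A b l where "0 < A" "hydrodynamic (\<lambda>w. of_real A * (cayley (\<psi> (cayley_inv w)) - of_real b)) l"
proof -
  have "\<psi> holomorphic_on \<D>" "\<psi> ` \<D> \<subseteq> \<D>" "has_angular_lim \<psi> 1 1"
    and ex: "\<And>j. j \<in> {1, 2, 3} \<Longrightarrow> \<exists>p. has_angular_lim ((deriv ^^ j) \<psi>) 1 p"
    using assms by (auto simp: calC_tilde_def calC_def univalent_on_def)
  then have \<psi>: "\<psi> holomorphic_on \<D>" "\<And>z. z \<in> \<D> \<Longrightarrow> \<psi> z \<in> \<D>" "has_angular_lim \<psi> 1 1"
    by blast+
  obtain a p2 where a: "has_angular_deriv \<psi> 1 1 a" and p2: "has_angular_lim ((deriv ^^ 2) \<psi>) 1 p2"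
    and re: "complex_of_real (Re p2) = a * (a - 1)"
    using assms by (auto simp: calC_tilde_def)
  obtain p1 p3 where p1: "has_angular_lim ((deriv ^^ 1) \<psi>) 1 p1" and p3: "has_angular_lim ((deriv ^^ 3) \<psi>) 1 p3"
    using ex[of 1] ex[of 3] by auto
  have p1: "has_angular_lim (deriv \<psi>) 1 p1" and p2: "has_angular_lim (deriv (deriv \<psi>)) 1 p2"
    and p3: "has_angular_lim (deriv (deriv (deriv \<psi>))) 1 p3"
    using p1 p2 p3 by (simp_all add: eval_nat_numeral)
  obtain r0 K where "0 \<le> r0 \<and> r0 < 1 \<and> 0 < K \<and>
      (\<forall>r\<in>{r0<..<1}. cmod (\<psi> (of_real r) - 1 - p1 * (of_real r - 1) - p2 * (of_real r - 1)\<^sup>2 / 2) \<le> K * (1 - r) ^ 3)"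
    using radial_taylor_bound[OF \<psi>(1,3) p1 p2 p3] by (elim exE) (rule that)
  then have K: "0 \<le> r0" "r0 < 1" "0 < K"
    "\<And>r. r0 < r \<Longrightarrow> r < 1 \<Longrightarrow> cmod (\<psi> (of_real r) - 1 - p1 * (of_real r - 1) - p2 * (of_real r - 1)\<^sup>2 / 2) \<le> K * (1 - r) ^ 3"
    by simp_all
  define E where "E r = \<psi> (of_real r) - 1 - p1 * (of_real r - 1) - p2 * (of_real r - 1)\<^sup>2 / 2" for r :: real
  have near: "\<forall>\<^sub>F r in at_left 1. r0 < r \<and> r < 1"
    using K(2) by (intro eventually_at_leftI[of r0]) auto
  have axis: "((\<lambda>r. (\<psi> (of_real r) - 1) / (of_real r - 1)) \<longlongrightarrow> a) (at_left 1)"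
    using has_angular_lim_radial[OF a[unfolded has_angular_deriv_def]] .
  have Elim: "((\<lambda>r. E r / (of_real r - 1)) \<longlongrightarrow> 0) (at_left 1)"
  proof (rule Lim_null_comparison)
    have "((\<lambda>r::real. K * (1 - r)\<^sup>2) \<longlongrightarrow> K * (1 - 1)\<^sup>2) (at_left 1)" by (intro tendsto_intros)
    then show "((\<lambda>r::real. K * (1 - r)\<^sup>2) \<longlongrightarrow> 0) (at_left 1)" by simp
    show "\<forall>\<^sub>F r in at_left 1. cmod (E r / (of_real r - 1)) \<le> K * (1 - r)\<^sup>2"
      using near
    proof eventually_elim
      case (elim r)
      have "cmod (of_real r - 1) = 1 - r" using elim norm_of_real[of "r - 1", where ?'a = complex] by simp
      then show ?case using K(4)[of r] elim
        by (simp add: norm_divide E_def divide_le_eq power2_eq_square power3_eq_cube mult.assoc)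
    qed
  qed
  have "((\<lambda>r. p1 + p2 * (of_real r - 1) / 2 + E r / (of_real r - 1)) \<longlongrightarrow> p1 + p2 * (of_real 1 - 1) / 2 + 0) (at_left 1)"
    by (intro tendsto_intros Elim) simp
  then have "((\<lambda>r. (\<psi> (of_real r) - 1) / (of_real r - 1)) \<longlongrightarrow> p1 + p2 * (of_real 1 - 1) / 2 + 0) (at_left 1)"
  proof (rule Lim_transform_eventually)
    show "\<forall>\<^sub>F r in at_left 1. p1 + p2 * (of_real r - 1) / 2 + E r / (of_real r - 1) = (\<psi> (of_real r) - 1) / (of_real r - 1)"
      using near
    proof eventually_elim
      case (elim r)
      then have "complex_of_real r - 1 \<noteq> 0" by auto
      then show ?case by (simp add: E_def field_simps power2_eq_square)
    qed
  qed
  \<comment> \<open>The limit of the derivative agrees with the angular derivative of the definition.\<close>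
  then have p1a: "p1 = a" using axis tendsto_unique[OF trivial_limit_at_left_real] by fastforce
  define G where "G w = cayley (\<psi> (cayley_inv w))" for w
  have Gpos: "0 < Im (G w)" if "0 < Im w" for w
    unfolding G_def using cayley_in_half_plane \<psi>(2) cayley_inv_in_disk that by blast
  have "(cayley \<circ> (\<psi> \<circ> cayley_inv)) holomorphic_on \<H>"
    by (intro holomorphic_on_compose_gen[OF holomorphic_on_compose_gen[OF holomorphic_cayley_inv \<psi>(1)] holomorphic_cayley])
       (use cayley_inv_in_disk \<psi>(2) in \<open>auto simp del: mem_ball\<close>)
  then have holG: "G holomorphic_on \<H>" by (simp add: G_def[abs_def] o_def)
  obtain \<alpha> where \<alpha>: "0 \<le> \<alpha>" "\<And>M. ((\<lambda>z. G z / z) \<longlongrightarrow> of_real \<alpha>) (nontangential M)"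
    using julia_wolff_caratheodory[OF holG Gpos] by metis
  have e0: "1 - \<psi> (of_real r) \<noteq> 0" if "r0 < r" "r < 1" for r
    using \<psi>(2)[of "of_real r"] that K(1) by auto
  have "((\<lambda>r. G (cayley (of_real r)) / cayley (of_real r)) \<longlongrightarrow> of_real \<alpha>) (at_left 1)"
    using filterlim_compose[OF \<alpha>(2) cayley_radial] .
  then have "((\<lambda>r. G (cayley (of_real r)) / cayley (of_real r) * ((\<psi> (of_real r) - 1) / (of_real r - 1))) \<longlongrightarrow> of_real \<alpha> * a) (at_left 1)"
    using axis by (intro tendsto_intros)
  moreover have "((\<lambda>r. (1 + \<psi> (of_real r)) / (1 + of_real r)) \<longlongrightarrow> (1 + 1) / (1 + of_real 1)) (at_left 1)"
    by (intro tendsto_intros has_angular_lim_radial[OF \<psi>(3)]) simp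
  then have "((\<lambda>r. G (cayley (of_real r)) / cayley (of_real r) * ((\<psi> (of_real r) - 1) / (of_real r - 1))) \<longlongrightarrow> (1 + 1) / (1 + of_real 1)) (at_left 1)"
  proof (rule Lim_transform_eventually)
    show "\<forall>\<^sub>F r in at_left 1. (1 + \<psi> (of_real r)) / (1 + of_real r) =
        G (cayley (of_real r)) / cayley (of_real r) * ((\<psi> (of_real r) - 1) / (of_real r - 1))"
      using near
    proof eventually_elim
      case (elim r)
      have nz: "1 - complex_of_real r \<noteq> 0" "1 + complex_of_real r \<noteq> 0" "1 - \<psi> (of_real r) \<noteq> 0"
        using elim e0 K(1) by (auto simp: complex_eq_iff)
      have "cayley_inv (cayley (of_real r)) = of_real r" using elim K(1) by (intro cayley_inv_cayley) auto
      then have "G (cayley (of_real r)) = \<i> * (1 + \<psi> (of_real r)) / (1 - \<psi> (of_real r))"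
        by (simp add: G_def cayley_def[of "\<psi> _"])
      moreover have "(\<psi> (of_real r) - 1) / (of_real r - 1) = (1 - \<psi> (of_real r)) / (1 - of_real r)"
        by (metis minus_diff_eq minus_divide_divide)
      ultimately show ?case using nz by (simp add: cayley_def)
    qed
  qed
  ultimately have "complex_of_real \<alpha> * a = (1 + 1) / (1 + of_real 1)"
    by (rule tendsto_unique[OF trivial_limit_at_left_real])
  \<comment> \<open>\<open>G w / w\<close> times the difference quotient of \<open>\<psi>\<close> tends both to \<open>\<alpha> a\<close> and to \<open>1\<close>.\<close>
  then have \<alpha>a: "complex_of_real \<alpha> * a = 1" by simp
  then have \<alpha>0: "0 < \<alpha>" using \<alpha>(1) by (cases "\<alpha> = 0") auto
  define A where "A = 1 / \<alpha>"
  have A0: "0 < A" using \<alpha>0 by (simp add: A_def)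
  have aA: "a = of_real A" using \<alpha>a \<alpha>0 by (simp add: A_def field_simps)
  have reA: "Re p2 = A * (A - 1)"
  proof -
    have "complex_of_real (Re p2) = of_real (A * (A - 1))" using re aA by simp
    then show ?thesis by (simp only: of_real_eq_iff)
  qed
  define \<beta> where "\<beta> = \<i> * (p2 / a\<^sup>2 + 1 / a - 1)"
  have "Im \<beta> = Re p2 / A\<^sup>2 + 1 / A - 1"
  proof -
    have e: "a\<^sup>2 = of_real (A\<^sup>2)" "1 / a = of_real (1 / A)" by (simp_all add: aA)
    show ?thesis unfolding \<beta>_def e by (simp add: Re_divide_of_real)
  qed
  also have "\<dots> = 0" using A0 by (simp add: reA field_simps power2_eq_square)
  finally have \<beta>: "\<beta> = of_real (Re \<beta>)" by (simp add: complex_eq_iff)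
  define H where "H w = of_real A * (G w - of_real (Re \<beta>))" for w
  have "\<exists>l. hydrodynamic H l"
  proof -
    let ?F = "filtermap (\<lambda>r. cayley (of_real r)) (at_left (1::real))"
    \<comment> \<open>Uses \<open>\<bar>e\<bar> \<ge> A x / 2\<close>, valid once \<open>x\<close> is small.\<close>
    define C where "C = 2 * cmod p2 * (cmod p2 + K) / A\<^sup>2 + 4 * K / A"
    have C0: "0 \<le> C" using A0 K(3) by (simp add: C_def)
    have small: "\<forall>\<^sub>F r in at_left 1. (cmod p2 + K) * (1 - r) < A / 2"
    proof -
      have "((\<lambda>r::real. (cmod p2 + K) * (1 - r)) \<longlongrightarrow> (cmod p2 + K) * (1 - 1)) (at_left 1)" by (intro tendsto_intros)
      then show ?thesis using A0 by (intro order_tendstoD(2)) auto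
    qed
    have ev: "\<forall>\<^sub>F z in ?F. cmod (H z - z) \<le> (2 * C) / cmod z"
      unfolding eventually_filtermap using near small
    proof eventually_elim
      case (elim r)
      define x where "x = 1 - r"
      define X where "X = complex_of_real x"
      have x: "0 < x" "x < 1" using elim K(1) by (auto simp: x_def)
      have X0: "X \<noteq> 0" using x by (simp add: X_def)
      have Xr: "complex_of_real r = 1 - X" by (simp add: X_def x_def)
      define e where "e = 1 - \<psi> (of_real r)"
      have enz: "e \<noteq> 0" using e0 elim by (simp add: e_def)
      have anz: "a \<noteq> 0" using A0 aA by simp
      have ee: "e = a * X - p2 * X\<^sup>2 / 2 - E r"
        by (simp add: e_def E_def p1a Xr)
      have Eb: "cmod (E r) \<le> K * x ^ 3" using K(4) elim by (simp add: E_def x_def)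
      have nX: "cmod X = x" using x by (simp add: X_def)
      have x3: "K * x ^ 3 \<le> K * x\<^sup>2"
        using x K(3) by (intro mult_left_mono power_decreasing) auto
      have d: "cmod (a * X - e) \<le> (cmod p2 + K) * x\<^sup>2"
      proof -
        have "a * X - e = p2 * X\<^sup>2 / 2 + E r" by (simp add: ee)
        then have "cmod (a * X - e) \<le> cmod (p2 * X\<^sup>2 / 2) + cmod (E r)" using norm_triangle_ineq by metis
        also have "cmod (p2 * X\<^sup>2 / 2) = cmod p2 * x\<^sup>2 / 2" by (simp add: norm_mult norm_divide norm_power nX)
        also have "cmod p2 * x\<^sup>2 / 2 + cmod (E r) \<le> cmod p2 * x\<^sup>2 + K * x\<^sup>2"
          using Eb x3 by (smt (verit) field_sum_of_halves mult_nonneg_nonneg norm_ge_zero zero_le_power2)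
        finally show ?thesis by (simp add: algebra_simps)
      qed
      have eb: "A * x / 2 \<le> cmod e"
      proof -
        have "(cmod p2 + K) * x\<^sup>2 = ((cmod p2 + K) * x) * x" by (simp add: power2_eq_square)
        also have "\<dots> \<le> A / 2 * x" using elim x by (intro mult_right_mono) (auto simp: x_def)
        finally have "cmod (a * X - e) \<le> A * x / 2" using d by simp
        moreover have "cmod (a * X) = A * x" using A0 x by (simp add: aA norm_mult nX)
        ultimately show ?thesis using norm_triangle_ineq2[of "a * X" "a * X - e"] by simp
      qed
      define w where "w = cayley (of_real r)"
      have we: "w = 2 * \<i> / X - \<i>" using X0 by (simp add: w_def cayley_def Xr field_simps)
      have "cayley_inv w = of_real r" unfolding w_def using elim K(1) by (intro cayley_inv_cayley) auto
      then have Ge: "G w = 2 * \<i> / e - \<i>" using enz by (simp add: G_def cayley_def e_def field_simps)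
      have "H w - w = a * (2 * \<i> / e - \<i>) - \<i> * (p2 / a + 1 - a) - (2 * \<i> / X - \<i>)"
      proof -
        have "of_real A * of_real (Re \<beta>) = a * \<beta>" using \<beta> aA by simp
        also have "\<dots> = \<i> * (p2 / a + 1 - a)"
          using anz by (simp add: \<beta>_def field_simps power2_eq_square)
        finally show ?thesis unfolding H_def Ge right_diff_distrib by (simp add: we aA)
      qed
      also have "\<dots> = 2 * \<i> * (a * X - e) / (e * X) - \<i> * p2 / a"
        using enz X0 by (simp add: field_simps)
      also have "\<dots> = \<i> * p2 * (a * X - e) / (a * e) + 2 * \<i> * E r / (e * X)"
      proof -
        have Er: "E r = a * X - p2 * X\<^sup>2 / 2 - e" by (simp add: ee)
        show ?thesis unfolding Er using enz X0 anz by (simp add: field_simps power2_eq_square)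
      qed
      finally have He: "H w - w = \<i> * p2 * (a * X - e) / (a * e) + 2 * \<i> * E r / (e * X)" .
      have "cmod (\<i> * p2 * (a * X - e) / (a * e)) = cmod p2 * cmod (a * X - e) / (A * cmod e)"
        using A0 by (simp add: norm_mult norm_divide aA)
      also have "\<dots> \<le> cmod p2 * ((cmod p2 + K) * x\<^sup>2) / (A * (A * x / 2))"
        using d eb A0 x K(3) by (intro frac_le mult_left_mono mult_nonneg_nonneg) auto
      also have "\<dots> = 2 * cmod p2 * (cmod p2 + K) / A\<^sup>2 * x"
        using A0 x by (simp add: field_simps power2_eq_square)
      finally have t1: "cmod (\<i> * p2 * (a * X - e) / (a * e)) \<le> 2 * cmod p2 * (cmod p2 + K) / A\<^sup>2 * x" .
      have "cmod (2 * \<i> * E r / (e * X)) = 2 * cmod (E r) / (cmod e * x)"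
        by (simp add: norm_mult norm_divide nX)
      also have "\<dots> \<le> 2 * (K * x ^ 3) / ((A * x / 2) * x)"
        using Eb eb A0 x K(3) by (intro frac_le mult_left_mono mult_right_mono mult_pos_pos) auto
      also have "\<dots> = 4 * K / A * x"
        using A0 x by (simp add: field_simps power3_eq_cube)
      finally have t2: "cmod (2 * \<i> * E r / (e * X)) \<le> 4 * K / A * x" .
      have "cmod (H w - w) \<le> C * x"
        unfolding He C_def using norm_triangle_le[OF add_mono[OF t1 t2]] by (simp add: algebra_simps)
      moreover have "x \<le> 2 / cmod w"
      proof -
        have wx: "w = \<i> * of_real ((2 - x) / x)" using X0 x by (simp add: we X_def field_simps)
        have "cmod w = (2 - x) / x" using x unfolding wx by (simp add: norm_mult norm_divide del: of_real_divide of_real_diff)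
        then have "x * cmod w = 2 - x" "0 < cmod w" using x by simp_all
        then show ?thesis using x by (simp add: le_divide_eq)
      qed
      then have "C * x \<le> C * (2 / cmod w)" using C0 by (intro mult_left_mono) auto
      ultimately show ?case unfolding w_def by (simp add: mult.commute)
    qed
    have F: "?F \<noteq> bot" "?F \<le> nontangential 4"
      using cayley_radial by (simp_all add: filtermap_bot_iff filterlim_def)
    have H: "H holomorphic_on \<H>" "\<And>z. 0 < Im z \<Longrightarrow> 0 < Im (H z)"
      unfolding H_def[abs_def] using Gpos A0 by (auto intro!: holomorphic_intros holG)
    show ?thesis
      by (rule hydrodynamicI[OF H F ev]) (auto intro: exI)
  qed
  then show ?thesis using that A0 unfolding H_def G_def by blast
qed

section \<open>Conformal radius and rigidity\<close>

lemma holomorphic_inv_into: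
  assumes "univalent_on S f" "open S"
  shows "inv_into S f holomorphic_on f ` S"
proof -
  have f: "f holomorphic_on S" "inj_on f S" using assms(1) by (auto simp: univalent_on_def)
  obtain h where h: "h holomorphic_on f ` S" "\<And>z. z \<in> S \<Longrightarrow> h (f z) = z"
    using holomorphic_has_inverse[OF f(1) assms(2) f(2)] by metis
  show ?thesis
    by (rule holomorphic_transform[OF h(1)]) (use f(2) h(2) in auto)
qed

text \<open>Subordination: \<open>k\<inverse> \<circ> h\<close> fixes \<open>0\<close>, so its derivative there is at most \<open>1\<close> in modulus.\<close>

lemma deriv_at_centre_le:
  assumes h: "univalent_on \<D> h" and k: "univalent_on \<D> k" and im: "h ` \<D> \<subseteq> k ` \<D>" and eq: "h 0 = k 0"
  shows "cmod (deriv h 0) \<le> cmod (deriv k 0)"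
proof -
  define u where "u = inv_into \<D> k \<circ> h"
  have hol: "h holomorphic_on \<D>" "k holomorphic_on \<D>" and inj: "inj_on k \<D>"
    using h k by (auto simp: univalent_on_def)
  have u: "u z \<in> \<D>" "k (u z) = h z" if "z \<in> \<D>" for z
  proof -
    have "h z \<in> k ` \<D>" using im that by blast
    then show "u z \<in> \<D>" "k (u z) = h z"
      unfolding u_def o_def by (rule inv_into_into, rule f_inv_into_f)
  qed
  have "inv_into \<D> k holomorphic_on h ` \<D>"
    using holomorphic_inv_into[OF k open_ball] im by (rule holomorphic_on_subset)
  then have holu: "u holomorphic_on \<D>"
    unfolding u_def using hol(1) by (intro holomorphic_on_compose)
  have u0: "u 0 = 0" using inj by (simp add: u_def eq)
  have "cmod (deriv u 0) \<le> 1"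
    by (rule Schwarz_Lemma(2)[OF holu u0 _, of 0]) (use u in auto)
  moreover have "deriv h 0 = deriv k 0 * deriv u 0"
  proof -
    have "((\<lambda>z. k (u z)) has_field_derivative deriv k 0 * deriv u 0) (at 0)"
      using holomorphic_derivI[OF hol(2) open_ball, of 0] holomorphic_derivI[OF holu open_ball, of 0]
      by (intro DERIV_chain2) (simp_all add: u0)
    then have "(h has_field_derivative deriv k 0 * deriv u 0) (at 0)"
      by (rule has_field_derivative_transform_within_open[OF _ open_ball, of _ _ _ 0 1]) (use u in auto)
    then show ?thesis by (rule DERIV_imp_deriv)
  qed
  ultimately show ?thesis
    using mult_left_mono[of "cmod (deriv u 0)" 1 "cmod (deriv k 0)"] by (simp add: norm_mult)
qed

text \<open>A chart centred at \<open>a\<close> provides a Riemann map, with derivative \<open>2 \<i> Im a * deriv f a\<close> at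
  \<open>0\<close>; subordination in both directions makes the value unique.\<close>

lemma conformal_radius_half_plane:
  assumes f: "univalent_on \<H> f" and a: "0 < Im a"
  shows "conformal_radius (f ` \<H>) (f a) = 2 * Im a * cmod (deriv f a)"
proof -
  define k where "k = f \<circ> half_plane_chart a"
  have hol: "f holomorphic_on \<H>" and inj: "inj_on f \<H>" using f by (auto simp: univalent_on_def)
  have im: "half_plane_chart a ` \<D> = \<H>"
  proof
    show "half_plane_chart a ` \<D> \<subseteq> \<H>" using half_plane_chart_in_half_plane[OF a] by auto
    show "\<H> \<subseteq> half_plane_chart a ` \<D>"
    proof
      fix w assume "w \<in> \<H>"
      then have w: "0 < Im w" by simp
      show "w \<in> half_plane_chart a ` \<D>"
        by (rule image_eqI[where x = "disk_chart a w"])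
           (rule half_plane_chart_disk_chart[OF a w, symmetric], rule disk_chart_in_disk[OF a w])
    qed
  qed
  have "inj_on (half_plane_chart a) \<D>"
    by (rule inj_on_inverseI[of _ "disk_chart a"]) (rule disk_chart_half_plane_chart[OF a])
  then have k: "univalent_on \<D> k"
    unfolding univalent_on_def k_def
    by (intro conjI holomorphic_on_compose holomorphic_half_plane_chart comp_inj_on) (simp_all add: im hol inj)
  have kim: "k ` \<D> = f ` \<H>" using im by (metis k_def image_comp)
  have c0: "half_plane_chart a 0 = a" by (simp add: half_plane_chart_def cayley_def complex_eq_iff)
  then have k0: "k 0 = f a" by (simp add: k_def)
  have d1: "(half_plane_chart a has_field_derivative 2 * \<i> * of_real (Im a)) (at 0)"
    unfolding half_plane_chart_def[abs_def] cayley_def[abs_def]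
    by (auto intro!: derivative_eq_intros)
  have d2: "(f has_field_derivative deriv f a) (at (half_plane_chart a 0))"
    unfolding c0 using holomorphic_derivI[OF hol open_upper_half_plane] a by simp
  have "(k has_field_derivative deriv f a * (2 * \<i> * of_real (Im a))) (at 0)"
    unfolding k_def o_def by (rule DERIV_chain2[OF d2 d1])
  then have kd: "cmod (deriv k 0) = 2 * Im a * cmod (deriv f a)"
    using a by (simp add: DERIV_imp_deriv norm_mult)
  show ?thesis
    unfolding conformal_radius_def
  proof (rule the_equality)
    show "\<exists>h. univalent_on \<D> h \<and> h ` \<D> = f ` \<H> \<and> h 0 = f a \<and> 2 * Im a * cmod (deriv f a) = cmod (deriv h 0)"
      using k kim k0 kd by (intro exI[of _ k]) simp
  next
    fix r assume "\<exists>h. univalent_on \<D> h \<and> h ` \<D> = f ` \<H> \<and> h 0 = f a \<and> r = cmod (deriv h 0)"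
    then obtain h where h: "univalent_on \<D> h" "h ` \<D> = k ` \<D>" "h 0 = k 0" "r = cmod (deriv h 0)"
      using kim k0 by auto
    then show "r = 2 * Im a * cmod (deriv f a)"
      using deriv_at_centre_le[OF h(1) k] deriv_at_centre_le[OF k h(1)] kd by simp
  qed
qed

text \<open>Evaluation at convergent points is harmless because convergence is uniform near \<open>x\<close>;
  for the derivatives, Cauchy's estimate transfers the uniform bound.\<close>

lemma uniform_limit_moving_point:
  assumes S: "open S" "x \<in> S" and hol: "\<And>n. f n holomorphic_on S" and holP: "P holomorphic_on S"
    and ul: "\<And>K. compact K \<Longrightarrow> K \<subseteq> S \<Longrightarrow> uniform_limit K f P sequentially"
    and X: "X \<longlonglongrightarrow> x"
  shows "(\<lambda>n. f n (X n)) \<longlonglongrightarrow> P x" "(\<lambda>n. deriv (f n) (X n)) \<longlonglongrightarrow> deriv P x"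
proof -
  obtain e where e: "0 < e" "cball x e \<subseteq> S" using S open_contains_cball by blast
  define \<rho> where "\<rho> = e / 2"
  have \<rho>: "0 < \<rho>" using e by (simp add: \<rho>_def)
  have ev: "\<forall>\<^sub>F n in sequentially. dist (X n) x < \<rho>" using X \<rho> by (rule tendstoD)
  have unif: "uniform_limit (cball x e) f P sequentially" using e by (intro ul) auto
  have close: "\<forall>\<^sub>F n in sequentially. cmod (f n (X n) - P (X n)) \<le> \<epsilon> \<and> cmod (deriv (f n) (X n) - deriv P (X n)) \<le> \<epsilon> / \<rho>"
    if \<epsilon>: "0 < \<epsilon>" for \<epsilon>
    using ev uniform_limitD[OF unif \<epsilon>]
  proof eventually_elim
    case (elim n)
    have sub: "cball (X n) \<rho> \<subseteq> cball x e"
    proof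
      fix z assume "z \<in> cball (X n) \<rho>"
      then show "z \<in> cball x e" using elim(1) dist_triangle[of x z "X n"] by (simp add: \<rho>_def dist_commute)
    qed
    define h where "h z = f n z - P z" for z
    have holh: "h holomorphic_on S" unfolding h_def[abs_def] by (intro holomorphic_intros hol holP)
    have hle: "cmod (h z) \<le> \<epsilon>" if "z \<in> cball x e" for z
      using elim(2) that by (auto simp: h_def dist_norm intro: less_imp_le)
    have XS: "X n \<in> S" "X n \<in> cball x e"
      using e(2) subsetD[OF sub, of "X n"] \<rho> by (auto simp del: mem_cball)
    have "cmod ((deriv ^^ 1) h (X n)) \<le> fact 1 * \<epsilon> / \<rho> ^ 1"
    proof (rule Cauchy_inequality)
      show "h holomorphic_on ball (X n) \<rho>"
        using holh sub e(2) by (meson ball_subset_cball holomorphic_on_subset order_trans)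
      show "continuous_on (cball (X n) \<rho>) h"
        using holh sub e(2) by (meson holomorphic_on_imp_continuous_on holomorphic_on_subset order_trans)
      show "cmod (h z) \<le> \<epsilon>" if "cmod (X n - z) = \<rho>" for z
        using that sub by (intro hle) (auto simp: dist_norm)
    qed (rule \<rho>)
    moreover have "deriv h (X n) = deriv (f n) (X n) - deriv P (X n)"
      unfolding h_def[abs_def]
      by (intro deriv_diff holomorphic_on_imp_differentiable_at[OF hol S(1) XS(1)]
          holomorphic_on_imp_differentiable_at[OF holP S(1) XS(1)])
    ultimately show ?case using hle[OF XS(2)] by (simp add: h_def)
  qed
  have PX: "(\<lambda>n. P (X n)) \<longlonglongrightarrow> P x" "(\<lambda>n. deriv P (X n)) \<longlonglongrightarrow> deriv P x"
  proof -
    have "isCont P x" "isCont (deriv P) x"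
      using S holP holomorphic_deriv[OF holP S(1)]
      by (auto simp: continuous_on_eq_continuous_at dest!: holomorphic_on_imp_continuous_on)
    then show "(\<lambda>n. P (X n)) \<longlonglongrightarrow> P x" "(\<lambda>n. deriv P (X n)) \<longlonglongrightarrow> deriv P x"
      using X by (auto intro: isCont_tendsto_compose)
  qed
  have "(\<lambda>n. f n (X n) - P (X n)) \<longlonglongrightarrow> 0"
  proof (rule tendstoI)
    fix \<epsilon> :: real assume "0 < \<epsilon>"
    then show "\<forall>\<^sub>F n in sequentially. dist (f n (X n) - P (X n)) 0 < \<epsilon>"
      using close[of "\<epsilon> / 2"] by (auto elim!: eventually_mono simp: dist_norm)
  qed
  from tendsto_add[OF this PX(1)] show "(\<lambda>n. f n (X n)) \<longlonglongrightarrow> P x" by simp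
  have "(\<lambda>n. deriv (f n) (X n) - deriv P (X n)) \<longlonglongrightarrow> 0"
  proof (rule tendstoI)
    fix \<epsilon> :: real assume "0 < \<epsilon>"
    then show "\<forall>\<^sub>F n in sequentially. dist (deriv (f n) (X n) - deriv P (X n)) 0 < \<epsilon>"
      using close[of "\<rho> * \<epsilon> / 2"] \<rho> by (auto elim!: eventually_mono simp: dist_norm)
  qed
  from tendsto_add[OF this PX(2)] show "(\<lambda>n. deriv (f n) (X n)) \<longlonglongrightarrow> deriv P x" by simp
qed

lemma disk_chart_eq: "0 < Im a \<Longrightarrow> 0 < Im w \<Longrightarrow> disk_chart a w = 1 - 2 * \<i> * of_real (Im a) / (w - cnj a)"
  using diff_cnj_nonzero[of w a] complex_diff_cnj[of a]
  by (simp add: disk_chart_def diff_divide_eq_iff eq_diff_eq divide_diff_eq_iff) (simp add: field_simps)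

text \<open>Letting \<open>z = \<i> y\<close> tend to infinity in the equation between the charts gives \<open>\<alpha> = 1\<close>, so \<open>G\<close> fixes
  \<open>\<infinity>\<close> and is affine; \<open>G z - z \<longlongrightarrow> 0\<close> along the imaginary axis then leaves only the identity.\<close>

lemma hyperbolic_isometry_rigid:
  assumes G: "\<And>z. 0 < Im z \<Longrightarrow> 0 < Im (G z)" and L: "\<And>z. 0 < Im z \<Longrightarrow> cmod (G z - z) \<le> L / Im z"
    and a: "0 < Im a" and \<alpha>: "\<And>z. 0 < Im z \<Longrightarrow> disk_chart (G a) (G z) = \<alpha> * disk_chart a z"
    and z: "0 < Im z"
  shows "G z = z"
proof -
  define b where "b = G a"
  have b: "0 < Im b" using G[OF a] by (simp add: b_def)
  let ?iy = "\<lambda>y::real. \<i> * of_real y"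
  have pos: "\<forall>\<^sub>F y in at_top. (0::real) < y" by (rule eventually_gt_at_top)
  have near: "((\<lambda>y. G (?iy y) - ?iy y) \<longlongrightarrow> 0) at_top"
  proof (rule Lim_null_comparison)
    show "((\<lambda>y::real. L / y) \<longlongrightarrow> 0) at_top"
      by (intro tendsto_divide_0[OF tendsto_const] filterlim_at_top_imp_at_infinity filterlim_ident)
    show "\<forall>\<^sub>F y in at_top. cmod (G (?iy y) - ?iy y) \<le> L / y"
      using pos
    proof eventually_elim
      case (elim y)
      then show ?case using L[of "?iy y"] by simp
    qed
  qed
  have inv: "((\<lambda>y. inverse (?iy y)) \<longlongrightarrow> 0) at_top"
  proof -
    have "filterlim ?iy at_infinity at_top"
      using filterlim_imaginary_axis unfolding nontangential_def by (simp add: filterlim_inf)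
    from filterlim_compose[OF tendsto_inverse_0 this] show ?thesis .
  qed
  have chart1: "((\<lambda>y. disk_chart c (g y)) \<longlongrightarrow> 1) at_top"
    if "((\<lambda>y. g y - ?iy y) \<longlongrightarrow> 0) at_top" for c g
  proof -
    have "((\<lambda>y. (1 + ((g y - ?iy y) - c) * inverse (?iy y)) / (1 + ((g y - ?iy y) - cnj c) * inverse (?iy y)))
        \<longlongrightarrow> (1 + (0 - c) * 0) / (1 + (0 - cnj c) * 0)) at_top"
      by (intro tendsto_intros that inv) auto
    then have "((\<lambda>y. (1 + ((g y - ?iy y) - c) * inverse (?iy y)) / (1 + ((g y - ?iy y) - cnj c) * inverse (?iy y)))
        \<longlongrightarrow> 1) at_top" by simp
    then show ?thesis
    proof (rule Lim_transform_eventually)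
      show "\<forall>\<^sub>F y in at_top. (1 + ((g y - ?iy y) - c) * inverse (?iy y)) / (1 + ((g y - ?iy y) - cnj c) * inverse (?iy y)) = disk_chart c (g y)"
        using pos
      proof eventually_elim
        case (elim y)
        then have nz: "?iy y \<noteq> 0" by simp
        then have "1 + ((g y - ?iy y) - d) * inverse (?iy y) = (g y - d) / ?iy y" for d
          by (simp add: field_simps)
        then show ?case using nz by (simp add: disk_chart_def)
      qed
    qed
  qed
  have "((\<lambda>y. disk_chart b (G (?iy y))) \<longlongrightarrow> \<alpha> * 1) at_top"
  proof (rule Lim_transform_eventually)
    show "((\<lambda>y. \<alpha> * disk_chart a (?iy y)) \<longlongrightarrow> \<alpha> * 1) at_top"
      by (intro tendsto_intros chart1) simp
    show "\<forall>\<^sub>F y in at_top. \<alpha> * disk_chart a (?iy y) = disk_chart b (G (?iy y))"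
      using pos by eventually_elim (use \<alpha> in \<open>simp add: b_def\<close>)
  qed
  then have "\<alpha> = 1" using chart1[OF near, of b] tendsto_unique[OF trivial_limit_at_top_linorder] by fastforce
  define k where "k = complex_of_real (Im b / Im a)"
  have aff: "G w - w = (k - 1) * w + (cnj b - k * cnj a)" if w: "0 < Im w" for w
  proof -
    have nz: "w - cnj a \<noteq> 0" "G w - cnj b \<noteq> 0" using diff_cnj_nonzero w a b G by blast+
    have "disk_chart b (G w) = disk_chart a w" using \<alpha>[OF w] \<open>\<alpha> = 1\<close> by (simp add: b_def)
    then have "2 * \<i> * of_real (Im b) / (G w - cnj b) = 2 * \<i> * of_real (Im a) / (w - cnj a)"
      using disk_chart_eq[OF b G[OF w]] disk_chart_eq[OF a w] by simp
    then have "of_real (Im b) * (w - cnj a) = of_real (Im a) * (G w - cnj b)"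
      using nz by (simp add: frac_eq_eq)
    then have "G w - cnj b = k * (w - cnj a)"
      using a by (simp add: k_def field_simps)
    then show ?thesis by (simp add: algebra_simps)
  qed
  have lim: "((\<lambda>y. (k - 1) * ?iy y + (cnj b - k * cnj a)) \<longlongrightarrow> 0) at_top"
    by (rule Lim_transform_eventually[OF near])
      (use pos in eventually_elim, use aff in simp)
  then have "((\<lambda>y. ((k - 1) * ?iy y + (cnj b - k * cnj a)) * inverse (?iy y)) \<longlongrightarrow> 0 * 0) at_top"
    by (intro tendsto_mult inv)
  moreover have "((\<lambda>y. ((k - 1) * ?iy y + (cnj b - k * cnj a)) * inverse (?iy y)) \<longlongrightarrow> (k - 1) + (cnj b - k * cnj a) * 0) at_top"
  proof (rule Lim_transform_eventually)
    show "((\<lambda>y. (k - 1) + (cnj b - k * cnj a) * inverse (?iy y)) \<longlongrightarrow> (k - 1) + (cnj b - k * cnj a) * 0) at_top"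
      by (intro tendsto_intros inv)
    show "\<forall>\<^sub>F y in at_top. (k - 1) + (cnj b - k * cnj a) * inverse (?iy y) = ((k - 1) * ?iy y + (cnj b - k * cnj a)) * inverse (?iy y)"
      using pos
    proof eventually_elim
      case (elim y)
      then have "?iy y \<noteq> 0" by simp
      then have "?iy y * inverse (?iy y) = 1" by (rule right_inverse)
      then show ?case by (metis distrib_right mult.assoc mult.right_neutral)
    qed
  qed
  ultimately have k1: "k = 1" using tendsto_unique[OF trivial_limit_at_top_linorder] by fastforce
  then have "((\<lambda>y::real. cnj b - k * cnj a) \<longlongrightarrow> 0) at_top" using lim by simp
  then have "cnj b - k * cnj a = 0" using tendsto_unique[OF trivial_limit_at_top_linorder] tendsto_const by blast
  then show ?thesis using aff[OF z] k1 by simp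
qed

text \<open>Along a subsequence, \<open>G n - id\<close> converges locally uniformly by Montel's theorem and the points
  \<open>X n\<close> converge. The limit map attains equality in the Schwarz--Pick inequality for derivatives at the limit point, so it is an
  isometry, and the uniform bound \<open>L / Im z\<close> survives. Without this bound the conclusion fails, as
  translations and dilations show.\<close>

lemma near_isometries_tend_to_identity:
  fixes G :: "nat \<Rightarrow> complex \<Rightarrow> complex"
  assumes G: "\<And>n. hydrodynamic (G n) (m n)" and m: "\<And>n. m n \<le> L"
    and K: "compact K" "K \<subseteq> \<H>" "\<And>n. X n \<in> K" "\<And>n. Y n \<in> K"
    and iso: "(\<lambda>n. cmod (deriv (G n) (X n)) * Im (X n) / Im (G n (X n))) \<longlonglongrightarrow> 1"
  obtains r :: "nat \<Rightarrow> nat" where "strict_mono r" "(\<lambda>n. G (r n) (Y (r n)) - Y (r n)) \<longlonglongrightarrow> 0"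
proof -
  note hG = hydrodynamicD[OF G]
  have GL: "cmod (G n z - z) \<le> L / Im z" if "0 < Im z" for n z
    using hG(4)[OF that, of n] m[of n] that by (meson divide_right_mono less_imp_le order_trans)
  have "seq_compact (K \<times> K)" using K(1) by (intro compact_imp_seq_compact compact_Times)
  then obtain xy r1 where xy: "xy \<in> K \<times> K" and r1: "strict_mono r1"
    and lim1: "((\<lambda>n. (X n, Y n)) \<circ> r1) \<longlonglongrightarrow> xy"
    using K(3,4) seq_compactE[of "K \<times> K" "\<lambda>n. (X n, Y n)"] by (metis mem_Times_iff fst_conv snd_conv)
  obtain x y where xyp: "xy = (x, y)" by (cases xy)
  have x: "0 < Im x" and y: "0 < Im y" using xy xyp K(2) by auto
  have X1: "(\<lambda>n. X (r1 n)) \<longlonglongrightarrow> x" "(\<lambda>n. Y (r1 n)) \<longlonglongrightarrow> y"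
    using tendsto_fst[OF lim1] tendsto_snd[OF lim1] by (auto simp: o_def xyp)
  define p where "p n z = G (r1 n) z - z" for n z
  have holp: "p n holomorphic_on \<H>" for n
    unfolding p_def[abs_def] by (intro holomorphic_intros hG(1))
  define \<N> where "\<N> = {h. h holomorphic_on \<H> \<and> (\<forall>z\<in>\<H>. cmod (h z) \<le> L / Im z)}"
  obtain P r2 where P: "P holomorphic_on \<H>" and r2: "strict_mono (r2 :: nat \<Rightarrow> nat)"
    and Plim: "\<And>z. z \<in> \<H> \<Longrightarrow> (\<lambda>n. p (r2 n) z) \<longlonglongrightarrow> P z"
    and Punif: "\<And>K. compact K \<Longrightarrow> K \<subseteq> \<H> \<Longrightarrow> uniform_limit K (p \<circ> r2) P sequentially"
  proof (rule Montel[OF open_upper_half_plane, of \<N> p])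
    show "\<exists>B. \<forall>h\<in>\<N>. \<forall>z\<in>C. cmod (h z) \<le> B" if C: "compact C" "C \<subseteq> \<H>" for C
    proof -
      have "continuous_on C (\<lambda>z. L / Im z)" using C(2) by (intro continuous_intros) auto
      then have "bounded ((\<lambda>z. L / Im z) ` C)" using C(1) compact_continuous_image compact_imp_bounded by blast
      then obtain B where "\<And>z. z \<in> C \<Longrightarrow> norm (L / Im z) \<le> B" unfolding bounded_iff by blast
      then have "\<forall>h\<in>\<N>. \<forall>z\<in>C. cmod (h z) \<le> B"
        using C(2) unfolding \<N>_def by (smt (verit) mem_Collect_eq real_norm_def subsetD)
      then show ?thesis ..
    qed
    show "range p \<subseteq> \<N>" using holp GL by (auto simp: \<N>_def p_def)
  qed (auto simp: \<N>_def)
  define Q where "Q z = P z + z" for z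
  have holQ: "Q holomorphic_on \<H>" unfolding Q_def[abs_def] by (intro holomorphic_intros P)
  have PL: "cmod (P z) \<le> L / Im z" if "0 < Im z" for z
  proof (rule tendsto_upperbound[OF tendsto_norm[OF Plim]])
    show "\<forall>\<^sub>F n in sequentially. cmod (p (r2 n) z) \<le> L / Im z"
      using GL[OF that] by (simp add: p_def)
  qed (use that in auto)
  have Pim: "0 \<le> Im (P z)" if "0 < Im z" for z
  proof (rule tendsto_lowerbound[OF tendsto_Im[OF Plim]])
    show "\<forall>\<^sub>F n in sequentially. 0 \<le> Im (p (r2 n) z)"
      using hG(2)[OF that] by (simp add: p_def)
  qed (use that in auto)
  have Q: "0 < Im (Q z)" if "0 < Im z" for z using Pim[OF that] that by (simp add: Q_def)
  have X2: "(\<lambda>n. X (r1 (r2 n))) \<longlonglongrightarrow> x" "(\<lambda>n. Y (r1 (r2 n))) \<longlonglongrightarrow> y"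
    using X1[THEN LIMSEQ_subseq_LIMSEQ, OF r2] by (auto simp: o_def)
  note mv = uniform_limit_moving_point[OF open_upper_half_plane _ _ P Punif]
  have holpr: "(p \<circ> r2) n holomorphic_on \<H>" for n using holp by (simp add: o_def)
  have pX: "(\<lambda>n. p (r2 n) (X (r1 (r2 n)))) \<longlonglongrightarrow> P x" "(\<lambda>n. deriv (p (r2 n)) (X (r1 (r2 n)))) \<longlonglongrightarrow> deriv P x"
    using mv[OF _ holpr _ _ X2(1)] x by (auto simp: o_def)
  have pY: "(\<lambda>n. p (r2 n) (Y (r1 (r2 n)))) \<longlonglongrightarrow> P y"
    using mv(1)[OF _ holpr _ _ X2(2)] y by (auto simp: o_def)
  define R where "R n = r1 (r2 n)" for n
  have R: "strict_mono R" using r1 r2 by (simp add: R_def strict_mono_def)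
  have XH: "0 < Im (X n)" for n using subsetD[OF K(2) K(3)[of n]] by simp
  have dG: "deriv (G (R n)) (X (R n)) = deriv (p (r2 n)) (X (R n)) + 1" for n
  proof -
    have "G (R n) = (\<lambda>z. p (r2 n) z + z)" by (simp add: p_def R_def)
    moreover have "((\<lambda>z. p (r2 n) z + z) has_field_derivative deriv (p (r2 n)) (X (R n)) + 1) (at (X (R n)))"
      using holomorphic_derivI[OF holp open_upper_half_plane, of "X (R n)"] XH
      by (auto intro!: derivative_eq_intros)
    ultimately show ?thesis by (simp add: DERIV_imp_deriv)
  qed
  have dQ: "deriv Q x = deriv P x + 1"
    unfolding Q_def[abs_def]
    by (rule DERIV_imp_deriv) (use holomorphic_derivI[OF P open_upper_half_plane, of x] x in \<open>auto intro!: derivative_eq_intros\<close>)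
  have "(\<lambda>n. cmod (deriv (p (r2 n)) (X (R n)) + 1) * Im (X (R n)) / Im (p (r2 n) (X (R n)) + X (R n)))
      \<longlonglongrightarrow> cmod (deriv P x + 1) * Im x / Im (P x + x)"
    using Q[OF x] pX X2 unfolding R_def Q_def by (intro tendsto_intros) auto
  moreover have "(\<lambda>n. cmod (deriv (p (r2 n)) (X (R n)) + 1) * Im (X (R n)) / Im (p (r2 n) (X (R n)) + X (R n))) \<longlonglongrightarrow> 1"
    using LIMSEQ_subseq_LIMSEQ[OF iso R] by (simp add: o_def dG) (simp add: p_def R_def)
  ultimately have "cmod (deriv Q x) * Im x / Im (Q x) = 1"
    using LIMSEQ_unique unfolding dQ Q_def by blast
  then have "cmod (deriv Q x) * Im x = Im (Q x)" using Q[OF x] by (simp add: field_simps)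
  then obtain \<alpha> where \<alpha>: "\<And>z. 0 < Im z \<Longrightarrow> disk_chart (Q x) (Q z) = \<alpha> * disk_chart x z"
    using schwarz_pick_derivative_equality[OF holQ Q x] by metis
  have "Q y = y"
    by (rule hyperbolic_isometry_rigid[OF Q _ x \<alpha> y, of L]) (use PL in \<open>auto simp: Q_def\<close>)
  then have "P y = 0" by (simp add: Q_def)
  then have "(\<lambda>n. G (R n) (Y (R n)) - Y (R n)) \<longlonglongrightarrow> 0" using pY by (simp add: p_def R_def)
  then show ?thesis using that R by blast
qed

section \<open>Chains of domains with hydrodynamic transition maps\<close>

text \<open>For \<open>\<eta> > 0\<close>, compact convex sets that exhaust the half-plane, chosen so that hydrodynamic maps with bounded
  constant send one into another.\<close>

definition half_plane_box :: "real \<Rightarrow> real \<Rightarrow> complex set" where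
  "half_plane_box \<eta> R = cball 0 R \<inter> {z. \<eta> \<le> Im z}"

lemma compact_half_plane_box: "compact (half_plane_box \<eta> R)"
  unfolding half_plane_box_def by (intro compact_Int_closed compact_cball closed_halfspace_Im_ge)

lemma half_plane_box_subset: "0 < \<eta> \<Longrightarrow> half_plane_box \<eta> R \<subseteq> \<H>"
  by (auto simp: half_plane_box_def)

lemma hydrodynamic_half_plane_box:
  assumes "hydrodynamic G m" "m \<le> L" "z \<in> half_plane_box \<eta> R" "0 < \<eta>"
  shows "G z \<in> half_plane_box \<eta> (R + L / \<eta>)"
proof -
  have z: "cmod z \<le> R" "\<eta> \<le> Im z" using assms(3) by (auto simp: half_plane_box_def)
  note h = hydrodynamicD[OF assms(1)]
  have "cmod (G z - z) \<le> m / Im z" using h(4)[of z] z assms(4) by simp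
  also have "\<dots> \<le> L / \<eta>" using z assms h(6) by (intro frac_le) auto
  finally have "cmod (G z) \<le> R + L / \<eta>" using norm_triangle_ineq2[of "G z" z] z by linarith
  then show ?thesis using h(2)[of z] z assms(4) by (simp add: half_plane_box_def)
qed

text \<open>\<open>F t\<close> is a Riemann map from the half-plane, \<open>E\<close> parametrises the initial domain, and \<open>g t\<close>
  is \<open>(F t)\<inverse> \<circ> E\<close>. Keeping \<open>E\<close> apart from \<open>F 0\<close> avoids having to know that the normalisation
  at time \<open>0\<close> is trivial; accordingly only differences of \<open>l\<close> matter.\<close>

locale hydrodynamic_chain =
  fixes \<Omega> :: "real \<Rightarrow> complex set" and F g :: "real \<Rightarrow> complex \<Rightarrow> complex"
    and E :: "complex \<Rightarrow> complex" and l :: "real \<Rightarrow> real"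
  assumes mono: "0 \<le> s \<Longrightarrow> s \<le> t \<Longrightarrow> \<Omega> s \<subseteq> \<Omega> t"
    and uni: "0 \<le> t \<Longrightarrow> univalent_on \<H> (F t)"
    and img: "0 \<le> t \<Longrightarrow> F t ` \<H> = \<Omega> t"
    and E: "E ` \<H> = \<Omega> 0"
    and g: "0 \<le> t \<Longrightarrow> hydrodynamic (g t) (l t)"
    and Fg: "0 \<le> t \<Longrightarrow> 0 < Im z \<Longrightarrow> F t (g t z) = E z"
begin

definition transition :: "real \<Rightarrow> real \<Rightarrow> complex \<Rightarrow> complex" where
  "transition s t z = inv_into \<H> (F t) (F s z)"

lemma g_pos: "0 \<le> t \<Longrightarrow> 0 < Im z \<Longrightarrow> 0 < Im (g t z)"
  by (rule hydrodynamicD(3)[OF g])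

lemma F_inj: "0 \<le> t \<Longrightarrow> inj_on (F t) \<H>" and F_hol: "0 \<le> t \<Longrightarrow> F t holomorphic_on \<H>"
  using uni by (auto simp: univalent_on_def)

lemma F_eq_iff: "0 \<le> t \<Longrightarrow> 0 < Im z \<Longrightarrow> 0 < Im w \<Longrightarrow> F t z = F t w \<longleftrightarrow> z = w"
  using F_inj[of t] by (auto simp: inj_on_def)

lemma F_transition:
  assumes "0 \<le> s" "s \<le> t" "0 < Im z"
  shows "F t (transition s t z) = F s z" "0 < Im (transition s t z)"
proof -
  have F: "F s z \<in> F t ` \<H>"
    using img[of s] img[of t] mono[of s t] assms by (metis imageI order_trans subsetD upper_half_plane_iff)
  then show "F t (transition s t z) = F s z" "0 < Im (transition s t z)"
    unfolding transition_def using f_inv_into_f[OF F] inv_into_into[OF F] by simp_all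
qed

lemma transition_unique: "0 \<le> s \<Longrightarrow> s \<le> t \<Longrightarrow> 0 < Im z \<Longrightarrow> 0 < Im w \<Longrightarrow> F t w = F s z \<Longrightarrow> transition s t z = w"
  using F_transition[of s t z] F_eq_iff[of t "transition s t z" w] by simp

lemma transition_refl: "0 \<le> s \<Longrightarrow> 0 < Im z \<Longrightarrow> transition s s z = z"
  by (rule transition_unique) auto

lemma transition_trans:
  "0 \<le> s \<Longrightarrow> s \<le> u \<Longrightarrow> u \<le> t \<Longrightarrow> 0 < Im z \<Longrightarrow> transition u t (transition s u z) = transition s t z"
  using F_transition[of s u z] F_transition[of u t "transition s u z"]
  by (intro transition_unique[symmetric]) auto

lemma transition_g: "0 \<le> s \<Longrightarrow> s \<le> t \<Longrightarrow> 0 < Im z \<Longrightarrow> transition s t (g s z) = g t z"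
  using Fg g_pos by (intro transition_unique) auto

lemma transition_holomorphic:
  assumes "0 \<le> s" "s \<le> t"
  shows "transition s t holomorphic_on \<H>"
proof -
  have "inv_into \<H> (F t) holomorphic_on F s ` \<H>"
    using holomorphic_inv_into[OF uni open_upper_half_plane, of t] mono[of s t] img[of s] img[of t] assms
    by (auto intro: holomorphic_on_subset)
  then have "(inv_into \<H> (F t) \<circ> F s) holomorphic_on \<H>"
    using F_hol assms(1) by (intro holomorphic_on_compose)
  then show ?thesis by (simp add: transition_def[abs_def] o_def)
qed

lemma transition_inj: "0 \<le> s \<Longrightarrow> s \<le> t \<Longrightarrow> inj_on (transition s t) \<H>"
proof (rule inj_onI)
  fix x y assume st: "0 \<le> s" "s \<le> t" and xy: "x \<in> \<H>" "y \<in> \<H>" "transition s t x = transition s t y"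
  then have "F s x = F s y" using F_transition(1)[OF st, of x] F_transition(1)[OF st, of y] by simp
  then show "x = y" using F_eq_iff[of s x y] st xy by simp
qed

lemma transition_hydrodynamic:
  "0 \<le> s \<Longrightarrow> s \<le> t \<Longrightarrow> hydrodynamic (transition s t) (l t - l s)"
  using transition_g F_transition transition_holomorphic by (intro hydrodynamic_cancel[OF g g]) auto

lemma l_mono: "0 \<le> s \<Longrightarrow> s \<le> t \<Longrightarrow> l s \<le> l t"
  using hydrodynamicD(6)[OF transition_hydrodynamic] by fastforce

lemma transition_diff: "0 \<le> s \<Longrightarrow> s \<le> t \<Longrightarrow> 0 < Im z \<Longrightarrow> cmod (transition s t z - z) \<le> (l t - l s) / Im z"
  by (rule hydrodynamicD(4)[OF transition_hydrodynamic])

lemma conformal_radius_eq: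
  assumes "0 \<le> t" "0 < Im z"
  shows "conformal_radius (\<Omega> t) (E z) = 2 * Im (g t z) * cmod (deriv (F t) (g t z))"
  using conformal_radius_half_plane[OF uni g_pos] Fg img assms by metis

lemma conformal_radius_pos:
  assumes "0 \<le> t" "0 < Im z"
  shows "0 < conformal_radius (\<Omega> t) (E z)"
proof -
  have "deriv (F t) (g t z) \<noteq> 0"
    by (rule holomorphic_injective_imp_regular[OF F_hol open_upper_half_plane F_inj])
       (use assms g_pos in auto)
  then show ?thesis using conformal_radius_eq[OF assms] g_pos[OF assms] by simp
qed

text \<open>The chain rule for \<open>F s = F t \<circ> transition s t\<close>: the hyperbolic derivative of a transition map
  is a quotient of conformal radii. This is the one place where the geometry of the domains enters.\<close>

lemma conformal_radius_ratio:
  assumes "0 \<le> s" "s \<le> t" "0 < Im z"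
  shows "cmod (deriv (transition s t) (g s z)) * Im (g s z) / Im (transition s t (g s z))
    = conformal_radius (\<Omega> s) (E z) / conformal_radius (\<Omega> t) (E z)"
proof -
  have t: "0 \<le> t" using assms by simp
  have p: "0 < Im (g s z)" "0 < Im (g t z)" using g_pos assms t by auto
  have "((\<lambda>w. F t (transition s t w)) has_field_derivative deriv (F t) (g t z) * deriv (transition s t) (g s z)) (at (g s z))"
  proof (rule DERIV_chain2[where f = "F t" and g = "transition s t"])
    show "(F t has_field_derivative deriv (F t) (g t z)) (at (transition s t (g s z)))"
      unfolding transition_g[OF assms] using holomorphic_derivI[OF F_hol open_upper_half_plane] t p by simp
    show "(transition s t has_field_derivative deriv (transition s t) (g s z)) (at (g s z))"
      using holomorphic_derivI[OF transition_holomorphic open_upper_half_plane] assms p by simp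
  qed
  then have "(F s has_field_derivative deriv (F t) (g t z) * deriv (transition s t) (g s z)) (at (g s z))"
    by (rule has_field_derivative_transform_within_open[OF _ open_upper_half_plane])
       (use p F_transition assms in auto)
  then have d: "deriv (F s) (g s z) = deriv (F t) (g t z) * deriv (transition s t) (g s z)"
    by (rule DERIV_imp_deriv)
  have "deriv (F t) (g t z) \<noteq> 0"
    using conformal_radius_pos[OF t assms(3)] conformal_radius_eq[OF t assms(3)] by auto
  then show ?thesis
    using p conformal_radius_eq[OF assms(1,3)] conformal_radius_eq[OF t assms(3)]
    by (simp add: d norm_mult transition_g[OF assms] field_simps)
qed

context
  fixes w
  assumes w: "w \<in> \<Omega> 0" and cont: "continuous_on {0..} (\<lambda>t. conformal_radius (\<Omega> t) w)"
begin

text \<open>The points \<open>g (s n) a\<close> over the base point \<open>w = E a\<close> stay in a compact set, and there the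
  hyperbolic derivatives of the transition maps tend to \<open>1\<close> by continuity of the conformal radius.\<close>

lemma transition_tendsto_identity:
  assumes s: "\<And>n. 0 \<le> s n" "\<And>n. s n \<le> t n" "\<And>n. t n \<le> T"
    and lim: "s \<longlonglongrightarrow> t0" "t \<longlonglongrightarrow> t0" and Y: "\<And>n. Y n \<in> half_plane_box \<delta> B" "0 < \<delta>"
  obtains r :: "nat \<Rightarrow> nat" where "strict_mono r"
    "(\<lambda>n. transition (s (r n)) (t (r n)) (Y (r n)) - Y (r n)) \<longlonglongrightarrow> 0"
proof -
  have "w \<in> E ` \<H>" using w E by simp
  then obtain a where a: "0 < Im a" "E a = w" by auto
  have t: "0 \<le> t n" "s n \<le> T" for n using s order_trans by blast+
  have t0: "0 \<le> t0" using lim(1) s(1) by (meson LIMSEQ_le_const)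
  define L where "L = l T"
  have L0: "0 \<le> L" unfolding L_def using hydrodynamicD(6)[OF g] t s by (metis order_trans)
  have lL: "l (t n) - l (s n) \<le> L" "l (s n) \<le> L" for n
    using l_mono[of "t n" T] l_mono[of "s n" T] t s hydrodynamicD(6)[OF g[OF s(1)]] unfolding L_def by (smt (verit))+
  define \<eta> where "\<eta> = min (Im a) \<delta>"
  define R where "R = max (cmod a) B"
  have \<eta>: "0 < \<eta>" using a Y by (simp add: \<eta>_def)
  have box: "g (s n) a \<in> half_plane_box \<eta> (R + L / \<eta>)" for n
    by (rule hydrodynamic_half_plane_box[OF g[OF s(1)] lL(2) _ \<eta>])
       (simp add: half_plane_box_def \<eta>_def R_def)
  have boxY: "Y n \<in> half_plane_box \<eta> (R + L / \<eta>)" for n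
  proof -
    have "0 \<le> L / \<eta>" using L0 \<eta> by simp
    then show ?thesis using Y(1)[of n] by (auto simp: half_plane_box_def \<eta>_def R_def)
  qed
  let ?r = "\<lambda>t. conformal_radius (\<Omega> t) w"
  have "(\<lambda>n. ?r (s n)) \<longlonglongrightarrow> ?r t0" "(\<lambda>n. ?r (t n)) \<longlonglongrightarrow> ?r t0"
    by (rule continuous_on_tendsto_compose[OF cont lim(1)]; use t0 s in simp)
       (rule continuous_on_tendsto_compose[OF cont lim(2)]; use t0 t in simp)
  moreover have "0 < ?r t0" using conformal_radius_pos[OF t0 a(1)] a(2) by simp
  ultimately have "(\<lambda>n. ?r (s n) / ?r (t n)) \<longlonglongrightarrow> ?r t0 / ?r t0" by (intro tendsto_divide) auto
  then have iso: "(\<lambda>n. ?r (s n) / ?r (t n)) \<longlonglongrightarrow> 1" using \<open>0 < ?r t0\<close> by simp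
  show ?thesis
  proof (rule near_isometries_tend_to_identity[OF transition_hydrodynamic[OF s(1,2)] lL(1)
        compact_half_plane_box half_plane_box_subset[OF \<eta>] box boxY])
    show "(\<lambda>n. cmod (deriv (transition (s n) (t n)) (g (s n) a)) * Im (g (s n) a) / Im (transition (s n) (t n) (g (s n) a))) \<longlonglongrightarrow> 1"
      using iso conformal_radius_ratio[OF s(1,2) a(1)] a(2) by simp
  qed (rule that)
qed

text \<open>For \<open>s n\<close> increasing to \<open>t0\<close>, \<open>g (s n) z \<longlongrightarrow> g t0 z\<close> along a subsequence. The estimate
  \<open>\<bar>g (s n) z - z\<bar> \<le> m / Im z\<close> passes to the limit, and \<open>l t0\<close> is the least constant for which it holds.\<close>

lemma l_left_continuous:
  assumes t0: "0 < t0" and le: "\<And>t. 0 \<le> t \<Longrightarrow> t < t0 \<Longrightarrow> l t \<le> m"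
  shows "l t0 \<le> m"
proof (rule hydrodynamic_least[OF g])
  fix z assume z: "0 < Im z"
  define s where "s n = t0 * (1 - inverse (real (Suc n)))" for n
  have s: "0 \<le> s n" "s n < t0" for n
    using t0 by (auto simp: s_def field_simps)
  have "s \<longlonglongrightarrow> t0 * (1 - 0)"
    unfolding s_def[abs_def] by (intro tendsto_intros LIMSEQ_inverse_real_of_nat)
  then have lim: "s \<longlonglongrightarrow> t0" by simp
  have s': "s n \<le> t0" for n using s(2)[of n] by simp
  have box: "g (s n) z \<in> half_plane_box (Im z) (cmod z + l t0 / Im z)" for n
    by (rule hydrodynamic_half_plane_box[OF g[OF s(1)] l_mono[OF s(1) s'] _ z]) (simp add: half_plane_box_def)
  obtain r where "(\<lambda>n. transition (s (r n)) t0 (g (s (r n)) z) - g (s (r n)) z) \<longlonglongrightarrow> 0"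
    by (rule transition_tendsto_identity[OF s(1) s' order_refl lim tendsto_const box z])
  then have r: "(\<lambda>n. g t0 z - g (s (r n)) z) \<longlonglongrightarrow> 0"
    using transition_g[OF s(1) s' z] by simp
  have "(\<lambda>n. cmod (g t0 z - g (s (r n)) z) + m / Im z) \<longlonglongrightarrow> cmod 0 + m / Im z"
    by (intro tendsto_intros r)
  moreover have "cmod (g t0 z - z) \<le> cmod (g t0 z - g (s (r n)) z) + m / Im z" for n
  proof -
    have "cmod (g (s (r n)) z - z) \<le> l (s (r n)) / Im z" using hydrodynamicD(4)[OF g z] s by blast
    also have "\<dots> \<le> m / Im z" using le s z by (intro divide_right_mono) auto
    finally show ?thesis using norm_triangle_ineq[of "g t0 z - g (s (r n)) z" "g (s (r n)) z - z"] by simp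
  qed
  ultimately show "cmod (g t0 z - z) \<le> m / Im z"
    by (metis (no_types, lifting) LIMSEQ_le_const add_0 norm_zero)
qed (use t0 in simp)

text \<open>The same semicontinuity for the maps \<open>transition (u n) T\<close> as \<open>u n\<close> decreases to \<open>t0\<close>, for
  a fixed later time \<open>T\<close>: their constants are at most \<open>l T - m\<close>, so this bounds \<open>l T - l t0\<close>.\<close>

lemma l_right_continuous:
  assumes t0: "0 \<le> t0" and le: "\<And>t. t0 < t \<Longrightarrow> m \<le> l t"
  shows "m \<le> l t0"
proof -
  define T where "T = t0 + 1"
  have T: "t0 \<le> T" "0 \<le> T" using t0 by (auto simp: T_def)
  define u where "u n = t0 + inverse (real (Suc n))" for n
  have u: "t0 < u n" "u n \<le> T" "0 \<le> u n" for n
    using t0 inverse_le_1_iff[of "real (Suc n)"] by (auto simp: u_def T_def intro!: add_nonneg_nonneg)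
  have "u \<longlonglongrightarrow> t0 + 0" unfolding u_def[abs_def] by (intro tendsto_intros LIMSEQ_inverse_real_of_nat)
  then have lim: "u \<longlonglongrightarrow> t0" by simp
  have "l T - l t0 \<le> l T - m"
  proof (rule hydrodynamic_least[OF hydrodynamic_cancel[OF g[OF t0] g[OF T(2)] transition_holomorphic[OF t0 T(1)]]])
    fix z assume z: "0 < Im z"
    show "cmod (transition t0 T z - z) \<le> (l T - m) / Im z"
    proof -
      have box: "z \<in> half_plane_box (Im z) (cmod z)" by (simp add: half_plane_box_def)
      have u': "t0 \<le> u n" for n using u(1)[of n] by simp
      obtain r where r: "(\<lambda>n. transition t0 (u (r n)) z - z) \<longlonglongrightarrow> 0"
        by (rule transition_tendsto_identity[OF t0 u' u(2) tendsto_const lim box z])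
      have "(\<lambda>n. cmod (transition t0 (u (r n)) z - z) + (l T - m) / Im z) \<longlonglongrightarrow> cmod 0 + (l T - m) / Im z"
        by (intro tendsto_intros r)
      moreover have "cmod (transition t0 T z - z) \<le> cmod (transition t0 (u (r n)) z - z) + (l T - m) / Im z" for n
      proof -
        define v where "v = transition t0 (u (r n)) z"
        have v: "0 < Im v" "Im z \<le> Im v"
          using F_transition(2)[OF t0 u' z] hydrodynamicD(2)[OF transition_hydrodynamic[OF t0 u'] z] by (auto simp: v_def)
        have "cmod (transition (u (r n)) T v - v) \<le> (l T - l (u (r n))) / Im v"
          by (rule transition_diff[OF u(3,2) v(1)])
        also have "\<dots> \<le> (l T - m) / Im z"
          using v z le[OF u(1)[of "r n"]] l_mono[OF u(3,2), of "r n"] by (intro frac_le) auto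
        also have "transition (u (r n)) T v = transition t0 T z"
          unfolding v_def by (rule transition_trans[OF t0 u' u(2) z])
        finally show ?thesis
          using norm_triangle_ineq[of "transition t0 T z - v" "v - z"] by (simp add: v_def)
      qed
      ultimately show ?thesis
        by (metis (no_types, lifting) LIMSEQ_le_const add_0 norm_zero)
    qed
  qed (use F_transition transition_g t0 T in auto)
  then show ?thesis by simp
qed

lemma continuous_on_l: "continuous_on {0..} l"
  unfolding continuous_on_iff
proof (intro ballI allI impI)
  fix t0 e :: real assume t0: "t0 \<in> {0..}" and e: "0 < e"
  have "\<exists>t2>t0. l t2 < l t0 + e"
  proof (rule ccontr)
    assume "\<not> ?thesis"
    then have "l t0 + e \<le> l t" if "t0 < t" for t using that by (meson not_less)
    then have "l t0 + e \<le> l t0" by (rule l_right_continuous[rotated]) (use t0 in simp_all)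
    then show False using e by simp
  qed
  then obtain t2 where t2: "t0 < t2" "l t2 < l t0 + e" by blast
  have "\<exists>t1. t1 < t0 \<and> (\<forall>t\<in>{0..}. t1 < t \<longrightarrow> t \<le> t0 \<longrightarrow> l t0 - e < l t)"
  proof (cases "t0 = 0")
    case True
    then show ?thesis using e by (intro exI[of _ "-1"]) auto
  next
    case False
    then have pos: "0 < t0" using t0 by simp
    have "\<exists>t1\<ge>0. t1 < t0 \<and> l t0 - e < l t1"
    proof (rule ccontr)
      assume "\<not> ?thesis"
      then have "l t \<le> l t0 - e" if "0 \<le> t" "t < t0" for t using that by (meson not_less)
      then have "l t0 \<le> l t0 - e" by (rule l_left_continuous[OF pos])
      then show False using e by simp
    qed
    then obtain t1 where t1: "0 \<le> t1" "t1 < t0" "l t0 - e < l t1" by blast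
    have "l t0 - e < l t" if "t1 < t" for t
      using l_mono[of t1 t] t1 that by simp
    then show ?thesis using t1 by blast
  qed
  then obtain t1 where t1: "t1 < t0" "\<And>t. 0 \<le> t \<Longrightarrow> t1 < t \<Longrightarrow> t \<le> t0 \<Longrightarrow> l t0 - e < l t" by auto
  show "\<exists>d>0. \<forall>t\<in>{0..}. dist t t0 < d \<longrightarrow> dist (l t) (l t0) < e"
  proof (intro exI[of _ "min (t0 - t1) (t2 - t0)"] conjI ballI impI)
    fix t assume t: "t \<in> {0..}" "dist t t0 < min (t0 - t1) (t2 - t0)"
    then have tt: "0 \<le> t" "t1 < t" "t < t2" by (auto simp: dist_real_def)
    show "dist (l t) (l t0) < e"
    proof (cases "t \<le> t0")
      case True
      then show ?thesis using t1(2)[OF tt(1,2)] l_mono[OF tt(1) True] e by (simp add: dist_real_def)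
    next
      case False
      then show ?thesis using l_mono[of t0 t] l_mono[of t t2] t0 t2 tt e by (simp add: dist_real_def)
    qed
  qed (use t1 t2 in auto)
qed


text \<open>\<open>u\<close> is the inverse of \<open>h t = t + (l t - l 0)\<close>. The summand \<open>t\<close> makes \<open>h\<close> strictly increasing
  and unbounded even when \<open>l\<close> is constant on intervals or bounded, so all times are reached without case distinctions.\<close>

lemma clock_exists:
  obtains u where "\<And>\<sigma>. 0 \<le> \<sigma> \<Longrightarrow> 0 \<le> u \<sigma>" "\<And>\<sigma> \<tau>. 0 \<le> \<sigma> \<Longrightarrow> \<sigma> \<le> \<tau> \<Longrightarrow> u \<sigma> \<le> u \<tau>"
    "u ` {0..} = {0..}" "\<And>\<sigma> \<tau>. 0 \<le> \<sigma> \<Longrightarrow> \<sigma> \<le> \<tau> \<Longrightarrow> l (u \<tau>) - l (u \<sigma>) \<le> \<tau> - \<sigma>"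
proof -
  define h where "h t = t + (l t - l 0)" for t
  have h_less: "h s < h t" if "0 \<le> s" "s < t" for s t
    using l_mono[of s t] that by (simp add: h_def)
  have "\<exists>t\<ge>0. h t = \<sigma>" if "0 \<le> \<sigma>" for \<sigma>
  proof -
    have "\<exists>t\<ge>0. t \<le> \<sigma> \<and> h t = \<sigma>"
    proof (rule IVT')
      show "h 0 \<le> \<sigma>" using that by (simp add: h_def)
      show "\<sigma> \<le> h \<sigma>" using l_mono[of 0 \<sigma>] that by (simp add: h_def)
      show "continuous_on {0..\<sigma>} h" unfolding h_def[abs_def]
        by (intro continuous_intros continuous_on_subset[OF continuous_on_l]) auto
    qed (rule that)
    then show ?thesis by blast
  qed
  then obtain u where u: "\<And>\<sigma>. 0 \<le> \<sigma> \<Longrightarrow> 0 \<le> u \<sigma>" "\<And>\<sigma>. 0 \<le> \<sigma> \<Longrightarrow> h (u \<sigma>) = \<sigma>" by metis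
  have um: "u \<sigma> \<le> u \<tau>" if "0 \<le> \<sigma>" "\<sigma> \<le> \<tau>" for \<sigma> \<tau>
  proof (rule ccontr)
    assume "\<not> u \<sigma> \<le> u \<tau>"
    then have "h (u \<tau>) < h (u \<sigma>)" using h_less[of "u \<tau>" "u \<sigma>"] u(1)[of \<tau>] that by simp
    then show False using u(2) that by simp
  qed
  show ?thesis
  proof (rule that[OF u(1) um])
    show "u ` {0..} = {0..}"
    proof
      show "{0..} \<subseteq> u ` {0..}"
      proof
        fix t :: real assume t: "t \<in> {0..}"
        have ht: "0 \<le> h t" using l_mono[of 0 t] t by (simp add: h_def)
        have "u (h t) = t"
        proof (rule ccontr)
          assume "u (h t) \<noteq> t"
          then have "h (u (h t)) \<noteq> h t" using h_less u(1)[OF ht] t by (metis atLeast_iff less_irrefl linorder_neqE)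
          then show False using u(2)[OF ht] by simp
        qed
        then show "t \<in> u ` {0..}" using ht by (metis atLeast_iff image_eqI)
      qed
    qed (use u in auto)
    show "l (u \<tau>) - l (u \<sigma>) \<le> \<tau> - \<sigma>" if "0 \<le> \<sigma>" "\<sigma> \<le> \<tau>" for \<sigma> \<tau>
      using u(2)[of \<sigma>] u(2)[of \<tau>] um[OF that] that by (simp add: h_def)
  qed
qed

end

end

section \<open>The Loewner chain after the change of time\<close>

lemma compact_subset_half_plane_box:
  assumes "compact C" "C \<subseteq> \<H>"
  obtains \<eta> R where "0 < \<eta>" "C \<subseteq> half_plane_box \<eta> R"
proof (cases "C = {}")
  case True
  then show ?thesis using that[of 1 0] by simp
next
  case False
  have "continuous_on C Im" by (intro continuous_intros)
  then obtain c where c: "c \<in> C" "\<And>z. z \<in> C \<Longrightarrow> Im c \<le> Im z"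
    using continuous_attains_inf[OF assms(1) False] by blast
  obtain R where R: "\<And>z. z \<in> C \<Longrightarrow> cmod z \<le> R"
    using compact_imp_bounded[OF assms(1)] unfolding bounded_iff by blast
  show ?thesis
    by (rule that[of "Im c" R]) (use c R assms(2) in \<open>auto simp: half_plane_box_def\<close>)
qed

lemma convex_half_plane_box: "convex (half_plane_box \<eta> R)"
  unfolding half_plane_box_def by (intro convex_Int convex_cball convex_halfspace_Im_ge)

text \<open>Schwarz--Pick bounds the ratio \<open>\<bar>G v - G w\<bar> / \<bar>v - w\<bar>\<close> by \<open>\<bar>G v - cnj (G w)\<bar> / \<bar>v - cnj w\<bar>\<close>, whose
  numerator differs from its denominator, which is at least \<open>2 \<eta>\<close>, by at most \<open>2 L / \<eta>\<close>.\<close>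

lemma hydrodynamic_lipschitz:
  assumes G: "hydrodynamic G m" and "m \<le> L" and \<eta>: "0 < \<eta>" "\<eta> \<le> Im v" "\<eta> \<le> Im w"
  shows "cmod (G v - G w) \<le> (1 + L / \<eta>\<^sup>2) * cmod (v - w)"
proof -
  note h = hydrodynamicD[OF G]
  have vw: "0 < Im v" "0 < Im w" using \<eta> by auto
  define D where "D = cmod (v - cnj w)"
  have D: "2 * \<eta> \<le> D"
    using abs_Im_le_cmod[of "v - cnj w"] \<eta> by (simp add: D_def)
  have d: "cmod (G v - v) \<le> L / \<eta>" "cmod (G w - w) \<le> L / \<eta>"
  proof -
    have "m / Im v \<le> L / \<eta>" "m / Im w \<le> L / \<eta>" using \<eta> h(6) assms(2) by (auto intro!: frac_le)
    then show "cmod (G v - v) \<le> L / \<eta>" "cmod (G w - w) \<le> L / \<eta>" using h(4) vw by (meson order_trans)+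
  qed
  have "G v - cnj (G w) = (v - cnj w) + ((G v - v) - cnj (G w - w))" by simp
  then have "cmod (G v - cnj (G w)) \<le> D + (cmod (G v - v) + cmod (cnj (G w - w)))"
    unfolding D_def by (metis add_left_mono norm_triangle_ineq norm_triangle_ineq4 order_trans)
  then have "cmod (G v - cnj (G w)) \<le> D + 2 * (L / \<eta>)" using d unfolding complex_mod_cnj by linarith
  also have "2 * (L / \<eta>) = (2 * \<eta>) * (L / \<eta>\<^sup>2)" using \<eta> by (simp add: power2_eq_square)
  also have "\<dots> \<le> D * (L / \<eta>\<^sup>2)"
    using D h(6) assms(2) by (intro mult_right_mono) auto
  finally have "cmod (G v - cnj (G w)) \<le> (1 + L / \<eta>\<^sup>2) * D" by (simp add: algebra_simps)
  then have "cmod (G v - cnj (G w)) * cmod (v - w) \<le> ((1 + L / \<eta>\<^sup>2) * D) * cmod (v - w)"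
    by (rule mult_right_mono) simp
  moreover have "cmod (G v - G w) * D \<le> cmod (G v - cnj (G w)) * cmod (v - w)"
    unfolding D_def by (rule schwarz_pick_half_plane[OF h(1,3) vw(2,1)])
  ultimately have "cmod (G v - G w) * D \<le> ((1 + L / \<eta>\<^sup>2) * cmod (v - w)) * D" by (simp add: mult_ac)
  then show ?thesis using D \<eta> by simp
qed

lemma cayley_inv_lipschitz:
  assumes "0 < Im a" "0 < Im b"
  shows "cmod (cayley_inv a - cayley_inv b) \<le> 2 * cmod (a - b)"
proof -
  have a: "1 \<le> cmod (a + \<i>)" and b: "1 \<le> cmod (b + \<i>)"
    using assms abs_Im_le_cmod[of "a + \<i>"] abs_Im_le_cmod[of "b + \<i>"] by auto
  then have nz: "a + \<i> \<noteq> 0" "b + \<i> \<noteq> 0" by auto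
  have "cayley_inv a - cayley_inv b = 2 * \<i> * (a - b) / ((a + \<i>) * (b + \<i>))"
    using nz by (simp add: cayley_inv_formula assms field_simps)
  then have "cmod (cayley_inv a - cayley_inv b) = 2 * cmod (a - b) / (cmod (a + \<i>) * cmod (b + \<i>))"
    by (simp add: norm_mult norm_divide)
  also have "\<dots> \<le> 2 * cmod (a - b) / 1"
    using a b mult_mono[OF a b] by (intro divide_left_mono) auto
  finally show ?thesis by simp
qed

lemma set_integral_const_interval:
  fixes a b C :: real
  assumes "a \<le> b"
  shows "(LINT \<xi>:{a..b}|lebesgue. C) = C * (b - a)"
  using assms by (simp add: set_lebesgue_integral_def)

lemma L_space_const: "L_space \<infinity> S (\<lambda>\<xi>. C)"
  by (simp add: L_space_def) (auto intro!: exI[of _ "\<bar>C\<bar>"])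

lemma lipschitz_imp_loc_abs_continuous:
  assumes "\<And>s t. 0 \<le> s \<Longrightarrow> s \<le> t \<Longrightarrow> \<bar>f t - f s\<bar> \<le> t - s"
  shows "loc_abs_continuous f"
  unfolding loc_abs_continuous_def abs_continuous_on_def
proof (intro allI impI)
  fix T \<epsilon> :: real assume "0 < T" and \<epsilon>: "0 < \<epsilon>"
  show "\<exists>\<delta>>0. \<forall>(n::nat) a b.
        (\<forall>i<n. a i \<le> b i \<and> {a i..b i} \<subseteq> {0..T}) \<and>
        (\<forall>i<n. \<forall>j<n. i \<noteq> j \<longrightarrow> {a i<..<b i} \<inter> {a j<..<b j} = {}) \<and>
        (\<Sum>i<n. b i - a i) < \<delta> \<longrightarrow> (\<Sum>i<n. \<bar>f (b i) - f (a i)\<bar>) < \<epsilon>"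
  proof (intro exI[of _ \<epsilon>] conjI allI impI \<epsilon>)
    fix n :: nat and a b :: "nat \<Rightarrow> real"
    assume ab: "(\<forall>i<n. a i \<le> b i \<and> {a i..b i} \<subseteq> {0..T}) \<and>
        (\<forall>i<n. \<forall>j<n. i \<noteq> j \<longrightarrow> {a i<..<b i} \<inter> {a j<..<b j} = {}) \<and> (\<Sum>i<n. b i - a i) < \<epsilon>"
    have "(\<Sum>i<n. \<bar>f (b i) - f (a i)\<bar>) \<le> (\<Sum>i<n. b i - a i)"
      using ab by (intro sum_mono assms) auto
    then show "(\<Sum>i<n. \<bar>f (b i) - f (a i)\<bar>) < \<epsilon>" using ab by linarith
  qed
qed

lemma loc_abs_continuous_imp_continuous:
  assumes "loc_abs_continuous f"
  shows "continuous_on {0..} f"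
  unfolding continuous_on_iff
proof (intro ballI allI impI)
  fix t0 \<epsilon> :: real assume t0: "t0 \<in> {0..}" and \<epsilon>: "0 < \<epsilon>"
  have "abs_continuous_on {0..t0 + 1} f" using assms t0 by (simp add: loc_abs_continuous_def)
  from this[unfolded abs_continuous_on_def, THEN spec, THEN mp, OF \<epsilon>]
  have "\<exists>\<delta>>0. \<forall>x y. 0 \<le> x \<and> x \<le> y \<and> y \<le> t0 + 1 \<and> y - x < \<delta> \<longrightarrow> \<bar>f y - f x\<bar> < \<epsilon>"
  proof (elim exE conjE, intro exI conjI allI impI)
    fix \<delta> x y
    assume ac: "\<forall>(n::nat) a b.
        (\<forall>i<n. a i \<le> b i \<and> {a i..b i} \<subseteq> {0..t0 + 1}) \<and>
        (\<forall>i<n. \<forall>j<n. i \<noteq> j \<longrightarrow> {a i<..<b i} \<inter> {a j<..<b j} = {}) \<and>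
        (\<Sum>i<n. b i - a i) < \<delta> \<longrightarrow> (\<Sum>i<n. \<bar>f (b i) - f (a i)\<bar>) < \<epsilon>"
      and xy: "0 \<le> x \<and> x \<le> y \<and> y \<le> t0 + 1 \<and> y - x < \<delta>"
    from ac[THEN spec[of _ "1::nat"], THEN spec[of _ "\<lambda>_. x"], THEN spec[of _ "\<lambda>_. y"]] xy
    show "\<bar>f y - f x\<bar> < \<epsilon>" by simp
  qed
  then obtain \<delta> where \<delta>: "0 < \<delta>"
    and one: "\<And>x y. 0 \<le> x \<Longrightarrow> x \<le> y \<Longrightarrow> y \<le> t0 + 1 \<Longrightarrow> y - x < \<delta> \<Longrightarrow> \<bar>f y - f x\<bar> < \<epsilon>" by blast
  show "\<exists>d>0. \<forall>t\<in>{0..}. dist t t0 < d \<longrightarrow> dist (f t) (f t0) < \<epsilon>"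
  proof (intro exI[of _ "min \<delta> 1"] conjI ballI impI)
    fix t assume t: "t \<in> {0..}" "dist t t0 < min \<delta> 1"
    then show "dist (f t) (f t0) < \<epsilon>"
      using one[of t t0] one[of t0 t] t0 by (cases "t \<le> t0") (auto simp: dist_real_def abs_minus_commute)
  qed (use \<delta> in auto)
qed

lemma ell_cayley_conjugate:
  assumes G: "hydrodynamic G m" and \<phi>: "\<And>z. z \<in> \<D> \<Longrightarrow> \<phi> z = cayley_inv (G (cayley z))"
  shows "ell \<phi> = m"
proof -
  have "(cayley \<circ> \<phi> \<circ> cayley_inv) z = G z" if "0 < Im z" for z
    using \<phi>[OF cayley_inv_in_disk[OF that]] cayley_cayley_inv that hydrodynamicD(3)[OF G that] by simp
  then have "ell \<phi> = ell_half_plane G"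
    unfolding ell_def ell_half_plane_def by simp
  then show ?thesis using ell_half_plane_eq[OF G] by simp
qed

context hydrodynamic_chain
begin

context
  fixes u :: "real \<Rightarrow> real"
  assumes u0: "\<And>\<sigma>. 0 \<le> \<sigma> \<Longrightarrow> 0 \<le> u \<sigma>" and um: "\<And>\<sigma> \<tau>. 0 \<le> \<sigma> \<Longrightarrow> \<sigma> \<le> \<tau> \<Longrightarrow> u \<sigma> \<le> u \<tau>"
    and lu: "\<And>\<sigma> \<tau>. 0 \<le> \<sigma> \<Longrightarrow> \<sigma> \<le> \<tau> \<Longrightarrow> l (u \<tau>) - l (u \<sigma>) \<le> \<tau> - \<sigma>"
begin

definition disk_transition :: "real \<Rightarrow> real \<Rightarrow> complex \<Rightarrow> complex" where
  "disk_transition s t z = cayley_inv (transition (u s) (u t) (cayley z))"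

definition disk_chain :: "real \<Rightarrow> complex \<Rightarrow> complex" where
  "disk_chain t z = F (u t) (cayley z)"

lemma transition_frakP0: "0 \<le> s \<Longrightarrow> s \<le> t \<Longrightarrow> transition (u s) (u t) \<in> frakP0"
  by (intro hydrodynamic_frakP0[OF transition_hydrodynamic] transition_inj u0 um)

lemma disk_transition_univalent:
  assumes "0 \<le> s" "s \<le> t"
  shows "univalent_on \<D> (disk_transition s t)" "disk_transition s t ` \<D> \<subseteq> \<D>"
  using univalent_cayley_conjugate[of "transition (u s) (u t)" "disk_transition s t"]
    transition_frakP0[OF assms] by (auto simp: frakP0_def disk_transition_def)

lemma cayley_disk_transition:
  "0 \<le> s \<Longrightarrow> s \<le> t \<Longrightarrow> z \<in> \<D> \<Longrightarrow> cayley (disk_transition s t z) = transition (u s) (u t) (cayley z)"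
  unfolding disk_transition_def by (intro cayley_cayley_inv F_transition(2) u0 um cayley_in_half_plane)

text \<open>The displacement of a transition map is at most the growth of \<open>l \<circ> u\<close> divided by \<open>Im w\<close>, and \<open>l \<circ> u\<close> grows at
  most as fast as time; hence a constant majorant.\<close>

lemma disk_evolution_family: "evolution_family_order \<infinity> disk_transition"
  unfolding evolution_family_order_def
proof (intro conjI allI impI ballI)
  show "disk_transition s t holomorphic_on \<D>" "disk_transition s t ` \<D> \<subseteq> \<D>" if "0 \<le> s \<and> s \<le> t" for s t
    using disk_transition_univalent[of s t] that by (auto simp: univalent_on_def)
  show "disk_transition s s z = z" if "0 \<le> s" "z \<in> \<D>" for s z
    using transition_refl[OF u0 cayley_in_half_plane] cayley_inv_cayley that by (simp add: disk_transition_def)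
  show "disk_transition s t z = disk_transition v t (disk_transition s v z)"
    if "0 \<le> s \<and> s \<le> v \<and> v \<le> t" "z \<in> \<D>" for s v t z
  proof -
    have "transition (u v) (u t) (transition (u s) (u v) (cayley z)) = transition (u s) (u t) (cayley z)"
      using that by (intro transition_trans u0 um cayley_in_half_plane) auto
    then show ?thesis
      using cayley_disk_transition[of s v z] that by (simp add: disk_transition_def[of v t] disk_transition_def[of s t])
  qed
  fix z :: complex and T :: real assume z: "z \<in> \<D>" and T: "0 < T"
  define w where "w = cayley z"
  have w: "0 < Im w" unfolding w_def by (rule cayley_in_half_plane[OF z])
  show "\<exists>k. (\<forall>\<xi>\<in>{0..T}. 0 \<le> k \<xi>) \<and> L_space \<infinity> {0..T} k \<and>
        (\<forall>s v t. 0 \<le> s \<and> s \<le> v \<and> v \<le> t \<and> t \<le> T \<longrightarrow>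
           cmod (disk_transition s v z - disk_transition s t z) \<le> (LINT \<xi>:{v..t}|lebesgue. k \<xi>))"
  proof (intro exI[of _ "\<lambda>_. 2 / Im w"] conjI ballI allI impI L_space_const)
    show "0 \<le> 2 / Im w" using w by simp
    fix s v t assume st: "0 \<le> s \<and> s \<le> v \<and> v \<le> t \<and> t \<le> T"
    then have us: "0 \<le> u s" "u s \<le> u v" "0 \<le> u v" "u v \<le> u t" using u0 um by auto
    define a where "a = transition (u s) (u v) w"
    have a: "0 < Im a" "Im w \<le> Im a"
      using F_transition(2)[OF us(1,2) w] hydrodynamicD(2)[OF transition_hydrodynamic[OF us(1,2)] w] by (auto simp: a_def)
    have b: "transition (u s) (u t) w = transition (u v) (u t) a"
      unfolding a_def by (rule transition_trans[OF us(1,2,4) w, symmetric])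
    have "cmod (transition (u v) (u t) a - a) \<le> (l (u t) - l (u v)) / Im a" by (rule transition_diff[OF us(3,4) a(1)])
    also have "\<dots> \<le> (t - v) / Im w" using lu[of v t] l_mono[OF us(3,4)] st a w by (intro frac_le) auto
    finally have d: "cmod (a - transition (u v) (u t) a) \<le> (t - v) / Im w" by (simp add: norm_minus_commute)
    have "cmod (disk_transition s v z - disk_transition s t z) \<le> 2 * cmod (a - transition (u v) (u t) a)"
      unfolding disk_transition_def w_def[symmetric] b a_def[symmetric]
      by (rule cayley_inv_lipschitz[OF a(1) F_transition(2)[OF us(3,4) a(1)]])
    also have "\<dots> \<le> 2 * ((t - v) / Im w)" using d by (rule mult_left_mono) simp
    also have "\<dots> = (LINT \<xi>:{v..t}|lebesgue. 2 / Im w)"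
      using st by (simp add: set_integral_const_interval)
    finally show "cmod (disk_transition s v z - disk_transition s t z) \<le> (LINT \<xi>:{v..t}|lebesgue. 2 / Im w)" .
  qed
qed

lemma disk_Goryainov_Ba: "Goryainov_Ba disk_transition"
  unfolding Goryainov_Ba_def
proof (intro conjI allI impI)
  show "evolution_family disk_transition"
    unfolding evolution_family_def using disk_evolution_family by (intro exI[of _ \<infinity>]) auto
  show "disk_transition s t \<in> calP0" if "0 \<le> s \<and> s \<le> t" for s t
    unfolding calP0_def using transition_frakP0[of s t] that by (auto simp: disk_transition_def)
  have "ell (disk_transition 0 t) = l (u t) - l (u 0)" if "0 \<le> t" for t
    using that by (intro ell_cayley_conjugate[OF transition_hydrodynamic] u0 um) (auto simp: disk_transition_def)
  then show "loc_abs_continuous (\<lambda>t. ell (disk_transition 0 t))"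
    using lu l_mono um u0 by (intro lipschitz_imp_loc_abs_continuous) (simp add: abs_of_nonneg)
qed

lemma disk_associated: "associated_with disk_chain disk_transition"
  unfolding associated_with_def disk_chain_def
  by (auto simp del: mem_ball simp: cayley_disk_transition intro!: F_transition(1) u0 um cayley_in_half_plane)

lemma disk_chain_image: "0 \<le> t \<Longrightarrow> disk_chain t ` \<D> = \<Omega> (u t)"
  using img[OF u0, of t] cayley_image unfolding disk_chain_def by (simp add: image_image[symmetric] del: image_image)

text \<open>Up to time \<open>T\<close> all maps factor through \<open>F (u T)\<close>, and the transition maps to time \<open>T\<close> keep a
  compact set in one compact convex box. There \<open>F (u T)\<close> is Lipschitz, which reduces the estimate to the transition maps.\<close>

lemma disk_Loewner_chain: "Loewner_chain_order \<infinity> disk_chain"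
  unfolding Loewner_chain_order_def
proof (intro conjI allI impI)
  show "univalent_on \<D> (disk_chain t)" if "0 \<le> t" for t
  proof -
    have "(F (u t) \<circ> cayley) holomorphic_on \<D>"
      by (intro holomorphic_on_compose holomorphic_cayley) (simp add: cayley_image F_hol u0 that)
    moreover have "inj_on (F (u t) \<circ> cayley) \<D>"
      by (intro comp_inj_on inj_on_cayley) (simp add: cayley_image F_inj u0 that)
    ultimately show ?thesis by (simp add: univalent_on_def disk_chain_def[abs_def] o_def)
  qed
  show "disk_chain s ` \<D> \<subseteq> disk_chain t ` \<D>" if "0 \<le> s \<and> s \<le> t" for s t
    using that mono[of "u s" "u t"] u0 um disk_chain_image by simp
  fix K :: "complex set" and T :: real assume KT: "compact K \<and> K \<subseteq> \<D> \<and> 0 < T"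
  then have T: "0 \<le> T" by simp
  have "compact (cayley ` K)"
    using KT holomorphic_on_imp_continuous_on[OF holomorphic_cayley]
    by (intro compact_continuous_image) (auto intro: continuous_on_subset)
  moreover have "cayley ` K \<subseteq> \<H>" using KT cayley_in_half_plane by auto
  ultimately obtain \<eta> R where \<eta>: "0 < \<eta>" and box: "cayley ` K \<subseteq> half_plane_box \<eta> R"
    using compact_subset_half_plane_box by metis
  define B where "B = half_plane_box \<eta> (R + T / \<eta>)"
  have BH: "B \<subseteq> \<H>" unfolding B_def by (rule half_plane_box_subset[OF \<eta>])
  have cB: "compact B" "convex B" unfolding B_def by (rule compact_half_plane_box, rule convex_half_plane_box)
  have "continuous_on B (deriv (F (u T)))"
    by (rule continuous_on_subset[OF holomorphic_on_imp_continuous_on[OF holomorphic_deriv[OF F_hol[OF u0[OF T]] open_upper_half_plane]] BH])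
  then have "bounded (deriv (F (u T)) ` B)" using cB compact_continuous_image compact_imp_bounded by blast
  then obtain M where M: "0 < M" "\<And>z. z \<in> B \<Longrightarrow> cmod (deriv (F (u T)) z) \<le> M"
    unfolding bounded_pos by blast
  define C where "C = M * ((1 + T / \<eta>\<^sup>2) / \<eta>)"
  have C0: "0 \<le> C" using M \<eta> T by (simp add: C_def)
  show "\<exists>k. (\<forall>\<xi>\<in>{0..T}. 0 \<le> k \<xi>) \<and> L_space \<infinity> {0..T} k \<and>
           (\<forall>z\<in>K. \<forall>s t. 0 \<le> s \<and> s \<le> t \<and> t \<le> T \<longrightarrow>
              cmod (disk_chain s z - disk_chain t z) \<le> (LINT \<xi>:{s..t}|lebesgue. k \<xi>))"
  proof (intro exI[of _ "\<lambda>_. C"] conjI ballI allI impI L_space_const C0)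
    fix z s t assume z: "z \<in> K" and "0 \<le> s \<and> s \<le> t \<and> t \<le> T"
    then have st: "0 \<le> s" "s \<le> t" "0 \<le> t" "t \<le> T" "s \<le> T" by auto
    have us: "0 \<le> u s" "u s \<le> u t" "0 \<le> u t" "u t \<le> u T" "u s \<le> u T" using st u0 um by auto
    define w where "w = cayley z"
    have wb: "w \<in> half_plane_box \<eta> R" using box z by (auto simp: w_def)
    then have w: "0 < Im w" "\<eta> \<le> Im w" using \<eta> by (auto simp: half_plane_box_def)
    define v where "v = transition (u s) (u t) w"
    have v: "0 < Im v" "\<eta> \<le> Im v"
      using F_transition(2)[OF us(1,2) w(1)] hydrodynamicD(2)[OF transition_hydrodynamic[OF us(1,2)] w(1)] w by (auto simp: v_def)
    have lT: "l (u T) - l (u t) \<le> T" "l (u T) - l (u s) \<le> T" using lu st by fastforce+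
    have a: "transition (u t) (u T) w \<in> B"
      unfolding B_def by (rule hydrodynamic_half_plane_box[OF transition_hydrodynamic[OF us(3,4)] lT(1) wb \<eta>])
    have "transition (u s) (u T) w \<in> B"
      unfolding B_def by (rule hydrodynamic_half_plane_box[OF transition_hydrodynamic[OF us(1,5)] lT(2) wb \<eta>])
    moreover have "transition (u s) (u T) w = transition (u t) (u T) v"
      unfolding v_def by (rule transition_trans[OF us(1,2,4) w(1), symmetric])
    ultimately have b: "transition (u t) (u T) v \<in> B" by simp
    have "cmod (v - w) \<le> (l (u t) - l (u s)) / Im w" unfolding v_def by (rule transition_diff[OF us(1,2) w(1)])
    also have "\<dots> \<le> (t - s) / \<eta>" using lu[of s t] l_mono[OF us(1,2)] st w \<eta> by (intro frac_le) auto
    finally have vw: "cmod (v - w) \<le> (t - s) / \<eta>" .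
    have "cmod (transition (u t) (u T) v - transition (u t) (u T) w) \<le> (1 + T / \<eta>\<^sup>2) * cmod (v - w)"
      by (rule hydrodynamic_lipschitz[OF transition_hydrodynamic[OF us(3,4)] lT(1) \<eta> v(2) w(2)])
    also have "\<dots> \<le> (1 + T / \<eta>\<^sup>2) * ((t - s) / \<eta>)" using vw T \<eta> by (intro mult_left_mono) auto
    finally have ab: "cmod (transition (u t) (u T) v - transition (u t) (u T) w) \<le> (1 + T / \<eta>\<^sup>2) * ((t - s) / \<eta>)" .
    have "cmod (F (u T) (transition (u t) (u T) v) - F (u T) (transition (u t) (u T) w))
        \<le> M * cmod (transition (u t) (u T) v - transition (u t) (u T) w)"
    proof (rule field_differentiable_bound[OF cB(2)])
      fix y assume y: "y \<in> B"
      then show "(F (u T) has_field_derivative deriv (F (u T)) y) (at y within B)"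
        using BH holomorphic_derivI[OF F_hol[OF u0[OF T]] open_upper_half_plane, of y] by auto
      show "cmod (deriv (F (u T)) y) \<le> M" by (rule M(2)[OF y])
    qed (rule b, rule a)
    also have "\<dots> \<le> M * ((1 + T / \<eta>\<^sup>2) * ((t - s) / \<eta>))" using ab M by (intro mult_left_mono) auto
    also have "\<dots> = C * (t - s)"
      unfolding C_def by (simp only: times_divide_eq_left times_divide_eq_right mult.assoc)
    also have "\<dots> = (LINT \<xi>:{s..t}|lebesgue. C)"
      using st by (simp add: set_integral_const_interval)
    finally show "cmod (disk_chain s z - disk_chain t z) \<le> (LINT \<xi>:{s..t}|lebesgue. C)"
      unfolding disk_chain_def w_def[symmetric] F_transition(1)[OF us(3,4) v(1)] F_transition(1)[OF us(3,4) w(1)]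
      unfolding v_def F_transition(1)[OF us(1,2) w(1)] .
  qed
qed

end

theorem exists_disk_chain:
  assumes w: "w \<in> \<Omega> 0" and cont: "continuous_on {0..} (\<lambda>t. conformal_radius (\<Omega> t) w)"
  shows "\<exists>\<phi> f. Goryainov_Ba \<phi> \<and> Loewner_chain f \<and> associated_with f \<phi> \<and>
                {f t ` \<D> | t. t \<ge> 0} = {\<Omega> t | t. t \<ge> 0}"
proof -
  obtain u where u: "\<And>\<sigma>. 0 \<le> \<sigma> \<Longrightarrow> 0 \<le> u \<sigma>" "\<And>\<sigma> \<tau>. 0 \<le> \<sigma> \<Longrightarrow> \<sigma> \<le> \<tau> \<Longrightarrow> u \<sigma> \<le> u \<tau>"
    and surj: "u ` {0..} = {0..}" and lu: "\<And>\<sigma> \<tau>. 0 \<le> \<sigma> \<Longrightarrow> \<sigma> \<le> \<tau> \<Longrightarrow> l (u \<tau>) - l (u \<sigma>) \<le> \<tau> - \<sigma>"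
    using clock_exists[OF w cont] by blast
  show ?thesis
  proof (intro exI conjI)
    show "Goryainov_Ba (disk_transition u)" by (rule disk_Goryainov_Ba[OF u lu])
    show "Loewner_chain (disk_chain u)"
      unfolding Loewner_chain_def using disk_Loewner_chain[OF u lu] by (intro exI[of _ \<infinity>]) auto
    show "associated_with (disk_chain u) (disk_transition u)" by (rule disk_associated[OF u lu])
    have "{disk_chain u t ` \<D> | t. t \<ge> 0} = {\<Omega> (u t) | t. t \<ge> 0}"
      using disk_chain_image[OF u lu] by (metis (no_types, lifting))
    also have "\<dots> = \<Omega> ` (u ` {0..})" by (auto simp: image_iff)
    also have "\<dots> = {\<Omega> t | t. t \<ge> 0}" unfolding surj by auto
    finally show "{disk_chain u t ` \<D> | t. t \<ge> 0} = {\<Omega> t | t. t \<ge> 0}" .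
  qed
qed

end

section \<open>The equivalence\<close>

text \<open>Both families are increasing, so each contains its smallest domain at time \<open>0\<close> and these
  agree. This allows \<open>\<tau> 0 = 0\<close>, after which \<open>(F t)\<inverse> \<circ> F 0\<close> coincides with \<open>\<phi> 0 (\<tau> t)\<close>.\<close>

lemma condition_i_imp_ii:
  assumes mono: "\<And>s t. 0 \<le> s \<Longrightarrow> s \<le> t \<Longrightarrow> \<Omega> s \<subseteq> \<Omega> t"
    and \<phi>: "\<And>s t. 0 \<le> s \<Longrightarrow> s \<le> t \<Longrightarrow> \<phi> s t \<in> calP0"
    and f: "\<And>t. 0 \<le> t \<Longrightarrow> univalent_on \<D> (f t)" "\<And>s t. 0 \<le> s \<Longrightarrow> s \<le> t \<Longrightarrow> f s ` \<D> \<subseteq> f t ` \<D>"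
    and assoc: "associated_with f \<phi>" and eq: "{f t ` \<D> | t. t \<ge> 0} = {\<Omega> t | t. t \<ge> (0::real)}"
  shows "\<exists>F :: real \<Rightarrow> complex \<Rightarrow> complex. \<forall>t\<ge>0.
                univalent_on \<D> (F t) \<and> F t ` \<D> = \<Omega> t \<and> inv_into \<D> (F t) \<circ> F 0 \<in> calC_tilde"
proof -
  have ex: "\<exists>\<tau>\<ge>0. \<Omega> t = f \<tau> ` \<D>" if "0 \<le> t" for t
    using eq that by (smt (verit, best) mem_Collect_eq)
  have "\<exists>b\<ge>0. f 0 ` \<D> = \<Omega> b" using eq by (smt (verit, best) mem_Collect_eq)
  then obtain b where b: "0 \<le> b" "f 0 ` \<D> = \<Omega> b" by blast
  obtain a where a: "0 \<le> a" "\<Omega> 0 = f a ` \<D>" using ex[of 0] by auto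
  have start: "\<Omega> 0 = f 0 ` \<D>" using a b mono[of 0 b] f(2)[of 0 a] by auto
  have "\<forall>t. \<exists>\<tau>. 0 \<le> t \<longrightarrow> 0 \<le> \<tau> \<and> \<Omega> t = f \<tau> ` \<D> \<and> (t = 0 \<longrightarrow> \<tau> = 0)"
    using ex start by (metis order_refl)
  then obtain \<tau> where \<tau>: "\<And>t. 0 \<le> t \<Longrightarrow> 0 \<le> \<tau> t" "\<And>t. 0 \<le> t \<Longrightarrow> \<Omega> t = f (\<tau> t) ` \<D>" "\<tau> 0 = 0"
    by (metis order_refl)
  have "inv_into \<D> (f (\<tau> t)) \<circ> f (\<tau> 0) \<in> calC_tilde" if t: "0 \<le> t" for t
  proof -
    obtain G where G: "G \<in> frakP0" "\<And>z. z \<in> \<D> \<Longrightarrow> \<phi> 0 (\<tau> t) z = cayley_inv (G (cayley z))"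
      using \<phi>[OF order_refl \<tau>(1)[OF t]] unfolding calP0_def by auto
    have D: "\<phi> 0 (\<tau> t) z \<in> \<D>" if "z \<in> \<D>" for z
      using univalent_cayley_conjugate(2)[of G "\<phi> 0 (\<tau> t)"] G that unfolding frakP0_def by blast
    have "(inv_into \<D> (f (\<tau> t)) \<circ> f (\<tau> 0)) z = \<phi> 0 (\<tau> t) z" if z: "z \<in> \<D>" for z
    proof -
      have "f (\<tau> t) (\<phi> 0 (\<tau> t) z) = f 0 z"
        using assoc z \<tau>(1)[OF t] by (simp add: associated_with_def)
      then have "inv_into \<D> (f (\<tau> t)) (f 0 z) = \<phi> 0 (\<tau> t) z"
        using f(1)[OF \<tau>(1)[OF t]] D[OF z] by (metis inv_into_f_f univalent_on_def)
      then show ?thesis by (simp add: \<tau>(3))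
    qed
    then have "inv_into \<D> (f (\<tau> t)) \<circ> f (\<tau> 0) \<in> calP0"
      unfolding calP0_def using G by (intro CollectI bexI[of _ G]) auto
    then show ?thesis using calP0_subset_calC_tilde by blast
  qed
  then show ?thesis using f(1) \<tau> by (intro exI[of _ "\<lambda>t. f (\<tau> t)"]) auto
qed

lemma affine_half_plane:
  assumes "0 < A"
  shows "(\<lambda>w. w / complex_of_real A + complex_of_real b) ` \<H> = \<H>" "inj_on (\<lambda>w. w / complex_of_real A + complex_of_real b) S"
proof -
  show "inj_on (\<lambda>w. w / complex_of_real A + complex_of_real b) S" using assms by (auto simp: inj_on_def)
  show "(\<lambda>w. w / complex_of_real A + complex_of_real b) ` \<H> = \<H>"
  proof
    show "\<H> \<subseteq> (\<lambda>w. w / complex_of_real A + complex_of_real b) ` \<H>"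
    proof
      fix z assume "z \<in> \<H>"
      then show "z \<in> (\<lambda>w. w / complex_of_real A + complex_of_real b) ` \<H>"
        using assms by (intro image_eqI[where x = "of_real A * (z - of_real b)"]) auto
    qed
  qed (use assms in \<open>auto simp: Im_divide_of_real\<close>)
qed

text \<open>The real affine map that normalises \<open>(F t)\<inverse> \<circ> F 0\<close> at \<open>\<infinity>\<close> is an automorphism of the half-plane,
  so its inverse can be absorbed into the Riemann map of \<open>\<Omega> t\<close>.\<close>

lemma condition_ii_imp_chain:
  fixes F :: "real \<Rightarrow> complex \<Rightarrow> complex"
  assumes mono: "\<And>s t. 0 \<le> s \<Longrightarrow> s \<le> t \<Longrightarrow> \<Omega> s \<subseteq> \<Omega> t"
    and F: "\<And>t. 0 \<le> t \<Longrightarrow> univalent_on \<D> (F t)" "\<And>t. 0 \<le> t \<Longrightarrow> F t ` \<D> = \<Omega> t"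
      "\<And>t. 0 \<le> t \<Longrightarrow> inv_into \<D> (F t) \<circ> F 0 \<in> calC_tilde"
  obtains G g E l where "hydrodynamic_chain \<Omega> G g E l"
proof -
  define \<psi> where "\<psi> t = inv_into \<D> (F t) \<circ> F 0" for t
  define normal where "normal t A b m \<longleftrightarrow> 0 < A \<and>
      hydrodynamic (\<lambda>w. of_real A * (cayley (\<psi> t (cayley_inv w)) - of_real b)) m" for t A b m
  have "\<exists>A b m. normal t A b m" if t: "0 \<le> t" for t
  proof -
    have "\<psi> t \<in> calC_tilde" unfolding \<psi>_def by (rule F(3)[OF t])
    then obtain A b m where "0 < A" "hydrodynamic (\<lambda>w. of_real A * (cayley (\<psi> t (cayley_inv w)) - of_real b)) m"
      by (rule calC_tilde_normalisation)
    then show ?thesis unfolding normal_def by blast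
  qed
  then obtain A b l where "\<And>t. 0 \<le> t \<Longrightarrow> normal t (A t) (b t) (l t)" by metis
  then have A: "\<And>t. 0 \<le> t \<Longrightarrow> 0 < A t"
    and hyd: "\<And>t. 0 \<le> t \<Longrightarrow> hydrodynamic (\<lambda>w. of_real (A t) * (cayley (\<psi> t (cayley_inv w)) - of_real (b t))) (l t)"
    unfolding normal_def by blast+
  have \<psi>: "\<psi> t z \<in> \<D>" "F t (\<psi> t z) = F 0 z" if "0 \<le> t" "z \<in> \<D>" for t z
  proof -
    have "F 0 z \<in> F t ` \<D>" using mono[of 0 t] F(2)[of 0] F(2)[of t] that by auto
    then show "\<psi> t z \<in> \<D>" "F t (\<psi> t z) = F 0 z"
      unfolding \<psi>_def o_def by (rule inv_into_into, rule f_inv_into_f)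
  qed
  have "hydrodynamic_chain \<Omega> (\<lambda>t w. F t (cayley_inv (w / of_real (A t) + of_real (b t))))
      (\<lambda>t w. of_real (A t) * (cayley (\<psi> t (cayley_inv w)) - of_real (b t))) (\<lambda>w. F 0 (cayley_inv w)) l"
  proof
    fix t :: real assume t: "0 \<le> t"
    let ?h = "\<lambda>w. w / of_real (A t) + of_real (b t) :: complex"
    have c: "(\<lambda>w. F t (cayley_inv (?h w))) = F t \<circ> (cayley_inv \<circ> ?h)" by (simp add: o_def)
    have im: "(cayley_inv \<circ> ?h) ` \<H> = \<D>"
      by (simp only: image_comp[symmetric] affine_half_plane(1)[OF A[OF t]] cayley_inv_image)
    show "(\<lambda>w. F t (cayley_inv (?h w))) ` \<H> = \<Omega> t"
      unfolding c image_comp[symmetric, of "F t"] im by (rule F(2)[OF t])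
    show "univalent_on \<H> (\<lambda>w. F t (cayley_inv (?h w)))"
      unfolding univalent_on_def c
    proof
      have h: "?h holomorphic_on \<H>" using A[OF t] by (intro holomorphic_intros) auto
      have "(cayley_inv \<circ> ?h) holomorphic_on \<H>"
        using h by (rule holomorphic_on_compose) (simp only: affine_half_plane(1)[OF A[OF t]] holomorphic_cayley_inv)
      then show "(F t \<circ> (cayley_inv \<circ> ?h)) holomorphic_on \<H>"
        by (rule holomorphic_on_compose) (use F(1)[OF t] im in \<open>simp add: univalent_on_def\<close>)
      have "inj_on (cayley_inv \<circ> ?h) \<H>"
        by (intro comp_inj_on affine_half_plane(2)[OF A[OF t]])
           (simp only: affine_half_plane(1)[OF A[OF t]] inj_on_cayley_inv)
      then show "inj_on (F t \<circ> (cayley_inv \<circ> ?h)) \<H>"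
        by (rule comp_inj_on) (use F(1)[OF t] im in \<open>simp add: univalent_on_def\<close>)
    qed
    show "F t (cayley_inv (of_real (A t) * (cayley (\<psi> t (cayley_inv z)) - of_real (b t)) / of_real (A t) + of_real (b t)))
        = F 0 (cayley_inv z)" if z: "0 < Im z" for z
      using \<psi>[OF t cayley_inv_in_disk[OF z]] A[OF t] by (simp add: cayley_inv_cayley del: mem_ball)
  qed (use mono hyd in \<open>auto simp: image_image[symmetric] cayley_inv_image F(2) simp del: image_image\<close>)
  then show ?thesis by (rule that)
qed

theorem theorem5p5:
  fixes \<Omega> :: "real \<Rightarrow> complex set"
  assumes "L_admissible \<Omega>"
  shows "(\<exists>\<phi> f. Goryainov_Ba \<phi> \<and> Loewner_chain f \<and> associated_with f \<phi> \<and>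
                {f t ` \<D> | t. t \<ge> 0} = {\<Omega> t | t. t \<ge> 0})
     \<longleftrightarrow>
         (\<exists>F :: real \<Rightarrow> complex \<Rightarrow> complex. \<forall>t\<ge>0.
                univalent_on \<D> (F t) \<and> F t ` \<D> = \<Omega> t \<and>
                inv_into \<D> (F t) \<circ> F 0 \<in> calC_tilde)"
proof -
  obtain d where "L_admissible_order d \<Omega>" using assms by (auto simp: L_admissible_def)
  then have mono: "\<And>s t. 0 \<le> s \<Longrightarrow> s \<le> t \<Longrightarrow> \<Omega> s \<subseteq> \<Omega> t"
    and "\<exists>w\<in>\<Omega> 0. AC_order d (\<lambda>t. conformal_radius (\<Omega> t) w)"
    unfolding L_admissible_order_def by blast+
  then obtain w where w: "w \<in> \<Omega> 0" "loc_abs_continuous (\<lambda>t. conformal_radius (\<Omega> t) w)"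
    by (auto simp: AC_order_def)
  show ?thesis
  proof
    assume "\<exists>\<phi> f. Goryainov_Ba \<phi> \<and> Loewner_chain f \<and> associated_with f \<phi> \<and>
                {f t ` \<D> | t. t \<ge> 0} = {\<Omega> t | t. t \<ge> 0}"
    then obtain \<phi> f where \<phi>: "Goryainov_Ba \<phi>" and f: "Loewner_chain f" and fa: "associated_with f \<phi>"
      "{f t ` \<D> | t. t \<ge> 0} = {\<Omega> t | t. t \<ge> 0}" by blast
    show "\<exists>F :: real \<Rightarrow> complex \<Rightarrow> complex. \<forall>t\<ge>0.
                univalent_on \<D> (F t) \<and> F t ` \<D> = \<Omega> t \<and> inv_into \<D> (F t) \<circ> F 0 \<in> calC_tilde"
    proof (rule condition_i_imp_ii[OF mono _ _ _ fa])
      show "\<phi> s t \<in> calP0" if "0 \<le> s" "s \<le> t" for s t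
        using \<phi> that by (simp add: Goryainov_Ba_def)
      obtain e where e: "Loewner_chain_order e f" using f by (auto simp: Loewner_chain_def)
      have fe: "\<forall>t\<ge>0. univalent_on \<D> (f t)" "\<forall>s t. 0 \<le> s \<and> s \<le> t \<longrightarrow> f s ` \<D> \<subseteq> f t ` \<D>"
        using e[unfolded Loewner_chain_order_def, THEN conjunct1]
          e[unfolded Loewner_chain_order_def, THEN conjunct2, THEN conjunct1] .
      show "univalent_on \<D> (f t)" if "0 \<le> t" for t
        using fe(1) that by simp
      show "f s ` \<D> \<subseteq> f t ` \<D>" if "0 \<le> s" "s \<le> t" for s t
        using fe(2)[THEN spec, THEN spec, THEN mp, OF conjI[OF that]] .
    qed
  next
    assume "\<exists>F :: real \<Rightarrow> complex \<Rightarrow> complex. \<forall>t\<ge>0.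
                univalent_on \<D> (F t) \<and> F t ` \<D> = \<Omega> t \<and> inv_into \<D> (F t) \<circ> F 0 \<in> calC_tilde"
    then obtain F :: "real \<Rightarrow> complex \<Rightarrow> complex" where F: "\<And>t. 0 \<le> t \<Longrightarrow> univalent_on \<D> (F t)"
      "\<And>t. 0 \<le> t \<Longrightarrow> F t ` \<D> = \<Omega> t" "\<And>t. 0 \<le> t \<Longrightarrow> inv_into \<D> (F t) \<circ> F 0 \<in> calC_tilde" by blast
    obtain G g E l where "hydrodynamic_chain \<Omega> G g E l"
      using condition_ii_imp_chain[of \<Omega> F, OF mono F] by blast
    then show "\<exists>\<phi> f. Goryainov_Ba \<phi> \<and> Loewner_chain f \<and> associated_with f \<phi> \<and>
                {f t ` \<D> | t. t \<ge> 0} = {\<Omega> t | t. t \<ge> 0}"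
      by (rule hydrodynamic_chain.exists_disk_chain[OF _ w(1) loc_abs_continuous_imp_continuous[OF w(2)]])
  qed
qed

end
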